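(* Let $T:L_\infty[0,1]\to L_\infty[0,1]$ be a bounded linear operator. Then $$\|T\|_w=\|T^*\|_w=\|T^{co}\|=\omega(T).$$
   Context: Scalars are real or complex; $[0,1]$ carries Lebesgue measure. Let $T:E\to F$ be an operator between Banach spaces, and let $B_E$ denote the unit ball of $E$. Weak essential norm: $\|T\|_w=\inf\{\|T-W\|: W:E\to F\text{ weakly compact}\}$, where an operator is weakly compact if it maps the unit ball to a relatively weakly compact set; $\|T^*\|_w$ is the same quantity for the adjoint $T^*:F^*\to E^*$. Residuum operator: $E^{co}=E^{**}/E$ (with the quotient norm) and $T^{co}:E^{co}\to F^{co}$ is given by $T^{co}(x+E)=T^{**}(x)+F$ for $x\in E^{**}$. De Blasi measure of weak noncompactness: for a bounded set $A\subseteq F$, $\omega(A)=\inf\{\varepsilon>0: A\subseteq D+\varepsilon B_F\text{ for some weakly compact } D\subseteq F\}$, and $\omega(T)=\omega(T[B_E])$. *)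

theory Defs
  imports "HOL-Analysis.Analysis" "HOL-Probability.Essential_Supremum"
begin

section \<open>Normed spaces over the scalars \<open>'k\<close>\<close>

text \<open>
  Dual spaces, second duals and quotients are needed over the real and over the complex scalars,
  so normed spaces are treated as carrier-based structures over a scalar type \<open>'k\<close> (to be
  instantiated by \<^typ>\<open>real\<close> or \<^typ>\<open>complex\<close>). The zero vector and negatives are obtained by
  scaling with \<open>0\<close> and \<open>-1\<close>.
\<close>

record ('k, 'a) nspace =
  vcarrier :: "'a set"
  vadd :: "'a \<Rightarrow> 'a \<Rightarrow> 'a"
  vscale :: "'k \<Rightarrow> 'a \<Rightarrow> 'a"
  vnorm :: "'a \<Rightarrow> real"

definition unit_ball :: "('k, 'a) nspace \<Rightarrow> 'a set" where
  "unit_ball E = {x \<in> vcarrier E. vnorm E x \<le> 1}"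

definition scalar_space :: "('k::real_normed_field, 'k) nspace" where
  "scalar_space = \<lparr>vcarrier = UNIV, vadd = (+), vscale = (*), vnorm = norm\<rparr>"

text \<open>
  The space of all bounded linear operators with the operator norm. Operators are functions
  that are \<open>undefined\<close> outside the carrier of their domain, so that equal operators are
  equal functions.
\<close>

definition bounded_ops ::
  "('k::real_normed_field, 'a) nspace \<Rightarrow> ('k, 'b) nspace \<Rightarrow> ('k, 'a \<Rightarrow> 'b) nspace" where
  "bounded_ops E F =
    \<lparr>vcarrier = {T \<in> vcarrier E \<rightarrow>\<^sub>E vcarrier F.
        (\<forall>x\<in>vcarrier E. \<forall>y\<in>vcarrier E. T (vadd E x y) = vadd F (T x) (T y)) \<and>
        (\<forall>c. \<forall>x\<in>vcarrier E. T (vscale E c x) = vscale F c (T x)) \<and>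
        (\<exists>C. \<forall>x\<in>vcarrier E. vnorm F (T x) \<le> C * vnorm E x)},
     vadd = (\<lambda>S T. \<lambda>x\<in>vcarrier E. vadd F (S x) (T x)),
     vscale = (\<lambda>c T. \<lambda>x\<in>vcarrier E. vscale F c (T x)),
     vnorm = (\<lambda>T. SUP x\<in>unit_ball E. vnorm F (T x))\<rparr>"

abbreviation op_norm ::
  "('k::real_normed_field, 'a) nspace \<Rightarrow> ('k, 'b) nspace \<Rightarrow> ('a \<Rightarrow> 'b) \<Rightarrow> real" where
  "op_norm E F \<equiv> vnorm (bounded_ops E F)"

definition vdiff :: "('k::real_normed_field, 'a) nspace \<Rightarrow> 'a \<Rightarrow> 'a \<Rightarrow> 'a" where
  "vdiff E x y = vadd E x (vscale E (- 1) y)"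


section \<open>Duality\<close>

definition dual :: "('k::real_normed_field, 'a) nspace \<Rightarrow> ('k, 'a \<Rightarrow> 'k) nspace" where
  "dual E = bounded_ops E scalar_space"

definition adjoint_op ::
  "('k::real_normed_field, 'a) nspace \<Rightarrow> ('k, 'b) nspace \<Rightarrow> ('a \<Rightarrow> 'b) \<Rightarrow> ('b \<Rightarrow> 'k) \<Rightarrow> ('a \<Rightarrow> 'k)" where
  "adjoint_op E F T = (\<lambda>g\<in>vcarrier (dual F). \<lambda>x\<in>vcarrier E. g (T x))"

abbreviation bidual :: "('k::real_normed_field, 'a) nspace \<Rightarrow> ('k, ('a \<Rightarrow> 'k) \<Rightarrow> 'k) nspace" where
  "bidual E \<equiv> dual (dual E)"

abbreviation biadjoint_op ::
  "('k::real_normed_field, 'a) nspace \<Rightarrow> ('k, 'b) nspace \<Rightarrow> ('a \<Rightarrow> 'b) \<Rightarrow>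
    (('a \<Rightarrow> 'k) \<Rightarrow> 'k) \<Rightarrow> (('b \<Rightarrow> 'k) \<Rightarrow> 'k)" where
  "biadjoint_op E F T \<equiv> adjoint_op (dual F) (dual E) (adjoint_op E F T)"

definition canonical_embedding ::
  "('k::real_normed_field, 'a) nspace \<Rightarrow> 'a \<Rightarrow> ('a \<Rightarrow> 'k) \<Rightarrow> 'k" where
  "canonical_embedding E x = (\<lambda>f\<in>vcarrier (dual E). f x)"

definition weak_topology :: "('k::real_normed_field, 'a) nspace \<Rightarrow> 'a topology" where
  "weak_topology E =
    topology_generated_by {{x \<in> vcarrier E. f x \<in> U} | f U. f \<in> vcarrier (dual E) \<and> open U}"


section \<open>Weakly compact operators and the weak essential norm\<close>

definition relatively_weakly_compact :: "('k::real_normed_field, 'a) nspace \<Rightarrow> 'a set \<Rightarrow> bool" where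
  "relatively_weakly_compact E A \<longleftrightarrow>
    A \<subseteq> vcarrier E \<and> compactin (weak_topology E) (weak_topology E closure_of A)"

definition weakly_compact_op ::
  "('k::real_normed_field, 'a) nspace \<Rightarrow> ('k, 'b) nspace \<Rightarrow> ('a \<Rightarrow> 'b) \<Rightarrow> bool" where
  "weakly_compact_op E F W \<longleftrightarrow>
    W \<in> vcarrier (bounded_ops E F) \<and> relatively_weakly_compact F (W ` unit_ball E)"

definition weak_essential_norm ::
  "('k::real_normed_field, 'a) nspace \<Rightarrow> ('k, 'b) nspace \<Rightarrow> ('a \<Rightarrow> 'b) \<Rightarrow> real" where
  "weak_essential_norm E F T =
    Inf {op_norm E F (vdiff (bounded_ops E F) T W) | W. weakly_compact_op E F W}"


section \<open>The residuum operator\<close>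

definition coset :: "('k, 'a) nspace \<Rightarrow> 'a set \<Rightarrow> 'a \<Rightarrow> 'a set" where
  "coset X M x = {vadd X x m | m. m \<in> M}"

text \<open>
  Adding \<open>M\<close> in the scalar multiplication of \<open>X/M\<close> is needed for the scalar \<open>0\<close> only:
  the product must be the coset \<open>M\<close> and not the singleton of the zero vector.
\<close>

definition quotient_space :: "('k, 'a) nspace \<Rightarrow> 'a set \<Rightarrow> ('k, 'a set) nspace" where
  "quotient_space X M =
    \<lparr>vcarrier = coset X M ` vcarrier X,
     vadd = (\<lambda>A B. {vadd X a b | a b. a \<in> A \<and> b \<in> B}),
     vscale = (\<lambda>c A. \<Union>a\<in>A. coset X M (vscale X c a)),
     vnorm = (\<lambda>A. INF a\<in>A. vnorm X a)\<rparr>"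

abbreviation embedded :: "('k::real_normed_field, 'a) nspace \<Rightarrow> (('a \<Rightarrow> 'k) \<Rightarrow> 'k) set" where
  "embedded E \<equiv> canonical_embedding E ` vcarrier E"

definition residuum ::
  "('k::real_normed_field, 'a) nspace \<Rightarrow> ('k, (('a \<Rightarrow> 'k) \<Rightarrow> 'k) set) nspace" where
  "residuum E = quotient_space (bidual E) (embedded E)"

text \<open>
  The union over all representatives is the single coset of \<open>T\<^sup>*\<^sup>* x\<close>, because
  \<open>T\<^sup>*\<^sup>*\<close> maps the copy of \<open>E\<close> in its second dual into that of \<open>F\<close>.
\<close>

definition residuum_op ::
  "('k::real_normed_field, 'a) nspace \<Rightarrow> ('k, 'b) nspace \<Rightarrow> ('a \<Rightarrow> 'b) \<Rightarrow>
    (('a \<Rightarrow> 'k) \<Rightarrow> 'k) set \<Rightarrow> (('b \<Rightarrow> 'k) \<Rightarrow> 'k) set" where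
  "residuum_op E F T =
    (\<lambda>A\<in>vcarrier (residuum E). \<Union>x\<in>A. coset (bidual F) (embedded F) (biadjoint_op E F T x))"


section \<open>The De Blasi measure of weak noncompactness\<close>

definition de_blasi :: "('k::real_normed_field, 'a) nspace \<Rightarrow> 'a set \<Rightarrow> real" where
  "de_blasi F A = Inf {\<epsilon>. \<epsilon> > 0 \<and> (\<exists>D. compactin (weak_topology F) D \<and>
    A \<subseteq> {vadd F d (vscale F (of_real \<epsilon>) b) | d b. d \<in> D \<and> b \<in> unit_ball F})}"

definition de_blasi_op ::
  "('k::real_normed_field, 'a) nspace \<Rightarrow> ('k, 'b) nspace \<Rightarrow> ('a \<Rightarrow> 'b) \<Rightarrow> real" where
  "de_blasi_op E F T = de_blasi F (T ` unit_ball E)"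


section \<open>The space of essentially bounded functions modulo null functions\<close>

definition ess_norm :: "'x measure \<Rightarrow> ('x \<Rightarrow> 'k::real_normed_field) \<Rightarrow> ereal" where
  "ess_norm M f = esssup M (\<lambda>x. ereal (norm (f x)))"

definition ess_bounded :: "'x measure \<Rightarrow> ('x \<Rightarrow> 'k::real_normed_field) set" where
  "ess_bounded M = {f \<in> borel_measurable M. ess_norm M f < \<infinity>}"

definition ae_equal :: "'x measure \<Rightarrow> (('x \<Rightarrow> 'k::real_normed_field) \<times> ('x \<Rightarrow> 'k)) set" where
  "ae_equal M = {(f, g). f \<in> ess_bounded M \<and> g \<in> ess_bounded M \<and> (AE x in M. f x = g x)}"

text \<open>
  For \<open>f \<in> A\<close> and \<open>g \<in> B\<close> the image of \<open>f + g\<close> under \<^term>\<open>ae_equal M\<close> is the class of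
  \<open>f + g\<close>, which does not depend on the representatives; similarly for scalar multiples and norms.
\<close>

definition L_infty :: "'x measure \<Rightarrow> ('k::real_normed_field, ('x \<Rightarrow> 'k) set) nspace" where
  "L_infty M =
    \<lparr>vcarrier = ess_bounded M // ae_equal M,
     vadd = (\<lambda>A B. \<Union>f\<in>A. \<Union>g\<in>B. ae_equal M `` {\<lambda>x. f x + g x}),
     vscale = (\<lambda>c A. \<Union>f\<in>A. ae_equal M `` {\<lambda>x. c * f x}),
     vnorm = (\<lambda>A. real_of_ereal (the_elem (ess_norm M ` A)))\<rparr>"

text \<open>
  A function on \<open>[0,1]\<close> is represented by a function on \<^typ>\<open>real\<close>; its values outside
  \<open>[0,1]\<close> are irrelevant, since functions agreeing almost everywhere on \<open>[0,1]\<close> are identified.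
\<close>

abbreviation L_infty_01 :: "('k::real_normed_field, (real \<Rightarrow> 'k) set) nspace" where
  "L_infty_01 \<equiv> L_infty (lebesgue_on {0..1})"

end

theory Submission
  imports Defs
begin

text \<open>
  Write \<open>E\<close> for the space of essentially bounded functions, \<open>T\<close> for an operator on \<open>E\<close>,
  \<open>w(T)\<close> for its weak essential norm, \<open>R(T)\<close> for the norm of its residuum operator, \<open>\<omega>(T)\<close> for its
  De Blasi measure and \<open>T'\<close> for its adjoint. The equalities come from two cycles of inequalities,
  \<open>R(T) \<le> \<omega>(T) \<le> w(T) \<le> R(T)\<close> and \<open>w(T') \<le> w(T) \<le> w(T')\<close>.

  Three of them hold between arbitrary normed spaces. If \<open>T\<close> maps the unit ball into \<open>D + \<epsilon>B\<close> with \<open>D\<close>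
  weakly compact, then Goldstine's theorem and the compactness of \<open>D\<close> show that \<open>T''\<close> maps the unit
  ball of the bidual into \<open>D + \<epsilon>B\<close> as well (\<open>bidual_near_weakly_compact\<close>), so \<open>R(T) \<le> \<epsilon>\<close>;
  for weakly compact \<open>W\<close> the weak closure of the image of the unit ball under \<open>W\<close> is such a \<open>D\<close> for
  every positive \<open>\<epsilon> \<ge> \<parallel>T - W\<parallel>\<close>, so \<open>\<omega>(T) \<le> w(T)\<close>; and \<open>w(T') \<le> w(T)\<close> is Gantmacher's theorem.

  The other two rest on the fact that \<open>E\<close> is injective with constant one (\<open>L_infty_injective\<close>): an
  operator into \<open>E\<close> that is defined on a subspace and dominated there by a seminorm has a dominated
  extension. Applied to the inverse of the canonical embedding this gives a projection \<open>P\<close> of norm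
  one from the bidual of \<open>E\<close> onto \<open>E\<close>. A weakly compact perturbation \<open>W\<close> of \<open>T'\<close> then yields the
  weakly compact perturbation \<open>P \<circ> W' \<circ> \<iota>\<close> of \<open>T\<close>, at no greater distance, where \<open>\<iota>\<close> embeds \<open>E\<close>;
  thus \<open>w(T) \<le> w(T')\<close>.

  The heart is \<open>w(T) \<le> R(T)\<close>. Fix a level \<open>r\<close> and ask whether there is a charge \<open>\<mu>\<close>, that is a
  positive finitely additive integral that ignores null sets, such that
  \<open>\<parallel>T x\<parallel> \<le> \<mu>(\<bar>x\<bar>) + r\<parallel>x\<parallel>\<close> for all \<open>x\<close>. If there is, injectivity, applied to the operator
  \<open>(x, x) \<mapsto> T x\<close> on the diagonal of \<open>E \<times> E\<close> with the seminorm \<open>\<mu>(\<bar>x\<bar>) + r\<parallel>y\<parallel>\<close>, splits \<open>T = W + S\<close>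
  with \<open>\<parallel>W x\<parallel> \<le> \<mu>(\<bar>x\<bar>)\<close> and \<open>\<parallel>S\<parallel> \<le> r\<close> (\<open>L_infty_operator_decomposition\<close>). The operator \<open>W\<close> is
  weakly compact because \<open>\<mu>(\<bar>x\<bar>)\<close> is controlled by the Hilbertian seminorm \<open>\<mu>(\<bar>x\<bar>\<^sup>2)\<close>
  (\<open>weakly_compact_op_if_charge_dominated\<close>), so \<open>w(T) \<le> r\<close>. If there is no such charge, a gliding
  hump argument produces functions \<open>f\<^sub>n\<close> in the unit ball with disjoint supports and functionals
  \<open>g\<^sub>n\<close> in the dual unit ball with \<open>Re g\<^sub>n(T f\<^sub>n) > r - \<epsilon>\<close> and with almost no interaction between
  different indices (\<open>disjoint_bump_sequence\<close>, \<open>interpolating_sequence\<close>). The weak-star sum \<open>x\<close> of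
  the series of the \<open>f\<^sub>n\<close> in the bidual satisfies \<open>\<parallel>2x - G\<parallel> \<le> 1\<close> for the pointwise sum
  \<open>G \<in> E\<close>, because partial sums of \<open>2f\<^sub>n\<close> minus \<open>G\<close> only change signs. So the coset of \<open>2x\<close> lies in
  the unit ball of the residuum, while \<open>T''(2x)\<close> has distance at least about \<open>r\<close> from \<open>E\<close>: it
  separates \<open>g\<^sub>n\<close> from a cluster point of the sequence by \<open>2r\<close>, and elements of \<open>E\<close> do not. Hence
  \<open>R(T) \<ge> r\<close> (\<open>residuum_norm_ge_if_not_dominated\<close>).
\<close>

section \<open>Scalars\<close>

text \<open>
  The real and the complex case are treated together: a normed field that is also a Euclidean space
  carries the real part \<open>a \<bullet> 1\<close>, and the formula below is the complex conjugate of \<open>a\<close> (and \<open>a\<close>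
  itself over the reals), because \<open>2 Re a - a\<close> is.
\<close>

definition cj :: "'k::{real_normed_field,euclidean_space} \<Rightarrow> 'k" where
  "cj a = (2 * (a \<bullet> 1)) *\<^sub>R 1 - a"

lemma inner_mult_mult:
  fixes x y a :: "'k::{real_normed_field,euclidean_space}"
  shows "(x * a) \<bullet> (y * a) = (norm a)\<^sup>2 * (x \<bullet> y)"
proof -
  have sq: "(z * a) \<bullet> (z * a) = (norm a)\<^sup>2 * (z \<bullet> z)" for z
    by (simp add: dot_square_norm norm_mult power_mult_distrib)
  have "2 * ((x * a) \<bullet> (y * a)) = 2 * ((norm a)\<^sup>2 * (x \<bullet> y))"
    using sq[of "x + y"] sq[of x] sq[of y]
    by (simp add: distrib_right inner_add_left inner_add_right inner_commute algebra_simps)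
  then show ?thesis by simp
qed

text \<open>
  This adjointness is what conjugation is needed for: \<open>Re (cj a * z)\<close> is the inner product of \<open>a\<close>
  and \<open>z\<close>. It comes from \<open>inner_mult_mult\<close> by replacing \<open>b\<close> with \<open>b + 1\<close>.
\<close>

lemma inner_cj:
  fixes z a b :: "'k::{real_normed_field,euclidean_space}"
  shows "(cj b * z) \<bullet> a = z \<bullet> (b * a)"
proof -
  have n: "(norm (b + 1))\<^sup>2 = (norm b)\<^sup>2 + 2 * (b \<bullet> 1) + 1"
    by (simp add: power2_norm_eq_inner inner_add_left inner_add_right inner_commute)
       (simp add: dot_square_norm)
  have "(z * b) \<bullet> a + z \<bullet> (a * b) = 2 * (b \<bullet> 1) * (z \<bullet> a)"
    using inner_mult_mult[of z "b + 1" a] inner_mult_mult[of z b a] n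
    by (simp add: distrib_left inner_add_left inner_add_right algebra_simps)
  then show ?thesis
    by (simp add: cj_def left_diff_distrib inner_diff_left mult.commute[of _ b])
qed

lemma inner_cj_1: "(cj b * z) \<bullet> 1 = z \<bullet> b"
  by (simp add: inner_cj)

text \<open>
  A scalar is determined by the real parts of its multiples; this reduces the algebra of conjugates to
  \<open>inner_cj\<close>.
\<close>

lemma inner_mult_1_eq_imp_eq:
  fixes u v :: "'k::{real_normed_field,euclidean_space}"
  assumes "\<And>z. (u * z) \<bullet> 1 = (v * z) \<bullet> 1"
  shows "u = v"
proof (rule ccontr)
  assume "u \<noteq> v"
  then have "((u - v) * inverse (u - v)) \<bullet> 1 = 1"
    by (simp add: dot_square_norm)
  moreover have "((u - v) * inverse (u - v)) \<bullet> 1 = 0"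
    using assms[of "inverse (u - v)"] by (simp add: left_diff_distrib inner_diff_left)
  ultimately show False by simp
qed

lemma cj_mult: "cj (a * b) = cj a * cj b"
proof (rule inner_mult_1_eq_imp_eq)
  fix z
  have "(cj a * cj b * z) \<bullet> 1 = (cj b * z) \<bullet> a"
    by (simp add: mult.assoc inner_cj_1)
  also have "\<dots> = z \<bullet> (a * b)"
    by (simp only: inner_cj mult.commute[of b a])
  also have "\<dots> = (cj (a * b) * z) \<bullet> 1"
    by (simp add: inner_cj_1)
  finally show "(cj (a * b) * z) \<bullet> 1 = (cj a * cj b * z) \<bullet> 1" ..
qed

lemma cj_cj [simp]: "cj (cj a) = a"
  by (simp add: cj_def inner_diff_left dot_square_norm)

lemma cj_add: "cj (a + b) = cj a + cj b"
  by (simp add: cj_def inner_add_left scaleR_add_left algebra_simps)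

lemma cj_scaleR: "cj (r *\<^sub>R a) = r *\<^sub>R cj a"
  by (simp add: cj_def scaleR_diff_right algebra_simps)

lemma cj_mult_self: "cj a * a = of_real ((norm a)\<^sup>2)"
proof (rule inner_mult_1_eq_imp_eq)
  fix z
  have "(cj a * a * z) \<bullet> 1 = (z * a) \<bullet> (1 * a)"
    by (simp add: mult.assoc inner_cj_1 mult.commute[of z])
  also have "\<dots> = (of_real ((norm a)\<^sup>2) * z) \<bullet> 1"
    by (simp only: inner_mult_mult flip: scaleR_conv_of_real) simp
  finally show "(cj a * a * z) \<bullet> 1 = (of_real ((norm a)\<^sup>2) * z) \<bullet> 1" .
qed

lemma norm_cj [simp]: "norm (cj a) = norm a"
proof (cases "a = 0")
  case True then show ?thesis by (simp add: cj_def)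
next
  case False
  have "norm (cj a) * norm a = norm a * norm a"
    using arg_cong[OF cj_mult_self[of a], of norm] by (simp add: norm_mult power2_eq_square)
  with False show ?thesis by simp
qed

lemma re_le_norm: "(z::'k::{real_normed_field,euclidean_space}) \<bullet> 1 \<le> norm z"
  using norm_cauchy_schwarz[of z 1] by simp

lemma abs_re_le_norm: "\<bar>(z::'k::{real_normed_field,euclidean_space}) \<bullet> 1\<bar> \<le> norm z"
  using Cauchy_Schwarz_ineq2[of z 1] by simp

text \<open>
  The unimodular scalar that rotates \<open>a\<close> onto \<open>\<bar>a\<bar>\<close>; the value at zero keeps it unimodular.
\<close>

definition csgn :: "'k::{real_normed_field,euclidean_space} \<Rightarrow> 'k" where
  "csgn a = (if a = 0 then 1 else cj a / of_real (norm a))"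

lemma norm_csgn [simp]: "norm (csgn a) = 1"
  by (simp add: csgn_def norm_divide)

lemma csgn_mult_self: "csgn a * a = of_real (norm a)"
  by (simp add: csgn_def cj_mult_self power2_eq_square)

lemma re_of_real [simp]: "(of_real r :: 'k::{real_normed_field,euclidean_space}) \<bullet> 1 = r"
  by (simp add: of_real_def dot_square_norm)

lemma re_csgn_mult: "(csgn a * a) \<bullet> 1 = norm a"
  by (simp add: csgn_mult_self)


section \<open>Seminormed spaces and bounded operators\<close>

text \<open>
  Seminorms are allowed because Hahn--Banach and injectivity are applied to seminorms that need not
  separate points. The zero vector is the common value of \<open>vscale E 0 x\<close>.
\<close>

locale seminormed_space =
  fixes E :: "('k::{real_normed_field,euclidean_space}, 'a) nspace"
  assumes nonempty: "vcarrier E \<noteq> {}"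
    and add_closed [simp, intro]: "\<lbrakk>x \<in> vcarrier E; y \<in> vcarrier E\<rbrakk> \<Longrightarrow> vadd E x y \<in> vcarrier E"
    and scale_closed [simp, intro]: "x \<in> vcarrier E \<Longrightarrow> vscale E c x \<in> vcarrier E"
    and add_assoc: "\<lbrakk>x \<in> vcarrier E; y \<in> vcarrier E; z \<in> vcarrier E\<rbrakk>
      \<Longrightarrow> vadd E (vadd E x y) z = vadd E x (vadd E y z)"
    and add_comm: "\<lbrakk>x \<in> vcarrier E; y \<in> vcarrier E\<rbrakk> \<Longrightarrow> vadd E x y = vadd E y x"
    and add_scale_0: "\<lbrakk>x \<in> vcarrier E; y \<in> vcarrier E\<rbrakk> \<Longrightarrow> vadd E x (vscale E 0 y) = x"
    and scale_one [simp]: "x \<in> vcarrier E \<Longrightarrow> vscale E 1 x = x"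
    and scale_scale: "x \<in> vcarrier E \<Longrightarrow> vscale E c (vscale E d x) = vscale E (c * d) x"
    and scale_add_right: "\<lbrakk>x \<in> vcarrier E; y \<in> vcarrier E\<rbrakk>
      \<Longrightarrow> vscale E c (vadd E x y) = vadd E (vscale E c x) (vscale E c y)"
    and scale_add_left: "x \<in> vcarrier E \<Longrightarrow> vscale E (c + d) x = vadd E (vscale E c x) (vscale E d x)"
    and norm_scale: "x \<in> vcarrier E \<Longrightarrow> vnorm E (vscale E c x) = norm c * vnorm E x"
    and norm_add_le: "\<lbrakk>x \<in> vcarrier E; y \<in> vcarrier E\<rbrakk>
      \<Longrightarrow> vnorm E (vadd E x y) \<le> vnorm E x + vnorm E y"
begin

definition vzero :: 'a where
  "vzero = vscale E 0 (SOME x. x \<in> vcarrier E)"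

lemma some_in: "(SOME x. x \<in> vcarrier E) \<in> vcarrier E"
  using nonempty by (simp add: some_in_eq)

lemma zero_closed [simp, intro]: "vzero \<in> vcarrier E"
  unfolding vzero_def using some_in by blast

lemma scale_0: "x \<in> vcarrier E \<Longrightarrow> vscale E 0 x = vzero"
  unfolding vzero_def
  by (metis add_comm add_scale_0 scale_closed some_in)

lemma add_zero [simp]: "x \<in> vcarrier E \<Longrightarrow> vadd E x vzero = x"
  unfolding vzero_def using add_scale_0 some_in by blast

lemma zero_add [simp]: "x \<in> vcarrier E \<Longrightarrow> vadd E vzero x = x"
  by (metis add_comm add_zero zero_closed)

lemma norm_zero [simp]: "vnorm E vzero = 0"
  using norm_scale[of vzero 0] by (simp add: scale_0)

lemma scale_zero [simp]: "vscale E c vzero = vzero"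
  using scale_scale[of vzero c 0] by (simp add: scale_0)

lemma add_neg: "x \<in> vcarrier E \<Longrightarrow> vadd E x (vscale E (- 1) x) = vzero"
  using scale_add_left[of x 1 "- 1"] by (simp add: scale_0)

lemma norm_nonneg [simp]: "x \<in> vcarrier E \<Longrightarrow> 0 \<le> vnorm E x"
  using norm_add_le[of x "vscale E (- 1) x"] norm_scale[of x "- 1"] by (simp add: add_neg)

lemma diff_closed [simp, intro]: "\<lbrakk>x \<in> vcarrier E; y \<in> vcarrier E\<rbrakk> \<Longrightarrow> vdiff E x y \<in> vcarrier E"
  by (simp add: vdiff_def)

lemma add_left_commute:
  "\<lbrakk>x \<in> vcarrier E; y \<in> vcarrier E; z \<in> vcarrier E\<rbrakk>
    \<Longrightarrow> vadd E x (vadd E y z) = vadd E y (vadd E x z)"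
  by (metis add_assoc add_comm)

lemma diff_add_cancel: "\<lbrakk>x \<in> vcarrier E; y \<in> vcarrier E\<rbrakk> \<Longrightarrow> vadd E (vdiff E x y) y = x"
proof -
  assume x: "x \<in> vcarrier E" and y: "y \<in> vcarrier E"
  have "vadd E (vadd E x (vscale E (- 1) y)) y = vadd E x (vadd E y (vscale E (- 1) y))"
    using x y by (simp add: add_assoc add_comm[of "vscale E (- 1) y" y])
  then show ?thesis using x y by (simp add: vdiff_def add_neg)
qed

lemma add_diff_cancel: "\<lbrakk>x \<in> vcarrier E; y \<in> vcarrier E\<rbrakk> \<Longrightarrow> vadd E y (vdiff E x y) = x"
  by (metis add_comm diff_add_cancel diff_closed)

lemma norm_diff_le: "\<lbrakk>x \<in> vcarrier E; y \<in> vcarrier E\<rbrakk> \<Longrightarrow> vnorm E (vdiff E x y) \<le> vnorm E x + vnorm E y"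
  using norm_add_le[of x "vscale E (- 1) y"] by (simp add: vdiff_def norm_scale)

lemma zero_in_ball [simp]: "vzero \<in> unit_ball E"
  by (simp add: unit_ball_def)

lemma ball_closed: "x \<in> unit_ball E \<Longrightarrow> x \<in> vcarrier E"
  by (simp add: unit_ball_def)

lemma ball_scale: "\<lbrakk>x \<in> unit_ball E; norm c \<le> 1\<rbrakk> \<Longrightarrow> vscale E c x \<in> unit_ball E"
  by (simp add: unit_ball_def norm_scale mult_le_one)

lemma ball_convex:
  assumes "x \<in> unit_ball E" "y \<in> unit_ball E" "0 \<le> t" "t \<le> 1"
  shows "vadd E (vscale E (of_real (1 - t)) x) (vscale E (of_real t) y) \<in> unit_ball E"
proof -
  have x: "x \<in> vcarrier E" "vnorm E x \<le> 1" and y: "y \<in> vcarrier E" "vnorm E y \<le> 1"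
    using assms by (auto simp: unit_ball_def)
  have "vnorm E (vadd E (vscale E (of_real (1 - t)) x) (vscale E (of_real t) y))
      \<le> norm (of_real (1 - t) :: 'k) * vnorm E x + norm (of_real t :: 'k) * vnorm E y"
    using norm_add_le[of "vscale E (of_real (1 - t)) x" "vscale E (of_real t) y"] x y
    by (simp add: norm_scale)
  also have "\<dots> \<le> (1 - t) * 1 + t * 1"
    using x y assms by (intro add_mono mult_mono) (auto simp: norm_of_real simp del: of_real_diff)
  finally show ?thesis using x y by (simp add: unit_ball_def)
qed

end

lemma scalar_space_sel [simp]:
  "vcarrier scalar_space = UNIV" "vadd scalar_space = (+)" "vscale scalar_space = (*)"
  "vnorm scalar_space = norm"
  by (simp_all add: scalar_space_def)

lemma seminormed_scalar_space:
  "seminormed_space (scalar_space :: ('k::{real_normed_field,euclidean_space}, 'k) nspace)"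
  by unfold_locales (auto simp: algebra_simps norm_mult norm_triangle_ineq)

lemma bounded_ops_sel:
  "vadd (bounded_ops E F) S T = (\<lambda>x\<in>vcarrier E. vadd F (S x) (T x))"
  "vscale (bounded_ops E F) c T = (\<lambda>x\<in>vcarrier E. vscale F c (T x))"
  "vnorm (bounded_ops E F) T = (SUP x\<in>unit_ball E. vnorm F (T x))"
  by (simp_all add: bounded_ops_def)

lemma bounded_ops_iff:
  "T \<in> vcarrier (bounded_ops E F) \<longleftrightarrow> T \<in> vcarrier E \<rightarrow>\<^sub>E vcarrier F \<and>
        (\<forall>x\<in>vcarrier E. \<forall>y\<in>vcarrier E. T (vadd E x y) = vadd F (T x) (T y)) \<and>
        (\<forall>c. \<forall>x\<in>vcarrier E. T (vscale E c x) = vscale F c (T x)) \<and>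
        (\<exists>C. \<forall>x\<in>vcarrier E. vnorm F (T x) \<le> C * vnorm E x)"
  by (simp add: bounded_ops_def)

lemma bounded_opsI:
  assumes "T \<in> extensional (vcarrier E)"
    "\<And>x. x \<in> vcarrier E \<Longrightarrow> T x \<in> vcarrier F"
    "\<And>x y. x \<in> vcarrier E \<Longrightarrow> y \<in> vcarrier E \<Longrightarrow> T (vadd E x y) = vadd F (T x) (T y)"
    "\<And>c x. x \<in> vcarrier E \<Longrightarrow> T (vscale E c x) = vscale F c (T x)"
    "\<And>x. x \<in> vcarrier E \<Longrightarrow> vnorm F (T x) \<le> C * vnorm E x"
  shows "T \<in> vcarrier (bounded_ops E F)"
  using assms unfolding bounded_ops_iff by (auto simp: PiE_def intro!: exI[of _ C])

lemma bounded_opsD: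
  assumes "T \<in> vcarrier (bounded_ops E F)"
  shows bops_closed: "x \<in> vcarrier E \<Longrightarrow> T x \<in> vcarrier F"
    and bops_add: "x \<in> vcarrier E \<Longrightarrow> y \<in> vcarrier E \<Longrightarrow> T (vadd E x y) = vadd F (T x) (T y)"
    and bops_scale: "x \<in> vcarrier E \<Longrightarrow> T (vscale E c x) = vscale F c (T x)"
    and bops_ext: "T \<in> extensional (vcarrier E)"
  using assms unfolding bounded_ops_iff by (auto simp: PiE_def)

lemma bops_diff:
  assumes "T \<in> vcarrier (bounded_ops E F)" "seminormed_space E" "x \<in> vcarrier E" "y \<in> vcarrier E"
  shows "T (vdiff E x y) = vdiff F (T x) (T y)"
proof -
  interpret seminormed_space E by fact
  show ?thesis using assms by (simp add: vdiff_def bops_add bops_scale)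
qed

lemma bops_norm_bdd:
  assumes "T \<in> vcarrier (bounded_ops E F)" "seminormed_space E"
  shows "bdd_above ((\<lambda>x. vnorm F (T x)) ` unit_ball E)"
proof -
  interpret seminormed_space E by fact
  obtain C where C: "\<And>x. x \<in> vcarrier E \<Longrightarrow> vnorm F (T x) \<le> C * vnorm E x"
    using assms unfolding bounded_ops_iff by blast
  have "vnorm F (T x) \<le> \<bar>C\<bar>" if "x \<in> unit_ball E" for x
  proof -
    have x: "x \<in> vcarrier E" using that by (rule ball_closed)
    have "vnorm F (T x) \<le> C * vnorm E x" using x C by simp
    also have "\<dots> \<le> \<bar>C\<bar> * vnorm E x" using x by (intro mult_right_mono) auto
    also have "\<dots> \<le> \<bar>C\<bar> * 1" using that by (intro mult_left_mono) (auto simp: unit_ball_def)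
    finally show ?thesis by simp
  qed
  then show ?thesis by (intro bdd_aboveI[of _ "\<bar>C\<bar>"]) auto
qed

lemma op_norm_ball:
  assumes "T \<in> vcarrier (bounded_ops E F)" "seminormed_space E" "x \<in> unit_ball E"
  shows "vnorm F (T x) \<le> op_norm E F T"
  unfolding bounded_ops_sel using bops_norm_bdd[OF assms(1,2)] assms(3) by (rule cSUP_upper2) simp

lemma op_norm_nonneg:
  assumes "T \<in> vcarrier (bounded_ops E F)" "seminormed_space E" "seminormed_space F"
  shows "0 \<le> op_norm E F T"
proof -
  interpret E: seminormed_space E by fact
  interpret F: seminormed_space F by fact
  have "0 \<le> vnorm F (T E.vzero)" by (intro F.norm_nonneg bops_closed[OF assms(1)] E.zero_closed)
  also have "\<dots> \<le> op_norm E F T" by (intro op_norm_ball[OF assms(1,2)] E.zero_in_ball)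
  finally show ?thesis .
qed

lemma op_norm_bound:
  assumes T: "T \<in> vcarrier (bounded_ops E F)" and "seminormed_space E" "seminormed_space F"
    and x: "x \<in> vcarrier E"
  shows "vnorm F (T x) \<le> op_norm E F T * vnorm E x"
proof -
  interpret E: seminormed_space E by fact
  interpret F: seminormed_space F by fact
  show ?thesis
  proof (cases "vnorm E x = 0")
    case True
    obtain C where C: "\<And>x. x \<in> vcarrier E \<Longrightarrow> vnorm F (T x) \<le> C * vnorm E x"
      using T unfolding bounded_ops_iff by blast
    then show ?thesis using C[OF x] True by simp
  next
    case False
    then have pos: "vnorm E x > 0" using E.norm_nonneg[OF x] by simp
    define u where "u = vscale E (of_real (inverse (vnorm E x))) x"
    have "u \<in> unit_ball E" using x pos by (simp add: u_def unit_ball_def E.norm_scale norm_inverse)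
    then have "vnorm F (T u) \<le> op_norm E F T" by (rule op_norm_ball[OF assms(1,2)])
    moreover have "vnorm F (T u) = inverse (vnorm E x) * vnorm F (T x)"
      using T x pos by (simp add: u_def bops_scale F.norm_scale bops_closed[OF T] norm_inverse)
    ultimately show ?thesis using pos by (simp add: field_simps)
  qed
qed

lemma op_norm_le:
  assumes "seminormed_space E" "\<And>x. x \<in> unit_ball E \<Longrightarrow> vnorm F (T x) \<le> C"
  shows "op_norm E F T \<le> C"
proof -
  interpret seminormed_space E by fact
  show ?thesis unfolding bounded_ops_sel using assms(2) zero_in_ball by (intro cSUP_least) blast+
qed

lemma op_norm_le':
  assumes "seminormed_space E" "\<And>x. x \<in> vcarrier E \<Longrightarrow> vnorm F (T x) \<le> C * vnorm E x" "0 \<le> C"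
  shows "op_norm E F T \<le> C"
proof (rule op_norm_le[OF assms(1)])
  fix x assume "x \<in> unit_ball E"
  then have "vnorm F (T x) \<le> C * vnorm E x" "vnorm E x \<le> 1" using assms(2) by (auto simp: unit_ball_def)
  then show "vnorm F (T x) \<le> C" using mult_left_le[of "vnorm E x" C] assms(3) by linarith
qed

lemma seminormed_bounded_ops:
  assumes "seminormed_space E" "seminormed_space F"
  shows "seminormed_space (bounded_ops E F)"
proof -
  interpret E: seminormed_space E by fact
  interpret F: seminormed_space F by fact
  have add: "(\<lambda>x\<in>vcarrier E. vadd F (S x) (T x)) \<in> vcarrier (bounded_ops E F)"
    if S: "S \<in> vcarrier (bounded_ops E F)" and T: "T \<in> vcarrier (bounded_ops E F)" for S T
  proof (rule bounded_opsI)
    show "vnorm F ((\<lambda>x\<in>vcarrier E. vadd F (S x) (T x)) x)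
        \<le> (op_norm E F S + op_norm E F T) * vnorm E x" if x: "x \<in> vcarrier E" for x
      using F.norm_add_le[of "S x" "T x"] op_norm_bound[OF S assms x] op_norm_bound[OF T assms x]
        bops_closed[OF S x] bops_closed[OF T x] x
      by (simp add: algebra_simps)
  qed (use S T in \<open>auto simp: bops_closed[OF S] bops_closed[OF T] bops_add[OF S] bops_add[OF T]
      bops_scale[OF S] bops_scale[OF T] F.scale_add_right F.add_assoc F.add_left_commute\<close>)
  have scale: "(\<lambda>x\<in>vcarrier E. vscale F c (T x)) \<in> vcarrier (bounded_ops E F)"
    if T: "T \<in> vcarrier (bounded_ops E F)" for c T
  proof (rule bounded_opsI)
    show "vnorm F ((\<lambda>x\<in>vcarrier E. vscale F c (T x)) x)
        \<le> (norm c * op_norm E F T) * vnorm E x" if x: "x \<in> vcarrier E" for x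
      using op_norm_bound[OF T assms x] bops_closed[OF T x] x mult_left_mono[of _ _ "norm c"]
      by (simp add: F.norm_scale mult.assoc)
  qed (use T in \<open>auto simp: bops_closed[OF T] bops_add[OF T] bops_scale[OF T]
      F.scale_add_right F.scale_scale mult.commute\<close>)
  have zero: "(\<lambda>x\<in>vcarrier E. F.vzero) \<in> vcarrier (bounded_ops E F)"
    by (rule bounded_opsI[where C = 0]) auto
  show ?thesis
  proof
    show "vcarrier (bounded_ops E F) \<noteq> {}" using zero by blast
  next
    fix S T assume S: "S \<in> vcarrier (bounded_ops E F)" and T: "T \<in> vcarrier (bounded_ops E F)"
    show "vadd (bounded_ops E F) S T \<in> vcarrier (bounded_ops E F)"
      using add[OF S T] by (simp add: bounded_ops_sel)
    show "vadd (bounded_ops E F) S T = vadd (bounded_ops E F) T S"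
      by (rule extensionalityI[of _ "vcarrier E"])
         (auto simp: bounded_ops_sel bops_closed[OF S] bops_closed[OF T] intro: F.add_comm)
    show "vadd (bounded_ops E F) S (vscale (bounded_ops E F) 0 T) = S"
      by (rule extensionalityI[of _ "vcarrier E"])
         (auto simp: bounded_ops_sel bops_closed[OF S] bops_closed[OF T] F.scale_0 bops_ext[OF S])
    show "op_norm E F (vadd (bounded_ops E F) S T) \<le> op_norm E F S + op_norm E F T"
    proof (rule op_norm_le[OF assms(1)])
      fix x assume x: "x \<in> unit_ball E"
      have "x \<in> vcarrier E" using x by (rule E.ball_closed)
      then show "vnorm F (vadd (bounded_ops E F) S T x) \<le> op_norm E F S + op_norm E F T"
        using F.norm_add_le[of "S x" "T x"] op_norm_ball[OF S assms(1) x] op_norm_ball[OF T assms(1) x]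
          bops_closed[OF S] bops_closed[OF T]
        by (simp add: bounded_ops_sel(1) del: bounded_ops_sel(3)) 
    qed
    fix c
    show "vscale (bounded_ops E F) c (vadd (bounded_ops E F) S T) =
       vadd (bounded_ops E F) (vscale (bounded_ops E F) c S) (vscale (bounded_ops E F) c T)"
      by (rule extensionalityI[of _ "vcarrier E"])
         (auto simp: bounded_ops_sel bops_closed[OF S] bops_closed[OF T] F.scale_add_right)
  next
    fix S T U assume S: "S \<in> vcarrier (bounded_ops E F)" and T: "T \<in> vcarrier (bounded_ops E F)"
      and U: "U \<in> vcarrier (bounded_ops E F)"
    show "vadd (bounded_ops E F) (vadd (bounded_ops E F) S T) U =
          vadd (bounded_ops E F) S (vadd (bounded_ops E F) T U)"
      by (rule extensionalityI[of _ "vcarrier E"])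
         (auto simp: bounded_ops_sel bops_closed[OF S] bops_closed[OF T] bops_closed[OF U] F.add_assoc)
  next
    fix T c d assume T: "T \<in> vcarrier (bounded_ops E F)"
    show "vscale (bounded_ops E F) c T \<in> vcarrier (bounded_ops E F)"
      using scale[OF T] by (simp add: bounded_ops_sel)
    show "vscale (bounded_ops E F) 1 T = T"
      by (rule extensionalityI[of _ "vcarrier E"])
         (auto simp: bounded_ops_sel bops_closed[OF T] bops_ext[OF T])
    show "vscale (bounded_ops E F) c (vscale (bounded_ops E F) d T) = vscale (bounded_ops E F) (c * d) T"
      by (rule extensionalityI[of _ "vcarrier E"])
         (auto simp: bounded_ops_sel bops_closed[OF T] F.scale_scale)
    show "vscale (bounded_ops E F) (c + d) T =
       vadd (bounded_ops E F) (vscale (bounded_ops E F) c T) (vscale (bounded_ops E F) d T)"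
      by (rule extensionalityI[of _ "vcarrier E"])
         (auto simp: bounded_ops_sel bops_closed[OF T] F.scale_add_left)
    have le: "op_norm E F (vscale (bounded_ops E F) c T) \<le> norm c * op_norm E F T"
      if T: "T \<in> vcarrier (bounded_ops E F)" for c T
    proof (rule op_norm_le[OF assms(1)])
      fix x assume x: "x \<in> unit_ball E"
      then show "vnorm F (vscale (bounded_ops E F) c T x) \<le> norm c * op_norm E F T"
        using op_norm_ball[OF T assms(1) x] mult_left_mono[of _ _ "norm c"]
        by (simp add: bounded_ops_sel(2) F.norm_scale bops_closed[OF T] E.ball_closed)
    qed
    show "op_norm E F (vscale (bounded_ops E F) c T) = norm c * op_norm E F T"
    proof (rule antisym[OF le[OF T]])
      let ?S = "vscale (bounded_ops E F) c T"
      show "norm c * op_norm E F T \<le> op_norm E F ?S"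
      proof (cases "c = 0")
        case True
        then show ?thesis
          using op_norm_nonneg[OF _ assms, of ?S] scale[OF T] by (simp add: bounded_ops_sel(2))
      next
        case False
        have "vscale (bounded_ops E F) (inverse c) ?S = T"
          using False by (intro extensionalityI[of _ "vcarrier E"])
            (auto simp: bounded_ops_sel bops_closed[OF T] F.scale_scale bops_ext[OF T])
        then have "op_norm E F T \<le> norm (inverse c) * op_norm E F ?S"
          using le[of ?S "inverse c"] scale[OF T] by (simp add: bounded_ops_sel(2))
        then show ?thesis using False by (simp add: norm_inverse norm_divide field_simps)
      qed
    qed
  qed
qed


section \<open>Dual spaces, adjoints and the canonical embedding\<close>

lemma seminormed_dual: "seminormed_space E \<Longrightarrow> seminormed_space (dual E)"
  unfolding dual_def by (intro seminormed_bounded_ops seminormed_scalar_space)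

lemma dual_sel:
  "vadd (dual E) f g = (\<lambda>x\<in>vcarrier E. f x + g x)"
  "vscale (dual E) c f = (\<lambda>x\<in>vcarrier E. c * f x)"
  by (simp_all add: dual_def bounded_ops_sel)

lemma dualI:
  assumes "f \<in> extensional (vcarrier E)"
    "\<And>x y. x \<in> vcarrier E \<Longrightarrow> y \<in> vcarrier E \<Longrightarrow> f (vadd E x y) = f x + f y"
    "\<And>c x. x \<in> vcarrier E \<Longrightarrow> f (vscale E c x) = c * f x"
    "\<And>x. x \<in> vcarrier E \<Longrightarrow> norm (f x) \<le> C * vnorm E x"
  shows "f \<in> vcarrier (dual E)"
  unfolding dual_def using assms by (intro bounded_opsI[where C = C]) auto

lemma dualD:
  assumes "f \<in> vcarrier (dual E)"
  shows dual_ext: "f \<in> extensional (vcarrier E)"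
    and dual_add: "x \<in> vcarrier E \<Longrightarrow> y \<in> vcarrier E \<Longrightarrow> f (vadd E x y) = f x + f y"
    and dual_scale: "x \<in> vcarrier E \<Longrightarrow> f (vscale E c x) = c * f x"
  using assms bops_ext[of f E scalar_space] bops_add[of f E scalar_space]
    bops_scale[of f E scalar_space] by (auto simp: dual_def)

lemma dual_diff:
  assumes "f \<in> vcarrier (dual E)" "seminormed_space E" "x \<in> vcarrier E" "y \<in> vcarrier E"
  shows "f (vdiff E x y) = f x - f y"
proof -
  interpret seminormed_space E by fact
  show ?thesis using assms by (simp add: vdiff_def dual_add dual_scale)
qed

lemma dual_norm_bound:
  assumes "f \<in> vcarrier (dual E)" "seminormed_space E" "x \<in> vcarrier E"
  shows "norm (f x) \<le> vnorm (dual E) f * vnorm E x"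
  using op_norm_bound[of f E scalar_space x] seminormed_scalar_space assms by (simp add: dual_def)

lemma dual_norm_ball:
  assumes "f \<in> vcarrier (dual E)" "seminormed_space E" "x \<in> unit_ball E"
  shows "norm (f x) \<le> vnorm (dual E) f"
  using op_norm_ball[of f E scalar_space x] assms by (simp add: dual_def)

lemma dual_norm_le:
  assumes "seminormed_space E" "\<And>x. x \<in> unit_ball E \<Longrightarrow> norm (f x) \<le> C"
  shows "vnorm (dual E) f \<le> C"
  using op_norm_le[of E scalar_space f C] assms by (simp add: dual_def)

lemma dual_norm_le':
  assumes "seminormed_space E" "\<And>x. x \<in> vcarrier E \<Longrightarrow> norm (f x) \<le> C * vnorm E x" "0 \<le> C"
  shows "vnorm (dual E) f \<le> C"
  using op_norm_le'[of E scalar_space f C] assms by (simp add: dual_def)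

lemma dual_norm_approx:
  assumes "f \<in> vcarrier (dual E)" "seminormed_space E" "e > 0"
  obtains x where "x \<in> unit_ball E" "f x \<bullet> 1 > vnorm (dual E) f - e"
proof -
  interpret seminormed_space E by fact
  have "\<exists>x\<in>unit_ball E. norm (f x) > vnorm (dual E) f - e"
    using dual_norm_le[OF assms(2), of f "vnorm (dual E) f - e"] assms(3) by (force simp: not_less)
  then obtain x where x: "x \<in> unit_ball E" "norm (f x) > vnorm (dual E) f - e" by blast
  have "f (vscale E (csgn (f x)) x) \<bullet> 1 = norm (f x)"
    using dual_scale[OF assms(1)] x(1) by (simp add: ball_closed re_csgn_mult)
  with x that[of "vscale E (csgn (f x)) x"] show ?thesis by (simp add: ball_scale)
qed

lemma adjoint_apply:
  "\<lbrakk>g \<in> vcarrier (dual F); x \<in> vcarrier E\<rbrakk> \<Longrightarrow> adjoint_op E F T g x = g (T x)"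
  by (simp add: adjoint_op_def)

lemma adjoint_extensional:
  "g \<in> vcarrier (dual F) \<Longrightarrow> adjoint_op E F T g \<in> extensional (vcarrier E)"
  by (simp add: adjoint_op_def del: restrict_apply) (simp only: restrict_apply if_True restrict_extensional)

lemma adjoint_dual:
  assumes T: "T \<in> vcarrier (bounded_ops E F)" and "seminormed_space E" "seminormed_space F"
    and g: "g \<in> vcarrier (dual F)"
  shows "adjoint_op E F T g \<in> vcarrier (dual E)"
    and "vnorm (dual E) (adjoint_op E F T g) \<le> op_norm E F T * vnorm (dual F) g"
proof -
  interpret E: seminormed_space E by fact
  interpret F: seminormed_space F by fact
  interpret F': seminormed_space "dual F" using \<open>seminormed_space F\<close> by (rule seminormed_dual)
  have le: "norm (adjoint_op E F T g x) \<le> (op_norm E F T * vnorm (dual F) g) * vnorm E x"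
    if x: "x \<in> vcarrier E" for x
  proof -
    have "norm (g (T x)) \<le> vnorm (dual F) g * vnorm F (T x)"
      by (rule dual_norm_bound[OF g assms(3) bops_closed[OF T x]])
    also have "\<dots> \<le> vnorm (dual F) g * (op_norm E F T * vnorm E x)"
      by (intro mult_left_mono op_norm_bound[OF T assms(2,3) x] F'.norm_nonneg g)
    finally show ?thesis using g x by (simp add: adjoint_apply mult_ac)
  qed
  show "adjoint_op E F T g \<in> vcarrier (dual E)"
    using g by (intro dualI[OF _ _ _ le])
      (simp_all add: adjoint_extensional adjoint_apply bops_add[OF T] bops_scale[OF T] dual_add[OF g] dual_scale[OF g] bops_closed[OF T])
  show "vnorm (dual E) (adjoint_op E F T g) \<le> op_norm E F T * vnorm (dual F) g"
    using assms by (intro dual_norm_le' le) (auto intro!: mult_nonneg_nonneg op_norm_nonneg F'.norm_nonneg)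
qed

lemma adjoint_bops:
  assumes T: "T \<in> vcarrier (bounded_ops E F)" and "seminormed_space E" "seminormed_space F"
  shows "adjoint_op E F T \<in> vcarrier (bounded_ops (dual F) (dual E))"
    and "op_norm (dual F) (dual E) (adjoint_op E F T) \<le> op_norm E F T"
proof -
  interpret E: seminormed_space E by fact
  interpret F: seminormed_space F by fact
  interpret F': seminormed_space "dual F" using \<open>seminormed_space F\<close> by (rule seminormed_dual)
  show "adjoint_op E F T \<in> vcarrier (bounded_ops (dual F) (dual E))"
  proof (rule bounded_opsI)
    show "adjoint_op E F T \<in> extensional (vcarrier (dual F))" by (simp add: adjoint_op_def)
    fix f g c assume f: "f \<in> vcarrier (dual F)" and g: "g \<in> vcarrier (dual F)"
    show "adjoint_op E F T (vadd (dual F) f g) =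
      vadd (dual E) (adjoint_op E F T f) (adjoint_op E F T g)"
      using f g F'.add_closed[OF f g]
      by (intro extensionalityI[of _ "vcarrier E"]) (auto simp: adjoint_op_def dual_sel bops_closed[OF T])
  next
    fix f c assume f: "f \<in> vcarrier (dual F)"
    show "adjoint_op E F T (vscale (dual F) c f) = vscale (dual E) c (adjoint_op E F T f)"
      using f F'.scale_closed[OF f]
      by (intro extensionalityI[of _ "vcarrier E"]) (auto simp: adjoint_op_def dual_sel bops_closed[OF T])
  qed (use assms adjoint_dual in blast)+
  show "op_norm (dual F) (dual E) (adjoint_op E F T) \<le> op_norm E F T"
    using assms adjoint_dual by (intro op_norm_le' F'.seminormed_space_axioms op_norm_nonneg)
qed

lemma emb_apply: "f \<in> vcarrier (dual E) \<Longrightarrow> canonical_embedding E x f = f x"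
  by (simp add: canonical_embedding_def)

lemma emb_extensional: "canonical_embedding E x \<in> extensional (vcarrier (dual E))"
  unfolding canonical_embedding_def by (rule restrict_extensional)

lemma emb_bidual:
  assumes "seminormed_space E" "x \<in> vcarrier E"
  shows "canonical_embedding E x \<in> vcarrier (bidual E)"
    and "vnorm (bidual E) (canonical_embedding E x) \<le> vnorm E x"
proof -
  interpret E: seminormed_space E by fact
  interpret E': seminormed_space "dual E" using assms(1) by (rule seminormed_dual)
  have le: "norm (canonical_embedding E x f) \<le> vnorm E x * vnorm (dual E) f"
    if "f \<in> vcarrier (dual E)" for f
    using dual_norm_bound[OF that assms] that by (simp add: emb_apply mult.commute)
  show "canonical_embedding E x \<in> vcarrier (bidual E)"
  proof (rule dualI[OF _ _ _ le])
    fix f g assume "f \<in> vcarrier (dual E)" "g \<in> vcarrier (dual E)"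
    then show "canonical_embedding E x (vadd (dual E) f g) = canonical_embedding E x f + canonical_embedding E x g"
      using E'.add_closed assms by (simp add: emb_apply) (simp add: dual_sel)
  next
    fix c f assume "f \<in> vcarrier (dual E)"
    then show "canonical_embedding E x (vscale (dual E) c f) = c * canonical_embedding E x f"
      using E'.scale_closed assms by (simp add: emb_apply) (simp add: dual_sel)
  qed (rule emb_extensional)
  show "vnorm (bidual E) (canonical_embedding E x) \<le> vnorm E x"
    using le assms by (intro dual_norm_le' E'.seminormed_space_axioms E.norm_nonneg)
qed

lemma emb_add:
  assumes "x \<in> vcarrier E" "y \<in> vcarrier E"
  shows "canonical_embedding E (vadd E x y) = vadd (bidual E) (canonical_embedding E x) (canonical_embedding E y)"
  using assms by (intro extensionalityI[of _ "vcarrier (dual E)"])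
    (auto simp: dual_sel emb_apply dual_add emb_extensional)

lemma emb_scale:
  assumes "x \<in> vcarrier E"
  shows "canonical_embedding E (vscale E c x) = vscale (bidual E) c (canonical_embedding E x)"
  using assms by (intro extensionalityI[of _ "vcarrier (dual E)"])
    (auto simp: dual_sel emb_apply dual_scale emb_extensional)

lemma biadjoint_apply:
  assumes "T \<in> vcarrier (bounded_ops E F)" "seminormed_space E" "seminormed_space F"
    "z \<in> vcarrier (bidual E)" "g \<in> vcarrier (dual F)"
  shows "biadjoint_op E F T z g = z (adjoint_op E F T g)"
  using assms by (simp add: adjoint_apply)

lemma biadjoint_emb:
  assumes T: "T \<in> vcarrier (bounded_ops E F)" and sp: "seminormed_space E" "seminormed_space F"
    and x: "x \<in> vcarrier E"
  shows "biadjoint_op E F T (canonical_embedding E x) = canonical_embedding F (T x)"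
proof (rule extensionalityI[of _ "vcarrier (dual F)"])
  show "biadjoint_op E F T (canonical_embedding E x) \<in> extensional (vcarrier (dual F))"
    using emb_bidual[OF sp(1) x] by (simp add: adjoint_op_def)
  fix g assume g: "g \<in> vcarrier (dual F)"
  show "biadjoint_op E F T (canonical_embedding E x) g = canonical_embedding F (T x) g"
    using g x emb_bidual(1)[OF sp(1) x] adjoint_dual(1)[OF T sp g]
    by (simp add: adjoint_apply emb_apply)
qed (rule emb_extensional)

text \<open>
  Definiteness of the norm enters the weak topology only through this property.
\<close>

definition separating :: "('k::real_normed_field, 'a) nspace \<Rightarrow> bool" where
  "separating E \<longleftrightarrow> (\<forall>x\<in>vcarrier E. \<forall>y\<in>vcarrier E. (\<forall>f\<in>vcarrier (dual E). f x = f y) \<longrightarrow> x = y)"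

lemma separating_dual:
  assumes "seminormed_space E"
  shows "separating (dual E)"
  unfolding separating_def
proof (intro ballI impI)
  fix f g assume f: "f \<in> vcarrier (dual E)" and g: "g \<in> vcarrier (dual E)"
    and *: "\<forall>z\<in>vcarrier (bidual E). z f = z g"
  show "f = g"
    using * emb_bidual(1)[OF assms] emb_apply[OF f] emb_apply[OF g]
    by (intro extensionalityI[of _ "vcarrier E"] dual_ext[OF f] dual_ext[OF g]) metis
qed

section \<open>The Hahn--Banach theorem\<close>

context seminormed_space
begin

definition sublinear :: "('a \<Rightarrow> real) \<Rightarrow> bool" where
  "sublinear p \<longleftrightarrow> p \<in> extensional (vcarrier E) \<and>
     (\<forall>x\<in>vcarrier E. \<forall>y\<in>vcarrier E. p (vadd E x y) \<le> p x + p y) \<and>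
     (\<forall>t>0. \<forall>x\<in>vcarrier E. p (vscale E (of_real t) x) \<le> t * p x)"

lemma sublinear_scale:
  assumes p: "sublinear p" and x: "x \<in> vcarrier E" and t: "0 \<le> t"
  shows "p (vscale E (of_real t) x) = t * p x"
proof (cases "t = 0")
  case True
  have "p vzero \<le> 2 * p vzero" "2 * p vzero \<le> p vzero"
  proof -
    show "p vzero \<le> 2 * p vzero" using p zero_closed add_zero[OF zero_closed] unfolding sublinear_def
      by (metis mult_2)
    have "p (vscale E (of_real (1/2)) vzero) \<le> (1/2) * p vzero"
      using p zero_closed unfolding sublinear_def by (metis zero_less_divide_1_iff zero_less_numeral)
    then show "2 * p vzero \<le> p vzero" by (simp del: of_real_divide)
  qed
  then show ?thesis using True x by (simp add: scale_0)
next
  case False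
  with t have t: "t > 0" by simp
  have 1: "p (vscale E (of_real t) x) \<le> t * p x" using p x t unfolding sublinear_def by blast
  have "p (vscale E (of_real (inverse t)) (vscale E (of_real t) x))
      \<le> inverse t * p (vscale E (of_real t) x)"
    using p x t unfolding sublinear_def by (meson positive_imp_inverse_positive scale_closed)
  then have "p x \<le> inverse t * p (vscale E (of_real t) x)" using x t by (simp add: scale_scale)
  then show ?thesis using 1 t by (simp add: field_simps)
qed

lemma sublinear_zero: "sublinear p \<Longrightarrow> p vzero = 0"
  using sublinear_scale[of p vzero 0] by simp

lemma sublinear_add: "\<lbrakk>sublinear p; x \<in> vcarrier E; y \<in> vcarrier E\<rbrakk> \<Longrightarrow> p (vadd E x y) \<le> p x + p y"
  unfolding sublinear_def by blast

lemma sublinear_lower: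
  assumes "sublinear p" "x \<in> vcarrier E"
  shows "- p (vscale E (- 1) x) \<le> p x"
  using sublinear_add[OF assms(1), of x "vscale E (- 1) x"] assms
  by (simp add: add_neg sublinear_zero)

text \<open>
  Zorn's lemma on the sublinear functionals below \<open>p\<close>: the infimum of a chain is again sublinear,
  and it is finite because \<open>- p (- x)\<close> is a lower bound.
\<close>

lemma minimal_sublinear_exists:
  assumes p: "sublinear p"
  obtains l where "sublinear l" "\<And>x. x \<in> vcarrier E \<Longrightarrow> l x \<le> p x"
    "\<And>m. sublinear m \<Longrightarrow> (\<And>x. x \<in> vcarrier E \<Longrightarrow> m x \<le> l x) \<Longrightarrow> m = l"
proof -
  define A where "A = {m. sublinear m \<and> (\<forall>x\<in>vcarrier E. m x \<le> p x)}"
  define P where "P = (\<lambda>(a::'a\<Rightarrow>real) b. \<forall>x\<in>vcarrier E. b x \<le> a x)"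
  have "\<exists>m\<in>A. \<forall>a\<in>A. P m a \<longrightarrow> a = m"
  proof (rule predicate_Zorn)
    show "partial_order_on A (relation_of P A)"
    proof (rule partial_order_on_relation_ofI)
      fix a b assume "a \<in> A" "b \<in> A" "P a b" "P b a"
      then show "a = b" unfolding A_def P_def sublinear_def
        by (intro extensionalityI[of _ "vcarrier E"]) (auto intro: order.antisym)
    qed (auto simp: P_def intro: order_trans)
  next
    fix C assume C: "C \<in> Chains (relation_of P A)"
    then have CA: "C \<subseteq> A" by (auto simp: Chains_def relation_of_def)
    have ch: "P a b \<or> P b a" if "a \<in> C" "b \<in> C" for a b
      using C that by (auto simp: Chains_def relation_of_def)
    show "\<exists>u\<in>A. \<forall>a\<in>C. P a u"
    proof (cases "C = {}")
      case True then show ?thesis using p by (auto simp: A_def)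
    next
      case False
      define u where "u = (\<lambda>x\<in>vcarrier E. INF m\<in>C. m x)"
      have sl: "sublinear m" "x \<in> vcarrier E \<Longrightarrow> m x \<le> p x" if "m \<in> C" for m x
        using that CA by (auto simp: A_def)
      have bdd: "bdd_below ((\<lambda>m. m x) ` C)" if x: "x \<in> vcarrier E" for x
      proof (rule bdd_belowI2)
        fix m assume m: "m \<in> C"
        show "- p (vscale E (- 1) x) \<le> m x"
          using sublinear_lower[OF sl(1)[OF m] x] sl(2)[OF m, of "vscale E (- 1) x"] x by simp
      qed
      have le: "u x \<le> m x" if "m \<in> C" "x \<in> vcarrier E" for m x
        using that bdd by (auto simp: u_def intro: cINF_lower)
      have "sublinear u" unfolding sublinear_def
      proof (intro conjI ballI allI impI)
        show "u \<in> extensional (vcarrier E)" unfolding u_def by (rule restrict_extensional)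
      next
        fix x y assume x: "x \<in> vcarrier E" and y: "y \<in> vcarrier E"
        have *: "u (vadd E x y) \<le> a x + b y" if a: "a \<in> C" and b: "b \<in> C" for a b
        proof -
          have "\<exists>m\<in>C. m x \<le> a x \<and> m y \<le> b y"
            using ch[OF a b] a b x y unfolding P_def by blast
          then obtain m where m: "m \<in> C" "m x \<le> a x" "m y \<le> b y" by blast
          have "u (vadd E x y) \<le> m (vadd E x y)" using m x y by (intro le) auto
          also have "\<dots> \<le> m x + m y" using sl(1)[OF m(1)] x y by (rule sublinear_add)
          finally show ?thesis using m by linarith
        qed
        have "u (vadd E x y) - a x \<le> (INF b\<in>C. b y)" if "a \<in> C" for a
          using *[OF that] False by (intro cINF_greatest) (auto simp: algebra_simps)
        then have "u (vadd E x y) - a x \<le> u y" if "a \<in> C" for a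
          using that y by (simp add: u_def)
        then have "u (vadd E x y) - u y \<le> a x" if "a \<in> C" for a using that by force
        then have "u (vadd E x y) - u y \<le> (INF a\<in>C. a x)" using False by (intro cINF_greatest) auto
        then show "u (vadd E x y) \<le> u x + u y" using x by (simp add: u_def)
      next
        fix t :: real and x assume t: "t > 0" and x: "x \<in> vcarrier E"
        have "u (vscale E (of_real t) x) / t \<le> m x" if m: "m \<in> C" for m
          using le[OF m, of "vscale E (of_real t) x"] sublinear_scale[OF sl(1)[OF m] x, of t] x t
          by (simp add: field_simps)
        then have "u (vscale E (of_real t) x) / t \<le> (INF m\<in>C. m x)"
          using False by (intro cINF_greatest) auto
        then show "u (vscale E (of_real t) x) \<le> t * u x" using x t by (simp add: u_def field_simps)
      qed
      moreover have "u x \<le> p x" if "x \<in> vcarrier E" for x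
        using False le sl(2) that by (meson all_not_in_conv order_trans)
      ultimately show ?thesis using le by (auto simp: A_def P_def)
    qed
  qed
  then obtain l where l: "l \<in> A" "\<And>a. a \<in> A \<Longrightarrow> P l a \<Longrightarrow> a = l" by blast
  show ?thesis
  proof (rule that)
    show "sublinear l" "\<And>x. x \<in> vcarrier E \<Longrightarrow> l x \<le> p x" using l(1) by (auto simp: A_def)
    fix m assume "sublinear m" "\<And>x. x \<in> vcarrier E \<Longrightarrow> m x \<le> l x"
    then show "m = l" using l(1) by (intro l(2)) (auto simp: A_def P_def intro: order_trans)
  qed
qed

text \<open>
  The functional \<open>x \<mapsto> inf (l (x + t y) - t l y)\<close>, with \<open>t\<close> ranging over the nonnegative reals, is
  sublinear and below \<open>l\<close>, so by minimality it is \<open>l\<close>; the value at \<open>t = 1\<close> is superadditivity.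
\<close>

lemma minimal_sublinear_additive:
  assumes l: "sublinear l"
    and minimal: "\<And>m. sublinear m \<Longrightarrow> (\<And>x. x \<in> vcarrier E \<Longrightarrow> m x \<le> l x) \<Longrightarrow> m = l"
    and x: "x \<in> vcarrier E" and y: "y \<in> vcarrier E"
  shows "l (vadd E x y) = l x + l y"
proof (rule antisym[OF sublinear_add[OF l x y]])
  define h where "h = (\<lambda>x t. l (vadd E x (vscale E (of_real t) y)) - t * l y)"
  define m where "m = (\<lambda>x\<in>vcarrier E. INF t\<in>{0::real..}. h x t)"
  have bdd: "bdd_below (h z ` {0..})" if z: "z \<in> vcarrier E" for z
  proof (rule bdd_belowI2)
    fix t :: real assume t: "t \<in> {0..}"
    have "vadd E (vadd E z (vscale E (of_real t) y)) (vscale E (- 1) z) = vscale E (of_real t) y"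
      using z y by (metis add_assoc add_comm add_neg add_zero scale_closed)
    then have "l (vscale E (of_real t) y) \<le> l (vadd E z (vscale E (of_real t) y)) + l (vscale E (- 1) z)"
      using sublinear_add[OF l, of "vadd E z (vscale E (of_real t) y)" "vscale E (- 1) z"] z y by simp
    then show "- l (vscale E (- 1) z) \<le> h z t"
      using sublinear_scale[OF l y, of t] t by (simp add: h_def)
  qed
  have le: "m z \<le> h z t" if "z \<in> vcarrier E" "t \<ge> 0" for z t
    unfolding m_def using that bdd by (auto intro: cINF_lower)
  have geI: "c \<le> m z" if "z \<in> vcarrier E" "\<And>t. t \<ge> 0 \<Longrightarrow> c \<le> h z t" for c z
    unfolding m_def using that by (auto intro!: cINF_greatest)
  have "sublinear m" unfolding sublinear_def
  proof (intro conjI ballI allI impI)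
    show "m \<in> extensional (vcarrier E)" unfolding m_def by (rule restrict_extensional)
  next
    fix a b assume a: "a \<in> vcarrier E" and b: "b \<in> vcarrier E"
    have *: "m (vadd E a b) \<le> h a s + h b t" if s: "s \<ge> 0" and t: "t \<ge> 0" for s t
    proof -
      have e: "vadd E (vadd E a b) (vscale E (of_real (s + t)) y)
          = vadd E (vadd E a (vscale E (of_real s) y)) (vadd E b (vscale E (of_real t) y))"
        using a b y by (simp add: scale_add_left add_assoc add_left_commute)
      have "m (vadd E a b) \<le> h (vadd E a b) (s + t)" using a b s t by (intro le) auto
      also have "\<dots> \<le> h a s + h b t"
        using sublinear_add[OF l, of "vadd E a (vscale E (of_real s) y)" "vadd E b (vscale E (of_real t) y)"] a b y
        unfolding h_def e by (simp add: algebra_simps)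
      finally show ?thesis .
    qed
    have "m (vadd E a b) - h a s \<le> m b" if "s \<ge> 0" for s
      using *[OF that] b by (intro geI) (auto simp: algebra_simps)
    then have "m (vadd E a b) - m b \<le> m a" using a by (intro geI) (auto simp: algebra_simps)
    then show "m (vadd E a b) \<le> m a + m b" by simp
  next
    fix s :: real and a assume s: "s > 0" and a: "a \<in> vcarrier E"
    have "m (vscale E (of_real s) a) / s \<le> m a"
    proof (rule geI[OF a])
      fix t :: real assume t: "t \<ge> 0"
      have e: "vadd E (vscale E (of_real s) a) (vscale E (of_real (s * t)) y)
          = vscale E (of_real s) (vadd E a (vscale E (of_real t) y))"
        using a y by (simp add: scale_add_right scale_scale)
      have "m (vscale E (of_real s) a) \<le> h (vscale E (of_real s) a) (s * t)"
        using a s t by (intro le) auto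
      also have "\<dots> = s * h a t"
        unfolding h_def e using sublinear_scale[OF l, of "vadd E a (vscale E (of_real t) y)" s] a y s
        by (simp add: algebra_simps)
      finally show "m (vscale E (of_real s) a) / s \<le> h a t" using s by (simp add: field_simps)
    qed
    then show "m (vscale E (of_real s) a) \<le> s * m a" using s by (simp add: field_simps)
  qed
  moreover have "m z \<le> l z" if "z \<in> vcarrier E" for z
    using le[OF that, of 0] that y by (simp add: h_def scale_0)
  ultimately have "m = l" by (rule minimal)
  then have "l x \<le> h x 1" using le[OF x, of 1] by simp
  then show "l x + l y \<le> l (vadd E x y)" using y by (simp add: h_def)
qed

lemma sublinear_dominates_linear:
  assumes p: "sublinear p"
  obtains l where "\<And>x. x \<in> vcarrier E \<Longrightarrow> l x \<le> p x"
    "\<And>x y. x \<in> vcarrier E \<Longrightarrow> y \<in> vcarrier E \<Longrightarrow> l (vadd E x y) = l x + l y"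
    "\<And>t x. x \<in> vcarrier E \<Longrightarrow> l (vscale E (of_real t) x) = t * l x"
proof -
  obtain l where l: "sublinear l" "\<And>x. x \<in> vcarrier E \<Longrightarrow> l x \<le> p x"
    "\<And>m. sublinear m \<Longrightarrow> (\<And>x. x \<in> vcarrier E \<Longrightarrow> m x \<le> l x) \<Longrightarrow> m = l"
    using minimal_sublinear_exists[OF p] by blast
  have add: "l (vadd E x y) = l x + l y" if "x \<in> vcarrier E" "y \<in> vcarrier E" for x y
    using minimal_sublinear_additive[OF l(1,3) that] .
  have neg: "l (vscale E (- 1) x) = - l x" if "x \<in> vcarrier E" for x
    using add[of x "vscale E (- 1) x"] that sublinear_zero[OF l(1)] by (simp add: add_neg)
  have "l (vscale E (of_real t) x) = t * l x" if x: "x \<in> vcarrier E" for t x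
  proof (cases "t \<ge> 0")
    case True then show ?thesis using sublinear_scale[OF l(1) x] by simp
  next
    case False
    have "vscale E (of_real t) x = vscale E (- 1) (vscale E (of_real (- t)) x)"
      using x by (simp add: scale_scale)
    then show ?thesis
      using neg[of "vscale E (of_real (- t)) x"] sublinear_scale[OF l(1) x, of "- t"] False x by simp
  qed
  then show ?thesis using that[of l] l(2) add by blast
qed

text \<open>
  The real part of \<open>f\<close> is extended first: a linear functional below
  \<open>x \<mapsto> inf (\<parallel>x - y\<parallel> + Re f y)\<close>, with \<open>y\<close> ranging over \<open>Y\<close>, agrees with \<open>Re f\<close> on \<open>Y\<close>. A scalar
  functional is recovered from its real part \<open>l\<close> by \<open>g x \<bullet> a = l (cj a x)\<close>, and no constant is lost,
  since \<open>\<bar>g x\<bar>\<^sup>2 = l (cj (g x) x)\<close>.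
\<close>

theorem hahn_banach:
  assumes Y: "Y \<subseteq> vcarrier E" "Y \<noteq> {}"
    and Y_add: "\<And>x y. x \<in> Y \<Longrightarrow> y \<in> Y \<Longrightarrow> vadd E x y \<in> Y"
    and Y_scale: "\<And>c x. x \<in> Y \<Longrightarrow> vscale E c x \<in> Y"
    and f_add: "\<And>x y. x \<in> Y \<Longrightarrow> y \<in> Y \<Longrightarrow> f (vadd E x y) = f x + f y"
    and f_scale: "\<And>c x. x \<in> Y \<Longrightarrow> f (vscale E c x) = c * f x"
    and f_le: "\<And>x. x \<in> Y \<Longrightarrow> norm (f x) \<le> vnorm E x"
  obtains g where "g \<in> vcarrier (dual E)" "\<And>x. x \<in> vcarrier E \<Longrightarrow> norm (g x) \<le> vnorm E x"
    "\<And>x. x \<in> Y \<Longrightarrow> g x = f x"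
proof -
  have YE: "y \<in> vcarrier E" if "y \<in> Y" for y using that Y by blast
  define h where "h = (\<lambda>x y. vnorm E (vdiff E x y) + f y \<bullet> 1)"
  define p where "p = (\<lambda>x\<in>vcarrier E. INF y\<in>Y. h x y)"
  have lower: "- vnorm E x \<le> h x y" if x: "x \<in> vcarrier E" and y: "y \<in> Y" for x y
  proof -
    have "vnorm E y \<le> vnorm E (vdiff E y x) + vnorm E x"
      using norm_add_le[of "vdiff E y x" x] x YE[OF y] by (simp add: diff_add_cancel)
    moreover have "vnorm E (vdiff E y x) = vnorm E (vdiff E x y)"
    proof -
      have "vscale E (- 1) (vdiff E x y) = vdiff E y x"
        using x YE[OF y] by (simp add: vdiff_def scale_add_right scale_scale add_comm)
      then show ?thesis using norm_scale[of "vdiff E x y" "- 1"] x YE[OF y] by simp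
    qed
    moreover have "- vnorm E y \<le> f y \<bullet> 1"
      using abs_re_le_norm[of "f y"] f_le[OF y] by linarith
    ultimately show ?thesis by (simp add: h_def)
  qed
  have le: "p x \<le> h x y" if "x \<in> vcarrier E" "y \<in> Y" for x y
    unfolding p_def using that lower[OF that(1)]
    by (auto intro!: cINF_lower bdd_belowI2[of _ "- vnorm E x"])
  have geI: "c \<le> p x" if "x \<in> vcarrier E" "\<And>y. y \<in> Y \<Longrightarrow> c \<le> h x y" for c x
    unfolding p_def using that Y(2) by (auto intro!: cINF_greatest)
  have "sublinear p" unfolding sublinear_def
  proof (intro conjI ballI allI impI)
    show "p \<in> extensional (vcarrier E)" unfolding p_def by (rule restrict_extensional)
  next
    fix a b assume a: "a \<in> vcarrier E" and b: "b \<in> vcarrier E"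
    have *: "p (vadd E a b) \<le> h a s + h b t" if s: "s \<in> Y" and t: "t \<in> Y" for s t
    proof -
      have e: "vdiff E (vadd E a b) (vadd E s t) = vadd E (vdiff E a s) (vdiff E b t)"
        using a b YE[OF s] YE[OF t]
        by (simp add: vdiff_def scale_add_right add_assoc add_left_commute)
      have "p (vadd E a b) \<le> h (vadd E a b) (vadd E s t)" using a b s t Y_add by (intro le) auto
      also have "\<dots> \<le> h a s + h b t"
        using norm_add_le[of "vdiff E a s" "vdiff E b t"] a b YE[OF s] YE[OF t] f_add[OF s t]
        unfolding h_def e by (simp add: inner_add_left)
      finally show ?thesis .
    qed
    have "p (vadd E a b) - h a s \<le> p b" if "s \<in> Y" for s
      using *[OF that] b by (intro geI) (auto simp: algebra_simps)
    then have "p (vadd E a b) - p b \<le> p a" using a by (intro geI) (auto simp: algebra_simps)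
    then show "p (vadd E a b) \<le> p a + p b" by simp
  next
    fix s :: real and a assume s: "s > 0" and a: "a \<in> vcarrier E"
    have "p (vscale E (of_real s) a) / s \<le> p a"
    proof (rule geI[OF a])
      fix t assume t: "t \<in> Y"
      have e: "vdiff E (vscale E (of_real s) a) (vscale E (of_real s) t) = vscale E (of_real s) (vdiff E a t)"
        using a YE[OF t] by (simp add: vdiff_def scale_add_right scale_scale)
      have "p (vscale E (of_real s) a) \<le> h (vscale E (of_real s) a) (vscale E (of_real s) t)"
        using a s t Y_scale by (intro le) auto
      also have "\<dots> = s * h a t"
        unfolding h_def e using a YE[OF t] s
        by (simp add: norm_scale f_scale[OF t] algebra_simps flip: scaleR_conv_of_real)
      finally show "p (vscale E (of_real s) a) / s \<le> h a t" using s by (simp add: field_simps)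
    qed
    then show "p (vscale E (of_real s) a) \<le> s * p a" using s by (simp add: field_simps)
  qed
  then obtain l where l: "\<And>x. x \<in> vcarrier E \<Longrightarrow> l x \<le> p x"
    "\<And>x y. x \<in> vcarrier E \<Longrightarrow> y \<in> vcarrier E \<Longrightarrow> l (vadd E x y) = l x + l y"
    "\<And>t x. x \<in> vcarrier E \<Longrightarrow> l (vscale E (of_real t) x) = t * l x"
    using sublinear_dominates_linear by blast
  have l_neg: "l (vscale E (- 1) x) = - l x" if "x \<in> vcarrier E" for x
    using l(3)[OF that, of "- 1"] by simp
  have l_le: "l x \<le> vnorm E x" if x: "x \<in> vcarrier E" for x
  proof -
    obtain y where y: "y \<in> Y" using Y by blast
    define z where "z = vscale E 0 y"
    have z: "z \<in> Y" "f z = 0" using y Y_scale f_scale[OF y, of 0] by (auto simp: z_def)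
    have "vdiff E x z = x" using x YE[OF y] by (simp add: vdiff_def z_def scale_0)
    then show ?thesis using l(1)[OF x] le[OF x z(1)] z by (simp add: h_def)
  qed
  have l_Y_le: "l y \<le> f y \<bullet> 1" if y: "y \<in> Y" for y
    using l(1)[OF YE[OF y]] le[OF YE[OF y] y] YE[OF y] by (simp add: h_def vdiff_def add_neg)
  have l_Y: "l y = f y \<bullet> 1" if y: "y \<in> Y" for y
    using l_Y_le[OF y] l_Y_le[OF Y_scale[OF y, of "- 1"]] l_neg[OF YE[OF y]] f_scale[OF y, of "- 1"] by simp
  define g where "g = (\<lambda>x\<in>vcarrier E. adjoint (\<lambda>a. l (vscale E (cj a) x)) 1)"
  have g_inner: "g x \<bullet> a = l (vscale E (cj a) x)" if x: "x \<in> vcarrier E" for x a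
  proof -
    have "linear (\<lambda>a. l (vscale E (cj a) x))"
    proof
      show "l (vscale E (cj (a + b)) x) = l (vscale E (cj a) x) + l (vscale E (cj b) x)" for a b
        using x by (simp add: cj_add scale_add_left l(2))
      show "l (vscale E (cj (r *\<^sub>R a)) x) = r *\<^sub>R l (vscale E (cj a) x)" for r a
        using x l(3)[of "vscale E (cj a) x" r]
        by (simp add: cj_scaleR scale_scale del: scaleR_conv_of_real flip: scaleR_conv_of_real)
    qed
    then show ?thesis using adjoint_works[of "\<lambda>a. l (vscale E (cj a) x)" a 1] x
      by (simp add: g_def inner_commute)
  qed
  have g_le: "norm (g x) \<le> vnorm E x" if x: "x \<in> vcarrier E" for x
  proof -
    have "norm (g x) * norm (g x) = l (vscale E (cj (g x)) x)"
      using g_inner[OF x, of "g x"] by (simp add: dot_square_norm power2_eq_square)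
    also have "\<dots> \<le> norm (g x) * vnorm E x"
      using l_le[of "vscale E (cj (g x)) x"] x by (simp add: norm_scale)
    finally show ?thesis using x by (cases "g x = 0") auto
  qed
  have "g \<in> vcarrier (dual E)"
  proof (rule dualI[where C = 1])
    show "g \<in> extensional (vcarrier E)" unfolding g_def by (rule restrict_extensional)
    show "g (vadd E x y) = g x + g y" if "x \<in> vcarrier E" "y \<in> vcarrier E" for x y
      by (rule vector_eq_rdot[THEN iffD1])
         (use that in \<open>simp add: g_inner inner_add_left scale_add_right l(2)\<close>)
    show "g (vscale E c x) = c * g x" if "x \<in> vcarrier E" for c x
    proof (rule vector_eq_rdot[THEN iffD1], rule allI)
      fix a
      have "g (vscale E c x) \<bullet> a = l (vscale E (cj (cj c * a)) x)"
        using that by (simp add: g_inner scale_scale cj_mult mult.commute)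
      also have "\<dots> = g x \<bullet> (cj c * a)" using that by (simp add: g_inner)
      also have "\<dots> = (c * g x) \<bullet> a" using inner_cj[of "cj c" "g x" a] by simp
      finally show "g (vscale E c x) \<bullet> a = (c * g x) \<bullet> a" .
    qed
  qed (use g_le in simp)
  moreover have "g y = f y" if y: "y \<in> Y" for y
  proof (rule vector_eq_rdot[THEN iffD1], rule allI)
    fix a
    show "g y \<bullet> a = f y \<bullet> a"
      using YE[OF y] l_Y[OF Y_scale[OF y, of "cj a"]] f_scale[OF y, of "cj a"]
      by (simp add: g_inner inner_cj_1)
  qed
  ultimately show ?thesis using that g_le by blast
qed

end

text \<open>
  Hahn--Banach on the line through \<open>x\<close>. If the norm of \<open>x\<close> vanishes, the line need not determine the
  coefficient of its points, but then the zero functional will do.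
\<close>

lemma norming_functional:
  assumes "seminormed_space E" "x \<in> vcarrier E"
  obtains f where "f \<in> unit_ball (dual E)" "f x = of_real (vnorm E x)"
proof -
  interpret E: seminormed_space E by fact
  interpret E': seminormed_space "dual E" using assms(1) by (rule seminormed_dual)
  show ?thesis
  proof (cases "vnorm E x = 0")
    case True
    have "norm (E'.vzero x) \<le> vnorm (dual E) E'.vzero * vnorm E x"
      using assms by (intro dual_norm_bound) auto
    then have "E'.vzero x = 0" using True by simp
    then show ?thesis using that[of E'.vzero] True by simp
  next
    case False
    define Y where "Y = range (\<lambda>c. vscale E c x)"
    define f where "f = (\<lambda>y. (SOME c. y = vscale E c x) * of_real (vnorm E x))"
    have inj: "c = d" if "vscale E c x = vscale E d x" for c d
    proof -
      have "vscale E (c - d) x = E.vzero"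
        using E.scale_add_left[OF assms(2), of c "- d"] E.scale_add_left[OF assms(2), of d "- d"] that assms(2)
        by (simp add: E.scale_0)
      then show ?thesis using E.norm_scale[OF assms(2), of "c - d"] False by simp
    qed
    have f: "f (vscale E c x) = c * of_real (vnorm E x)" for c
      unfolding f_def using inj by (metis (mono_tags, lifting) someI)
    have fx: "f x = of_real (vnorm E x)" using f[of 1] assms by simp
    have "\<exists>g. g \<in> vcarrier (dual E) \<and> (\<forall>x\<in>vcarrier E. norm (g x) \<le> vnorm E x) \<and> (\<forall>y\<in>Y. g y = f y)"
    proof (rule E.hahn_banach[of Y f])
      show "f (vadd E a b) = f a + f b" if "a \<in> Y" "b \<in> Y" for a b
        using that assms by (auto simp: Y_def f algebra_simps simp flip: E.scale_add_left)
      show "f (vscale E c a) = c * f a" if "a \<in> Y" for a c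
        using that assms by (auto simp: Y_def f E.scale_scale)
      show "norm (f a) \<le> vnorm E a" if "a \<in> Y" for a
        using that assms by (auto simp: Y_def f E.norm_scale norm_mult)
      show "vadd E a b \<in> Y" if "a \<in> Y" "b \<in> Y" for a b
        using that assms by (auto simp: Y_def simp flip: E.scale_add_left)
      show "vscale E c a \<in> Y" if "a \<in> Y" for a c
        using that assms by (auto simp: Y_def E.scale_scale)
    qed (use assms in \<open>auto simp: Y_def\<close>)
    then obtain g where g: "g \<in> vcarrier (dual E)" "\<And>x. x \<in> vcarrier E \<Longrightarrow> norm (g x) \<le> vnorm E x"
      "\<And>y. y \<in> Y \<Longrightarrow> g y = f y" by blast
    have "x \<in> Y" unfolding Y_def using E.scale_one[OF assms(2)] by (metis rangeI)
    moreover have "vnorm (dual E) g \<le> 1"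
      using g(2) assms by (intro dual_norm_le') auto
    ultimately show ?thesis using that[of g] g fx by (simp add: unit_ball_def)
  qed
qed

section \<open>Goldstine's theorem\<close>

lemma dual_linear_combination:
  assumes "seminormed_space E" "finite \<Phi>" "\<Phi> \<subseteq> vcarrier (dual E)"
  shows "(\<lambda>x\<in>vcarrier E. \<Sum>\<phi>\<in>\<Phi>. c \<phi> * \<phi> x) \<in> vcarrier (dual E)"
    and "z \<in> vcarrier (bidual E) \<Longrightarrow> z (\<lambda>x\<in>vcarrier E. \<Sum>\<phi>\<in>\<Phi>. c \<phi> * \<phi> x) = (\<Sum>\<phi>\<in>\<Phi>. c \<phi> * z \<phi>)"
proof -
  interpret E: seminormed_space E by fact
  interpret E': seminormed_space "dual E" using assms(1) by (rule seminormed_dual)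
  let ?\<psi> = "\<lambda>\<Phi>. \<lambda>x\<in>vcarrier E. \<Sum>\<phi>\<in>\<Phi>. c \<phi> * \<phi> x"
  have zero: "E'.vzero x = 0" if "x \<in> vcarrier E" for x
    using dual_norm_bound[OF E'.zero_closed assms(1) that] by simp
  have "?\<psi> \<Phi> \<in> vcarrier (dual E) \<and> (\<forall>z\<in>vcarrier (bidual E). z (?\<psi> \<Phi>) = (\<Sum>\<phi>\<in>\<Phi>. c \<phi> * z \<phi>))"
    using assms(2,3)
  proof (induction \<Phi> rule: finite_induct)
    case empty
    have "?\<psi> {} = E'.vzero"
      by (rule extensionalityI[of _ "vcarrier E"]) (auto simp: zero dual_ext[OF E'.zero_closed])
    then show ?case using dual_scale[of _ "dual E" E'.vzero 0] by (force simp: E'.scale_zero)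
  next
    case (insert f \<Phi>)
    have f: "f \<in> vcarrier (dual E)" and \<Phi>: "\<Phi> \<subseteq> vcarrier (dual E)" using insert.prems by blast+
    note IH = insert.IH[OF \<Phi>]
    have e: "?\<psi> (insert f \<Phi>) = vadd (dual E) (vscale (dual E) (c f) f) (?\<psi> \<Phi>)"
      by (rule extensionalityI[of _ "vcarrier E"]) (auto simp: insert dual_sel)
    define q where "q = ?\<psi> \<Phi>"
    have q: "q \<in> vcarrier (dual E)" "\<And>z. z \<in> vcarrier (bidual E) \<Longrightarrow> z q = (\<Sum>\<phi>\<in>\<Phi>. c \<phi> * z \<phi>)"
      unfolding q_def using IH by blast+
    show ?case unfolding e q_def[symmetric] using f q insert.hyps
      by (auto simp: E'.scale_closed E'.add_closed dual_add[of _ "dual E"] dual_scale[of _ "dual E"])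
  qed
  then show "?\<psi> \<Phi> \<in> vcarrier (dual E)"
    and "z \<in> vcarrier (bidual E) \<Longrightarrow> z (?\<psi> \<Phi>) = (\<Sum>\<phi>\<in>\<Phi>. c \<phi> * z \<phi>)" by blast+
qed

lemma norm_diff_scaleR_sq:
  fixes v w :: "'v::real_inner"
  shows "(norm (v - t *\<^sub>R w))\<^sup>2 = (norm v)\<^sup>2 - 2 * t * (v \<bullet> w) + t\<^sup>2 * (norm w)\<^sup>2"
  by (simp only: power2_norm_eq_inner inner_diff_left inner_diff_right inner_scaleR_left
      inner_scaleR_right inner_commute[of w v]) (simp only: power2_eq_square, algebra)

text \<open>
  Let \<open>d\<close> be the infimum of the squared distance of \<open>(\<phi> x)\<close> from \<open>(z \<phi>)\<close> over the unit ball. At an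
  almost minimal point \<open>x0\<close> the difference vector \<open>v\<close> defines a functional \<open>\<psi>\<close>, and moving from \<open>x0\<close>
  towards any \<open>x\<close> cannot decrease the distance much, so \<open>Re \<psi> x\<close> is at most \<open>Re \<psi> x0\<close> up to a small
  error. Hence \<open>Re z \<psi> \<le> \<parallel>\<psi>\<parallel>\<close> is at most \<open>Re \<psi> x0\<close> up to that error, but the difference of these
  numbers is the squared distance of \<open>x0\<close>, which is at least \<open>d\<close>; so \<open>d = 0\<close>.
\<close>

theorem goldstine:
  fixes E :: "('k::{real_normed_field,euclidean_space}, 'a) nspace"
  assumes E: "seminormed_space E" and z: "z \<in> unit_ball (bidual E)"
    and \<Phi>: "finite \<Phi>" "\<Phi> \<subseteq> vcarrier (dual E)" and \<eta>: "\<eta> > 0"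
  obtains x where "x \<in> unit_ball E" "\<And>\<phi>. \<phi> \<in> \<Phi> \<Longrightarrow> norm (z \<phi> - \<phi> x) < \<eta>"
proof -
  interpret E: seminormed_space E by fact
  interpret E': seminormed_space "dual E" using assms(1) by (rule seminormed_dual)
  have zd: "z \<in> vcarrier (bidual E)" "vnorm (bidual E) z \<le> 1" using z by (auto simp: unit_ball_def)
  define S where "S = (\<lambda>x. \<Sum>\<phi>\<in>\<Phi>. (norm (z \<phi> - \<phi> x))\<^sup>2)"
  define d where "d = (INF x\<in>unit_ball E. S x)"
  have S0: "S x \<ge> 0" for x unfolding S_def by (intro sum_nonneg) auto
  have bdd: "bdd_below (S ` unit_ball E)" using S0 by (intro bdd_belowI2[of _ 0]) auto
  have ne: "unit_ball E \<noteq> {}" using E.zero_in_ball by blast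
  have d_le: "d \<le> S x" if "x \<in> unit_ball E" for x unfolding d_def using bdd that by (rule cINF_lower)
  have near: "\<exists>x\<in>unit_ball E. S x < r" if "d < r" for r
    using that unfolding d_def cINF_less_iff[OF ne bdd] .
  have "d < \<eta>\<^sup>2"
  proof (rule ccontr)
    assume "\<not> d < \<eta>\<^sup>2"
    moreover have "\<eta>\<^sup>2 > 0" using \<eta> by simp
    ultimately have d: "d > 0" by linarith
    define C where "C = (\<Sum>\<phi>\<in>\<Phi>. (2 * vnorm (dual E) \<phi>)\<^sup>2)"
    have C: "C \<ge> 0" unfolding C_def by (intro sum_nonneg) auto
    \<comment> \<open>the step length and the tolerance make the two error terms at most d/4 each\<close>
    define t where "t = min 1 (d / (2 * (C + 1)))"
    have t: "t > 0" "t \<le> 1" "t * C \<le> d / 2"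
    proof -
      show "t > 0" "t \<le> 1" using d C by (auto simp: t_def)
      have "t * C \<le> d / (2 * (C + 1)) * C" using C by (intro mult_right_mono) (auto simp: t_def)
      also have "\<dots> \<le> d / 2" using C d by (simp add: field_simps)
      finally show "t * C \<le> d / 2" .
    qed
    define \<delta> where "\<delta> = t * d / 2"
    have "\<delta> > 0" using t d by (simp add: \<delta>_def)
    then obtain x0 where x0: "x0 \<in> unit_ball E" "S x0 < d + \<delta>" using near[of "d + \<delta>"] by auto
    have x0E: "x0 \<in> vcarrier E" using x0 by (simp add: E.ball_closed)
    define v where "v = (\<lambda>\<phi>. z \<phi> - \<phi> x0)"
    define \<psi> where "\<psi> = (\<lambda>x\<in>vcarrier E. \<Sum>\<phi>\<in>\<Phi>. cj (v \<phi>) * \<phi> x)"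
    have \<psi>: "\<psi> \<in> vcarrier (dual E)" "z \<psi> = (\<Sum>\<phi>\<in>\<Phi>. cj (v \<phi>) * z \<phi>)"
      using dual_linear_combination[OF E \<Phi>] zd by (auto simp: \<psi>_def)
    define R where "R = \<psi> x0 \<bullet> 1 + \<delta> / (2 * t) + t * C / 2"
    have le: "\<psi> x \<bullet> 1 \<le> R" if x: "x \<in> unit_ball E" for x
    proof -
      have xE: "x \<in> vcarrier E" using x by (simp add: E.ball_closed)
      define w where "w = (\<lambda>\<phi>::'a \<Rightarrow> 'k. \<phi> x - \<phi> x0)"
      let ?y = "vadd E (vscale E (of_real (1 - t)) x0) (vscale E (of_real t) x)"
      have y: "?y \<in> unit_ball E" using x x0 t by (intro E.ball_convex) auto
      have vy: "z \<phi> - \<phi> ?y = v \<phi> - t *\<^sub>R w \<phi>" if "\<phi> \<in> \<Phi>" for \<phi>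
        using that \<Phi> dual_add[of \<phi> E] dual_scale[of \<phi> E] xE x0E
        by (auto simp: v_def w_def scaleR_conv_of_real algebra_simps)
      have wC: "(norm (w \<phi>))\<^sup>2 \<le> (2 * vnorm (dual E) \<phi>)\<^sup>2" if "\<phi> \<in> \<Phi>" for \<phi>
      proof (intro power_mono)
        have "norm (w \<phi>) \<le> norm (\<phi> x) + norm (\<phi> x0)" unfolding w_def by (rule norm_triangle_ineq4)
        then show "norm (w \<phi>) \<le> 2 * vnorm (dual E) \<phi>"
          using dual_norm_ball[of \<phi> E x] dual_norm_ball[of \<phi> E x0] that \<Phi> E x x0 by fastforce
      qed auto
      have "S ?y = (\<Sum>\<phi>\<in>\<Phi>. (norm (v \<phi> - t *\<^sub>R w \<phi>))\<^sup>2)"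
        unfolding S_def using vy by (intro sum.cong) auto
      also have "\<dots> = (\<Sum>\<phi>\<in>\<Phi>. (norm (v \<phi>))\<^sup>2 - 2 * t * (v \<phi> \<bullet> w \<phi>) + t\<^sup>2 * (norm (w \<phi>))\<^sup>2)"
        by (intro sum.cong refl) (rule norm_diff_scaleR_sq)
      also have "\<dots> = S x0 - 2 * t * (\<Sum>\<phi>\<in>\<Phi>. v \<phi> \<bullet> w \<phi>) + t\<^sup>2 * (\<Sum>\<phi>\<in>\<Phi>. (norm (w \<phi>))\<^sup>2)"
        by (simp add: S_def v_def sum.distrib sum_subtractf sum_distrib_left)
      also have "(\<Sum>\<phi>\<in>\<Phi>. v \<phi> \<bullet> w \<phi>) = (\<Sum>\<phi>\<in>\<Phi>. w \<phi> \<bullet> v \<phi>)"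
        by (intro sum.cong refl inner_commute)
      also have "\<dots> = \<psi> x \<bullet> 1 - \<psi> x0 \<bullet> 1"
        using xE x0E by (simp add: \<psi>_def w_def inner_sum_left inner_cj_1 inner_diff_left sum_subtractf)
      finally have "d \<le> S x0 - 2 * t * (\<psi> x \<bullet> 1 - \<psi> x0 \<bullet> 1) + t\<^sup>2 * (\<Sum>\<phi>\<in>\<Phi>. (norm (w \<phi>))\<^sup>2)"
        using d_le[OF y] by simp
      also have "\<dots> \<le> d + \<delta> - 2 * t * (\<psi> x \<bullet> 1 - \<psi> x0 \<bullet> 1) + t\<^sup>2 * C"
        unfolding C_def using x0 wC t by (intro add_mono diff_mono mult_left_mono sum_mono) auto
      finally have "2 * t * (\<psi> x \<bullet> 1 - \<psi> x0 \<bullet> 1) \<le> \<delta> + t\<^sup>2 * C" by simp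
      then have "(\<psi> x \<bullet> 1 - \<psi> x0 \<bullet> 1) \<le> (\<delta> + t\<^sup>2 * C) / (2 * t)"
        using t by (simp add: field_simps)
      also have "\<dots> = \<delta> / (2 * t) + t * C / 2" using t by (simp add: field_simps power2_eq_square)
      finally show ?thesis by (simp add: R_def)
    qed
    have nR: "vnorm (dual E) \<psi> \<le> R"
    proof (rule field_le_epsilon)
      fix e :: real assume "e > 0"
      then obtain x where "x \<in> unit_ball E" "\<psi> x \<bullet> 1 > vnorm (dual E) \<psi> - e"
        using dual_norm_approx[OF \<psi>(1) E] by blast
      then show "vnorm (dual E) \<psi> \<le> R + e" using le[of x] by linarith
    qed
    have "z \<psi> \<bullet> 1 \<le> norm (z \<psi>)" by (rule re_le_norm)
    also have "\<dots> \<le> vnorm (bidual E) z * vnorm (dual E) \<psi>"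
      using zd \<psi> by (intro dual_norm_bound E'.seminormed_space_axioms)
    also have "\<dots> \<le> 1 * vnorm (dual E) \<psi>" using zd \<psi> by (intro mult_right_mono E'.norm_nonneg)
    finally have "z \<psi> \<bullet> 1 \<le> R" using nR by simp
    moreover have "z \<psi> \<bullet> 1 - \<psi> x0 \<bullet> 1 = S x0"
      unfolding \<psi>(2) using x0E
      by (simp add: \<psi>_def S_def v_def inner_sum_left inner_cj_1 power2_norm_eq_inner inner_diff_left
          flip: sum_subtractf)
    moreover have "\<delta> / (2 * t) = d / 4" using t by (simp add: \<delta>_def)
    ultimately show False using d_le[OF x0(1)] t(3) d unfolding R_def by linarith
  qed
  then obtain x where x: "x \<in> unit_ball E" "S x < \<eta>\<^sup>2" using near by blast
  show ?thesis
  proof (rule that[OF x(1)])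
    fix \<phi> assume "\<phi> \<in> \<Phi>"
    then have "(norm (z \<phi> - \<phi> x))\<^sup>2 \<le> S x" unfolding S_def using \<Phi> by (intro member_le_sum) auto
    with x have "(norm (z \<phi> - \<phi> x))\<^sup>2 < \<eta>\<^sup>2" by linarith
    then show "norm (z \<phi> - \<phi> x) < \<eta>" using \<eta> by (simp add: power_less_imp_less_base)
  qed
qed

section \<open>Weak compactness\<close>

lemma topspace_weak_topology:
  assumes "seminormed_space E"
  shows "topspace (weak_topology E) = vcarrier E"
proof -
  interpret E': seminormed_space "dual E" using assms by (rule seminormed_dual)
  show ?thesis unfolding weak_topology_def topology_generated_by_topspace
    using E'.zero_closed by blast
qed

lemma openin_weak_topology:
  "\<lbrakk>f \<in> vcarrier (dual E); open U\<rbrakk> \<Longrightarrow> openin (weak_topology E) {x \<in> vcarrier E. f x \<in> U}"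
  unfolding weak_topology_def by (rule topology_generated_by_Basis) blast

lemma Hausdorff_weak_topology:
  assumes "seminormed_space E" "separating E"
  shows "Hausdorff_space (weak_topology E)"
  unfolding Hausdorff_space_def topspace_weak_topology[OF assms(1)]
proof (intro allI impI)
  fix x y assume xy: "x \<in> vcarrier E \<and> y \<in> vcarrier E \<and> x \<noteq> y"
  then obtain f where f: "f \<in> vcarrier (dual E)" "f x \<noteq> f y"
    using assms(2) unfolding separating_def by blast
  then obtain U V where UV: "open U" "open V" "f x \<in> U" "f y \<in> V" "U \<inter> V = {}"
    using hausdorff by metis
  show "\<exists>U V. openin (weak_topology E) U \<and> openin (weak_topology E) V \<and> x \<in> U \<and> y \<in> V \<and> disjnt U V"
    using openin_weak_topology[OF f(1) UV(1)] openin_weak_topology[OF f(1) UV(2)] UV xy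
    by (intro exI[of _ "{x \<in> vcarrier E. f x \<in> U}"] exI[of _ "{x \<in> vcarrier E. f x \<in> V}"])
       (auto simp: disjnt_def)
qed

text \<open>
  The weak topology is Hausdorff, so the closure of \<open>A\<close> stays in \<open>K\<close>.
\<close>

lemma relatively_weakly_compact_subset:
  assumes "seminormed_space E" "separating E" "compactin (weak_topology E) K" "A \<subseteq> K"
  shows "relatively_weakly_compact E A"
proof -
  have K: "closedin (weak_topology E) K"
    using Hausdorff_weak_topology[OF assms(1,2)] assms(3) by (rule compactin_imp_closedin)
  have "weak_topology E closure_of A \<subseteq> K" using assms(4) K by (rule closure_of_minimal)
  then show ?thesis unfolding relatively_weakly_compact_def
    using assms(3,4) closed_compactin[OF assms(3)] compactin_subset_topspace[OF assms(3)]
      topspace_weak_topology[OF assms(1)] by auto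
qed

lemma continuous_map_weak_topology:
  assumes R: "R \<in> vcarrier (bounded_ops E F)" and E: "seminormed_space E" and F: "seminormed_space F"
  shows "continuous_map (weak_topology E) (weak_topology F) R"
  unfolding weak_topology_def[of F]
proof (rule continuous_on_generated_topo)
  fix V assume "V \<in> {{x \<in> vcarrier F. f x \<in> U} |f U. f \<in> vcarrier (dual F) \<and> open U}"
  then obtain f U where V: "V = {x \<in> vcarrier F. f x \<in> U}" and f: "f \<in> vcarrier (dual F)" "open U" by blast
  have "R -` V \<inter> topspace (weak_topology E) = {x \<in> vcarrier E. adjoint_op E F R f x \<in> U}"
    using bops_closed[OF R] f by (auto simp: V topspace_weak_topology[OF E] adjoint_apply)
  then show "openin (weak_topology E) (R -` V \<inter> topspace (weak_topology E))"
    using openin_weak_topology[OF adjoint_dual(1)[OF R E F f(1)] f(2)] by simp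
next
  show "R ` topspace (weak_topology E) \<subseteq> \<Union>{{x \<in> vcarrier F. f x \<in> U} |f U. f \<in> vcarrier (dual F) \<and> open U}"
    using bops_closed[OF R] topspace_weak_topology[OF F]
    unfolding topspace_weak_topology[OF E] weak_topology_def[of F] topology_generated_by_topspace by blast
qed

abbreviation pointwise_topology :: "('k::real_normed_field, 'a) nspace \<Rightarrow> ('a \<Rightarrow> 'k) topology" where
  "pointwise_topology E \<equiv> product_topology (\<lambda>_. euclidean) (vcarrier E)"

lemma continuous_map_evaluation:
  "x \<in> vcarrier E \<Longrightarrow> continuous_map (pointwise_topology E) euclidean (\<lambda>f. f x)"
  by (rule continuous_map_product_projection)

text \<open>
  The dual unit ball is cut out of a product of compact balls by the closed linearity conditions.
\<close>

theorem banach_alaoglu: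
  fixes E :: "('k::{real_normed_field,euclidean_space}, 'a) nspace"
  assumes "seminormed_space E"
  shows "compactin (pointwise_topology E) (unit_ball (dual E))"
proof -
  interpret E: seminormed_space E by fact
  let ?P = "pointwise_topology E"
  let ?B = "PiE (vcarrier E) (\<lambda>x. cball (0::'k) (vnorm E x))"
  define A where "A = (\<lambda>(x, y). {f \<in> topspace ?P. f (vadd E x y) - f x - f y \<in> {0::'k}})"
  define B where "B = (\<lambda>(c::'k, x). {f \<in> topspace ?P. f (vscale E c x) - c * f x \<in> {0::'k}})"
  define K where "K = ?B \<inter> (\<Inter>p\<in>vcarrier E \<times> vcarrier E. A p) \<inter> (\<Inter>p\<in>UNIV \<times> vcarrier E. B p)"
  have cA: "closedin ?P (A p)" if pE: "p \<in> vcarrier E \<times> vcarrier E" for p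
  proof -
    obtain x y where p: "p = (x, y)" "x \<in> vcarrier E" "y \<in> vcarrier E" using pE by blast
    show ?thesis unfolding A_def p prod.case using p
      by (intro closedin_continuous_map_preimage[where Y = euclidean] continuous_map_diff
          continuous_map_evaluation) auto
  qed
  have cB: "closedin ?P (B p)" if pE: "p \<in> UNIV \<times> vcarrier E" for p
  proof -
    obtain c x where p: "p = (c, x)" "x \<in> vcarrier E" using pE by blast
    have "continuous_map ?P euclidean ((\<lambda>a. c * a) \<circ> (\<lambda>f. f x))"
      using p continuous_map_evaluation
      by (intro continuous_map_compose[where X' = euclidean]) (auto simp: continuous_on_mult_left)
    then show ?thesis unfolding B_def p prod.case using p
      by (intro closedin_continuous_map_preimage[where Y = euclidean] continuous_map_diff
          continuous_map_evaluation) (auto simp: o_def)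
  qed
  have cK: "compactin ?P ?B" by (simp add: compactin_PiE)
  have "unit_ball (dual E) = K"
  proof (intro set_eqI iffI)
    fix f assume f: "f \<in> unit_ball (dual E)"
    then have fd: "f \<in> vcarrier (dual E)" "vnorm (dual E) f \<le> 1" by (auto simp: unit_ball_def)
    have "norm (f x) \<le> vnorm E x" if "x \<in> vcarrier E" for x
    proof -
      have "norm (f x) \<le> vnorm (dual E) f * vnorm E x" using dual_norm_bound[OF fd(1) assms that] .
      also have "\<dots> \<le> 1 * vnorm E x" using fd that by (intro mult_right_mono) auto
      finally show ?thesis by simp
    qed
    then show "f \<in> K" using dual_ext[OF fd(1)] dual_add[OF fd(1)] dual_scale[OF fd(1)]
      by (auto simp: K_def A_def B_def PiE_def)
  next
    fix f assume f: "f \<in> K"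
    then have f': "f \<in> extensional (vcarrier E)" "\<And>x. x \<in> vcarrier E \<Longrightarrow> norm (f x) \<le> vnorm E x"
      by (auto simp: K_def PiE_def)
    have "f (vadd E x y) = f x + f y" if "x \<in> vcarrier E" "y \<in> vcarrier E" for x y
    proof -
      have "f \<in> A (x, y)" using f that by (auto simp: K_def)
      then show ?thesis by (auto simp: A_def algebra_simps)
    qed
    moreover have "f (vscale E c x) = c * f x" if "x \<in> vcarrier E" for c x
    proof -
      have "f \<in> B (c, x)" using f that by (auto simp: K_def)
      then show ?thesis by (auto simp: B_def algebra_simps)
    qed
    ultimately have "f \<in> vcarrier (dual E)" using f' by (intro dualI[where C = 1]) auto
    moreover have "vnorm (dual E) f \<le> 1" using f' assms by (intro dual_norm_le') auto
    ultimately show "f \<in> unit_ball (dual E)" by (simp add: unit_ball_def)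
  qed
  moreover have "compactin ?P K"
  proof -
    have "closedin ?P ((\<Inter>p\<in>vcarrier E \<times> vcarrier E. A p) \<inter> (\<Inter>p\<in>UNIV \<times> vcarrier E. B p))"
      using cA cB E.nonempty by (intro closedin_Int closedin_INT) auto
    then show ?thesis unfolding K_def Int_assoc using cK by (simp add: inf_commute[of ?B] closed_Int_compactin)
  qed
  ultimately show ?thesis by simp
qed

text \<open>
  The common source of weakly compact sets below: \<open>ev\<close> says that \<open>\<Psi>\<close> is continuous from the
  topology of pointwise convergence to the weak topology, so the image inherits compactness from
  Banach--Alaoglu.
\<close>

lemma weakly_compact_image_dual_ball:
  assumes E: "seminormed_space E" and F: "seminormed_space F"
    and \<Psi>: "\<And>\<phi>. \<phi> \<in> unit_ball (dual E) \<Longrightarrow> \<Psi> \<phi> \<in> vcarrier F"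
    and ev: "\<And>f. f \<in> vcarrier (dual F) \<Longrightarrow> \<exists>x\<in>vcarrier E. \<forall>\<phi>\<in>unit_ball (dual E). f (\<Psi> \<phi>) = \<phi> x"
  shows "compactin (weak_topology F) (\<Psi> ` unit_ball (dual E))"
proof -
  let ?K = "unit_ball (dual E)"
  let ?P = "subtopology (pointwise_topology E) ?K"
  have top: "topspace ?P = ?K"
    using banach_alaoglu[OF E] compactin_subset_topspace by fastforce
  have "continuous_map ?P (weak_topology F) \<Psi>"
    unfolding weak_topology_def[of F]
  proof (rule continuous_on_generated_topo)
    fix V assume "V \<in> {{x \<in> vcarrier F. f x \<in> U} |f U. f \<in> vcarrier (dual F) \<and> open U}"
    then obtain f U where V: "V = {x \<in> vcarrier F. f x \<in> U}" and f: "f \<in> vcarrier (dual F)" "open U" by blast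
    obtain x where x: "x \<in> vcarrier E" "\<And>\<phi>. \<phi> \<in> ?K \<Longrightarrow> f (\<Psi> \<phi>) = \<phi> x" using ev[OF f(1)] by blast
    have "\<Psi> -` V \<inter> topspace ?P = {\<phi> \<in> topspace ?P. \<phi> x \<in> U}"
      unfolding top V using \<Psi> x(2) by auto
    moreover have "openin ?P {\<phi> \<in> topspace ?P. \<phi> x \<in> U}"
      by (rule openin_continuous_map_preimage[OF continuous_map_from_subtopology[OF continuous_map_evaluation[OF x(1)]]])
         (use f in simp)
    ultimately show "openin ?P (\<Psi> -` V \<inter> topspace ?P)" by simp
  next
    show "\<Psi> ` topspace ?P \<subseteq> \<Union>{{x \<in> vcarrier F. f x \<in> U} |f U. f \<in> vcarrier (dual F) \<and> open U}"
      using \<Psi> topspace_weak_topology[OF F]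
      unfolding top weak_topology_def[of F] topology_generated_by_topspace by blast
  qed
  moreover have "compactin ?P ?K" using banach_alaoglu[OF E] by (simp add: compactin_subtopology)
  ultimately show ?thesis using image_compactin by blast
qed

text \<open>
  If no \<open>d\<close> works, each \<open>d\<close> is refuted by a functional \<open>f\<close>, with some margin and on a weak
  neighbourhood of \<open>d\<close>. Finitely many of these functionals suffice by compactness. Goldstine's theorem
  replaces \<open>z\<close> by a point \<open>x\<close> of the unit ball for all of them at once, and then the element of \<open>D\<close>
  close to \<open>T x\<close> is not refuted. For \<open>\<epsilon> = 0\<close> the conclusion says that the biadjoint takes its
  values in \<open>D\<close>.
\<close>

lemma bidual_near_weakly_compact:
  assumes T: "T \<in> vcarrier (bounded_ops E F)" and E: "seminormed_space E" and F: "seminormed_space F"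
    and D: "compactin (weak_topology F) D"
    and cover: "T ` unit_ball E \<subseteq> {vadd F d (vscale F (of_real \<epsilon>) b) | d b. d \<in> D \<and> b \<in> unit_ball F}"
    and \<epsilon>: "0 \<le> \<epsilon>" and z: "z \<in> unit_ball (bidual E)"
  obtains d where "d \<in> D" "\<And>f. f \<in> vcarrier (dual F) \<Longrightarrow>
    norm (z (adjoint_op E F T f) - f d) \<le> \<epsilon> * vnorm (dual F) f"
proof -
  interpret E: seminormed_space E by fact
  interpret F: seminormed_space F by fact
  let ?T = "adjoint_op E F T"
  have DF: "D \<subseteq> vcarrier F" using compactin_subset_topspace[OF D] topspace_weak_topology[OF F] by simp
  have "\<exists>d\<in>D. \<forall>f\<in>vcarrier (dual F). norm (z (?T f) - f d) \<le> \<epsilon> * vnorm (dual F) f"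
  proof (rule ccontr)
    assume "\<not> ?thesis"
    then have "\<forall>d\<in>D. \<exists>f. f \<in> vcarrier (dual F) \<and> norm (z (?T f) - f d) > \<epsilon> * vnorm (dual F) f"
      by (auto simp: not_le)
    then obtain f where f: "\<And>d. d \<in> D \<Longrightarrow> f d \<in> vcarrier (dual F)"
      "\<And>d. d \<in> D \<Longrightarrow> norm (z (?T (f d)) - f d d) > \<epsilon> * vnorm (dual F) (f d)" by metis
    \<comment> \<open>half of the margin, so that the strict inequality survives on a neighbourhood of d\<close>
    define e where "e = (\<lambda>d. (norm (z (?T (f d)) - f d d) - \<epsilon> * vnorm (dual F) (f d)) / 2)"
    have e: "e d > 0" if "d \<in> D" for d using f(2)[OF that] by (simp add: e_def)
    define O' where "O' = (\<lambda>d. {w. norm (z (?T (f d)) - w) > \<epsilon> * vnorm (dual F) (f d) + e d})"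
    define U where "U = (\<lambda>d. {y \<in> vcarrier F. f d y \<in> O' d})"
    have "open (O' d)" for d unfolding O'_def by (intro open_Collect_less continuous_intros)
    then have "openin (weak_topology F) (U d)" if "d \<in> D" for d
      unfolding U_def using f(1)[OF that] by (intro openin_weak_topology)
    moreover have "d \<in> U d" if "d \<in> D" for d
      using f(2)[OF that] e[OF that] that DF by (auto simp: U_def O'_def e_def field_simps)
    ultimately have "\<exists>\<F>. finite \<F> \<and> \<F> \<subseteq> U ` D \<and> D \<subseteq> \<Union>\<F>"
      using D DF compactinD[OF D, of "U ` D"] by blast
    then obtain D0 where D0: "finite D0" "D0 \<subseteq> D" "D \<subseteq> (\<Union>d\<in>D0. U d)"
      by (metis finite_subset_image)
    have D0ne: "D0 \<noteq> {}"
    proof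
      assume "D0 = {}"
      then have "D = {}" using D0 by simp
      then show False using cover E.zero_in_ball by auto
    qed
    define \<eta> where "\<eta> = Min (e ` D0)"
    have \<eta>: "\<eta> > 0" "\<And>d. d \<in> D0 \<Longrightarrow> \<eta> \<le> e d" unfolding \<eta>_def using D0 D0ne e by auto
    obtain x where x: "x \<in> unit_ball E" "\<And>\<phi>. \<phi> \<in> (\<lambda>d. ?T (f d)) ` D0 \<Longrightarrow> norm (z \<phi> - \<phi> x) < \<eta>"
    proof (rule goldstine[OF E z _ _ \<eta>(1)])
      show "finite ((\<lambda>d. ?T (f d)) ` D0)" using D0 by simp
      show "(\<lambda>d. ?T (f d)) ` D0 \<subseteq> vcarrier (dual E)"
        using D0(2) f(1) adjoint_dual(1)[OF T E F] by blast
    qed blast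
    obtain d b where db: "d \<in> D" "b \<in> unit_ball F" "T x = vadd F d (vscale F (of_real \<epsilon>) b)"
      using cover x(1) by blast
    then obtain c where c: "c \<in> D0" "d \<in> U c" using D0 by blast
    have cD: "c \<in> D" using c D0 by blast
    have fc: "f c \<in> vcarrier (dual F)" using f(1)[OF cD] .
    have "norm (z (?T (f c)) - f c (T x)) < \<eta>"
      using x(2)[of "?T (f c)"] c(1) fc x(1) by (simp add: adjoint_apply E.ball_closed)
    moreover have "f c (T x) = f c d + of_real \<epsilon> * f c b"
      unfolding db(3) using fc db DF by (auto simp: dual_add dual_scale F.ball_closed)
    moreover have "norm (of_real \<epsilon> * f c b) \<le> \<epsilon> * vnorm (dual F) (f c)"
      using dual_norm_ball[OF fc F db(2)] \<epsilon> by (simp add: norm_mult mult_left_mono)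
    moreover have "norm (z (?T (f c)) - f c d) \<le> norm (z (?T (f c)) - f c (T x)) + norm (f c (T x) - f c d)"
      using norm_triangle_ineq[of "z (?T (f c)) - f c (T x)" "f c (T x) - f c d"] by simp
    ultimately have "norm (z (?T (f c)) - f c d) < \<eta> + \<epsilon> * vnorm (dual F) (f c)" by simp
    moreover have "norm (z (?T (f c)) - f c d) > \<epsilon> * vnorm (dual F) (f c) + e c"
      using c(2) by (simp add: U_def O'_def)
    ultimately show False using \<eta>(2)[OF c(1)] by simp
  qed
  then show ?thesis using that by blast
qed


lemma bidual_image_weakly_compact_op:
  assumes W: "weakly_compact_op E F W" and E: "seminormed_space E" and F: "seminormed_space F"
    and z: "z \<in> vcarrier (bidual E)"
  obtains y where "y \<in> vcarrier F" "\<And>f. f \<in> vcarrier (dual F) \<Longrightarrow> z (adjoint_op E F W f) = f y"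
proof -
  interpret E: seminormed_space E by fact
  interpret F: seminormed_space F by fact
  interpret E': seminormed_space "dual E" using E by (rule seminormed_dual)
  interpret F': seminormed_space "dual F" using F by (rule seminormed_dual)
  interpret E'': seminormed_space "bidual E" using E'.seminormed_space_axioms by (rule seminormed_dual)
  let ?D = "weak_topology F closure_of (W ` unit_ball E)"
  have Wb: "W \<in> vcarrier (bounded_ops E F)" and D: "compactin (weak_topology F) ?D"
    using W by (auto simp: weakly_compact_op_def relatively_weakly_compact_def)
  have WF: "W ` unit_ball E \<subseteq> vcarrier F" using bops_closed[OF Wb] E.ball_closed by blast
  have sub: "W ` unit_ball E \<subseteq> ?D"
    using WF topspace_weak_topology[OF F] by (intro closure_of_subset) simp
  have DF: "?D \<subseteq> vcarrier F" using topspace_weak_topology[OF F] closure_of_subset_topspace[of "weak_topology F"] by simp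
  \<comment> \<open>rescaling puts z into the unit ball; the summand 1 avoids a division by zero\<close>
  define r where "r = vnorm (bidual E) z + 1"
  have r: "r > 0" using E''.norm_nonneg[OF z] by (simp add: r_def)
  define u where "u = vscale (bidual E) (of_real (inverse r)) z"
  have "vnorm (bidual E) u = inverse r * vnorm (bidual E) z"
    unfolding u_def E''.norm_scale[OF z] norm_of_real using r by simp
  also have "\<dots> \<le> 1" using r by (simp add: field_simps) (simp add: r_def)
  finally have u: "u \<in> unit_ball (bidual E)"
    using z by (simp add: u_def unit_ball_def)
  obtain d where d: "d \<in> ?D" "\<And>f. f \<in> vcarrier (dual F) \<Longrightarrow> norm (u (adjoint_op E F W f) - f d) \<le> 0 * vnorm (dual F) f"
  proof (rule bidual_near_weakly_compact[OF Wb E F D _ _ u, where \<epsilon> = 0])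
    have "W x = vadd F (W x) (vscale F (of_real 0) F.vzero)" if "x \<in> unit_ball E" for x
      using that bops_closed[OF Wb] by (simp add: E.ball_closed)
    then show "W ` unit_ball E \<subseteq> {vadd F d (vscale F (of_real 0) b) |d b. d \<in> ?D \<and> b \<in> unit_ball F}"
      using sub F.zero_in_ball by blast
  qed auto
  have dF: "d \<in> vcarrier F" using d DF by blast
  show ?thesis
  proof (rule that[of "vscale F (of_real r) d"])
    show "vscale F (of_real r) d \<in> vcarrier F" using dF by simp
    fix f assume f: "f \<in> vcarrier (dual F)"
    have "adjoint_op E F W f \<in> vcarrier (dual E)" using adjoint_dual(1)[OF Wb E F f] .
    then have "u (adjoint_op E F W f) = of_real (inverse r) * z (adjoint_op E F W f)"
      by (simp add: u_def dual_sel)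
    then show "z (adjoint_op E F W f) = f (vscale F (of_real r) d)"
      using d(2)[OF f] r f dF by (simp add: dual_scale field_simps)
  qed
qed

text \<open>
  The converse of \<open>bidual_image_weakly_compact_op\<close>: if the biadjoint takes its values in \<open>F\<close>, it
  maps the bidual ball continuously onto a weakly compact set that contains the image of the ball.
\<close>

lemma weakly_compact_opI:
  assumes W: "W \<in> vcarrier (bounded_ops E F)" and E: "seminormed_space E" and F: "seminormed_space F"
    and sep: "separating F"
    and range: "\<And>z. z \<in> unit_ball (bidual E) \<Longrightarrow>
      \<exists>y\<in>vcarrier F. \<forall>f\<in>vcarrier (dual F). z (adjoint_op E F W f) = f y"
  shows "weakly_compact_op E F W"
proof -
  interpret E: seminormed_space E by fact
  obtain \<Psi> where \<Psi>: "\<And>z. z \<in> unit_ball (bidual E) \<Longrightarrow> \<Psi> z \<in> vcarrier F"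
    "\<And>z f. z \<in> unit_ball (bidual E) \<Longrightarrow> f \<in> vcarrier (dual F) \<Longrightarrow> z (adjoint_op E F W f) = f (\<Psi> z)"
    using range by metis
  have "compactin (weak_topology F) (\<Psi> ` unit_ball (bidual E))"
  proof (rule weakly_compact_image_dual_ball[OF seminormed_dual[OF E] F \<Psi>(1)])
    show "\<exists>x\<in>vcarrier (dual E). \<forall>\<phi>\<in>unit_ball (bidual E). f (\<Psi> \<phi>) = \<phi> x" if "f \<in> vcarrier (dual F)" for f
      using \<Psi>(2)[OF _ that] adjoint_dual(1)[OF W E F that] by metis
  qed
  moreover have "W ` unit_ball E \<subseteq> \<Psi> ` unit_ball (bidual E)"
  proof (rule image_subsetI)
    fix x assume x: "x \<in> unit_ball E"
    then have xE: "x \<in> vcarrier E" by (rule E.ball_closed)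
    let ?z = "canonical_embedding E x"
    have z: "?z \<in> unit_ball (bidual E)"
      using emb_bidual[OF E xE] x by (auto simp: unit_ball_def)
    have "f (W x) = f (\<Psi> ?z)" if "f \<in> vcarrier (dual F)" for f
      using \<Psi>(2)[OF z that] adjoint_dual(1)[OF W E F that] that xE by (simp add: emb_apply adjoint_apply)
    then have "W x = \<Psi> ?z"
      using sep \<Psi>(1)[OF z] bops_closed[OF W xE] unfolding separating_def by blast
    then show "W x \<in> \<Psi> ` unit_ball (bidual E)" using z by blast
  qed
  ultimately show ?thesis
    using W relatively_weakly_compact_subset[OF F sep] unfolding weakly_compact_op_def by blast
qed

text \<open>
  By \<open>bidual_image_weakly_compact_op\<close> the adjoint is continuous from the topology of pointwise
  convergence on the dual ball to the weak topology.
\<close>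

theorem gantmacher:
  assumes W: "weakly_compact_op E F W" and E: "seminormed_space E" and F: "seminormed_space F"
  shows "weakly_compact_op (dual F) (dual E) (adjoint_op E F W)"
proof -
  interpret F': seminormed_space "dual F" using F by (rule seminormed_dual)
  have Wb: "W \<in> vcarrier (bounded_ops E F)" using W by (simp add: weakly_compact_op_def)
  have "compactin (weak_topology (dual E)) (adjoint_op E F W ` unit_ball (dual F))"
  proof (rule weakly_compact_image_dual_ball[OF F seminormed_dual[OF E]])
    show "adjoint_op E F W \<phi> \<in> vcarrier (dual E)" if "\<phi> \<in> unit_ball (dual F)" for \<phi>
      using adjoint_dual(1)[OF Wb E F F'.ball_closed[OF that]] .
    show "\<exists>x\<in>vcarrier F. \<forall>\<phi>\<in>unit_ball (dual F). f (adjoint_op E F W \<phi>) = \<phi> x"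
      if f: "f \<in> vcarrier (bidual E)" for f
    proof -
      obtain y where "y \<in> vcarrier F" "\<And>g. g \<in> vcarrier (dual F) \<Longrightarrow> f (adjoint_op E F W g) = g y"
        using bidual_image_weakly_compact_op[OF W E F f] by blast
      then show ?thesis using F'.ball_closed by blast
    qed
  qed
  then show ?thesis unfolding weakly_compact_op_def
    using adjoint_bops(1)[OF Wb E F] relatively_weakly_compact_subset[OF seminormed_dual[OF E] separating_dual[OF E]]
    by blast
qed

section \<open>The elementary inequalities\<close>

lemma residuum_sel:
  "vcarrier (residuum E) = coset (bidual E) (embedded E) ` vcarrier (bidual E)"
  "vnorm (residuum E) A = (INF a\<in>A. vnorm (bidual E) a)"
  by (simp_all add: residuum_def quotient_space_def)

lemma coset_embedded_closed:
  assumes "seminormed_space E" "z \<in> vcarrier (bidual E)"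
  shows "coset (bidual E) (embedded E) z \<subseteq> vcarrier (bidual E)"
proof -
  interpret E'': seminormed_space "bidual E" using assms(1) by (intro seminormed_dual)
  show ?thesis using assms(2) emb_bidual(1)[OF assms(1)] by (auto simp: coset_def)
qed

lemma residuum_op_apply:
  "A \<in> vcarrier (residuum E) \<Longrightarrow>
    residuum_op E F T A = (\<Union>x\<in>A. coset (bidual F) (embedded F) (biadjoint_op E F T x))"
  by (simp add: residuum_op_def)

lemma residuum_op_closed:
  assumes T: "T \<in> vcarrier (bounded_ops E F)" and E: "seminormed_space E" and F: "seminormed_space F"
    and A: "A \<in> vcarrier (residuum E)"
  shows "residuum_op E F T A \<subseteq> vcarrier (bidual F)"
proof -
  have AE: "A \<subseteq> vcarrier (bidual E)" using A coset_embedded_closed[OF E] by (auto simp: residuum_sel)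
  have "biadjoint_op E F T x \<in> vcarrier (bidual F)" if "x \<in> A" for x
    using adjoint_bops(1)[OF T E F] that AE by (intro adjoint_dual(1) seminormed_dual E F) auto
  then show ?thesis unfolding residuum_op_apply[OF A] using coset_embedded_closed[OF F] by blast
qed

text \<open>
  A coset in the unit ball has representatives of norm at most \<open>1 + \<eta>\<close> only, which is why
  \<open>bidual_near_weakly_compact\<close> is applied to a rescaled representative.
\<close>

lemma residuum_op_norm_le:
  assumes T: "T \<in> vcarrier (bounded_ops E F)" and E: "seminormed_space E" and F: "seminormed_space F"
    and D: "compactin (weak_topology F) D"
    and cover: "T ` unit_ball E \<subseteq> {vadd F d (vscale F (of_real \<epsilon>) b) | d b. d \<in> D \<and> b \<in> unit_ball F}"
    and \<epsilon>: "0 \<le> \<epsilon>" and A: "A \<in> unit_ball (residuum E)"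
  shows "vnorm (residuum F) (residuum_op E F T A) \<le> \<epsilon>"
proof -
  interpret F: seminormed_space F by fact
  interpret E'': seminormed_space "bidual E" using E by (intro seminormed_dual)
  interpret F': seminormed_space "dual F" using F by (intro seminormed_dual)
  interpret F'': seminormed_space "bidual F" using F by (intro seminormed_dual)
  have Ac: "A \<in> vcarrier (residuum E)" and A1: "vnorm (residuum E) A \<le> 1" using A by (auto simp: unit_ball_def)
  have AE: "A \<subseteq> vcarrier (bidual E)" using Ac coset_embedded_closed[OF E] by (auto simp: residuum_sel)
  have Ane: "A \<noteq> {}"
    using Ac E unfolding residuum_sel coset_def by (auto simp: seminormed_space.nonempty)
  have DF: "D \<subseteq> vcarrier F" using compactin_subset_topspace[OF D] topspace_weak_topology[OF F] by simp
  have key: "vnorm (residuum F) (residuum_op E F T A) \<le> \<epsilon> * (1 + \<eta>)" if \<eta>: "\<eta> > 0" for \<eta>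
  proof -
    have "bdd_below (vnorm (bidual E) ` A)" using AE by (intro bdd_belowI2[of _ 0]) auto
    then obtain z where z: "z \<in> A" "vnorm (bidual E) z < 1 + \<eta>"
      using A1 \<eta> Ane cINF_less_iff[of A "vnorm (bidual E)" "1 + \<eta>"] by (force simp: residuum_sel)
    have zE: "z \<in> vcarrier (bidual E)" using z AE by blast
    define u where "u = vscale (bidual E) (of_real (inverse (1 + \<eta>))) z"
    have "vnorm (bidual E) u = inverse (1 + \<eta>) * vnorm (bidual E) z"
      unfolding u_def E''.norm_scale[OF zE] norm_of_real using \<eta> by simp
    also have "\<dots> \<le> 1" using \<eta> z by (simp add: field_simps)
    finally have u: "u \<in> unit_ball (bidual E)" using zE by (simp add: u_def unit_ball_def)
    obtain d where d: "d \<in> D" "\<And>f. f \<in> vcarrier (dual F) \<Longrightarrow>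
        norm (u (adjoint_op E F T f) - f d) \<le> \<epsilon> * vnorm (dual F) f"
      using bidual_near_weakly_compact[OF T E F D cover \<epsilon> u] by blast
    have dF: "d \<in> vcarrier F" using d DF by blast
    let ?y = "vscale F (- of_real (1 + \<eta>)) d"
    let ?b = "vadd (bidual F) (biadjoint_op E F T z) (canonical_embedding F ?y)"
    have Tz: "biadjoint_op E F T z \<in> vcarrier (bidual F)"
      using adjoint_bops(1)[OF T E F] zE by (intro adjoint_dual(1) seminormed_dual E F) auto
    have b: "?b \<in> residuum_op E F T A"
      unfolding residuum_op_apply[OF Ac] coset_def using z(1) dF by blast
    have "vnorm (bidual F) ?b \<le> \<epsilon> * (1 + \<eta>)"
    proof (rule dual_norm_le'[OF F'.seminormed_space_axioms])
      fix f assume f: "f \<in> vcarrier (dual F)"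
      have Tf: "adjoint_op E F T f \<in> vcarrier (dual E)" using adjoint_dual(1)[OF T E F f] .
      have "?b f = z (adjoint_op E F T f) - of_real (1 + \<eta>) * f d"
        using f dF zE biadjoint_apply[OF T E F zE f] by (simp add: dual_sel emb_apply dual_scale algebra_simps)
      also have "\<dots> = of_real (1 + \<eta>) * (u (adjoint_op E F T f) - f d)"
      proof -
        have "of_real (1 + \<eta>) * u (adjoint_op E F T f)
            = (of_real (1 + \<eta>) * of_real (inverse (1 + \<eta>))) * z (adjoint_op E F T f)"
          using Tf by (simp add: u_def dual_sel)
        also have "\<dots> = z (adjoint_op E F T f)"
          unfolding of_real_mult[symmetric] using \<eta> by simp
        finally show ?thesis by (simp add: right_diff_distrib)
      qed
      finally have eq: "?b f = of_real (1 + \<eta>) * (u (adjoint_op E F T f) - f d)" .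
      have "norm (?b f) = (1 + \<eta>) * norm (u (adjoint_op E F T f) - f d)"
        unfolding eq norm_mult norm_of_real using \<eta> by simp
      also have "\<dots> \<le> (1 + \<eta>) * (\<epsilon> * vnorm (dual F) f)"
        using d(2)[OF f] \<eta> by (intro mult_left_mono) auto
      finally show "norm (?b f) \<le> \<epsilon> * (1 + \<eta>) * vnorm (dual F) f" by (simp add: mult_ac)
    qed (use \<epsilon> \<eta> in auto)
    moreover have "vnorm (residuum F) (residuum_op E F T A) \<le> vnorm (bidual F) ?b"
      unfolding residuum_sel using residuum_op_closed[OF T E F Ac] b
      by (intro cINF_lower bdd_belowI2[of _ 0]) auto
    ultimately show ?thesis by linarith
  qed
  show ?thesis
  proof (rule field_le_epsilon)
    fix e :: real assume e: "e > 0"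
    have "\<epsilon> * (1 + e / (\<epsilon> + 1)) \<le> \<epsilon> + e" using e \<epsilon> by (simp add: field_simps)
    then show "vnorm (residuum F) (residuum_op E F T A) \<le> \<epsilon> + e"
      using key[of "e / (\<epsilon> + 1)"] e \<epsilon> by simp
  qed
qed

lemma residuum_ball_nonempty:
  assumes E: "seminormed_space E"
  shows "unit_ball (residuum E) \<noteq> {}"
proof -
  interpret E: seminormed_space E by fact
  interpret E'': seminormed_space "bidual E" using E by (intro seminormed_dual)
  let ?A = "coset (bidual E) (embedded E) E''.vzero"
  have m: "vadd (bidual E) E''.vzero (canonical_embedding E E.vzero) \<in> ?A"
    unfolding coset_def by blast
  have n0: "vnorm (bidual E) (canonical_embedding E E.vzero) \<le> 0"
    using emb_bidual(2)[OF E E.zero_closed] by simp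
  have "vnorm (residuum E) ?A \<le> vnorm (bidual E) (vadd (bidual E) E''.vzero (canonical_embedding E E.vzero))"
    unfolding residuum_sel using coset_embedded_closed[OF E E''.zero_closed] m
    by (intro cINF_lower bdd_belowI2[of _ 0]) auto
  also have "\<dots> \<le> 1" using n0 emb_bidual(1)[OF E E.zero_closed] by simp
  finally show ?thesis unfolding unit_ball_def residuum_sel by blast
qed

abbreviation de_blasi_radii ::
  "('k::real_normed_field, 'a) nspace \<Rightarrow> ('k, 'b) nspace \<Rightarrow> ('a \<Rightarrow> 'b) \<Rightarrow> real set" where
  "de_blasi_radii E F T \<equiv> {\<epsilon>. \<epsilon> > 0 \<and> (\<exists>D. compactin (weak_topology F) D \<and>
    T ` unit_ball E \<subseteq> {vadd F d (vscale F (of_real \<epsilon>) b) | d b. d \<in> D \<and> b \<in> unit_ball F})}"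

text \<open>
  Write \<open>T x = W x + \<epsilon> b\<close> with \<open>b = \<epsilon>\<^sup>-\<^sup>1 (T - W) x\<close>; the weak closure of the image of the ball
  under \<open>W\<close> is the compact set.
\<close>

lemma de_blasi_radiiI:
  assumes T: "T \<in> vcarrier (bounded_ops E F)" and E: "seminormed_space E" and F: "seminormed_space F"
    and W: "weakly_compact_op E F W" and \<epsilon>: "\<epsilon> > 0" "op_norm E F (vdiff (bounded_ops E F) T W) \<le> \<epsilon>"
  shows "\<epsilon> \<in> de_blasi_radii E F T"
proof -
  interpret E: seminormed_space E by fact
  interpret F: seminormed_space F by fact
  interpret L: seminormed_space "bounded_ops E F" using E F by (rule seminormed_bounded_ops)
  let ?D = "weak_topology F closure_of (W ` unit_ball E)" and ?R = "vdiff (bounded_ops E F) T W"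
  have Wb: "W \<in> vcarrier (bounded_ops E F)" and D: "compactin (weak_topology F) ?D"
    using W by (auto simp: weakly_compact_op_def relatively_weakly_compact_def)
  have sub: "W ` unit_ball E \<subseteq> ?D"
    using bops_closed[OF Wb] E.ball_closed topspace_weak_topology[OF F] by (intro closure_of_subset) auto
  have R: "?R \<in> vcarrier (bounded_ops E F)" using T Wb by simp
  have "T x \<in> {vadd F d (vscale F (of_real \<epsilon>) b) | d b. d \<in> ?D \<and> b \<in> unit_ball F}" if x: "x \<in> unit_ball E" for x
  proof -
    have xE: "x \<in> vcarrier E" using x by (rule E.ball_closed)
    define b where "b = vscale F (of_real (inverse \<epsilon>)) (?R x)"
    have "vnorm F b = inverse \<epsilon> * vnorm F (?R x)"
      unfolding b_def F.norm_scale[OF bops_closed[OF R xE]] norm_of_real using \<epsilon> by simp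
    also have "\<dots> \<le> inverse \<epsilon> * \<epsilon>"
      using op_norm_ball[OF R E x] \<epsilon> by (intro mult_left_mono) auto
    finally have b: "b \<in> unit_ball F" using \<epsilon> bops_closed[OF R xE] by (simp add: unit_ball_def b_def)
    have "vscale F (of_real \<epsilon>) b = ?R x"
    proof -
      have "vscale F (of_real \<epsilon>) b = vscale F (of_real \<epsilon> * of_real (inverse \<epsilon>)) (?R x)"
        unfolding b_def by (rule F.scale_scale[OF bops_closed[OF R xE]])
      then show ?thesis unfolding of_real_mult[symmetric] using \<epsilon> bops_closed[OF R xE] by simp
    qed
    moreover have "?R x = vdiff F (T x) (W x)" using xE by (simp add: vdiff_def bounded_ops_sel)
    ultimately have "T x = vadd F (W x) (vscale F (of_real \<epsilon>) b)"
      using F.add_diff_cancel[OF bops_closed[OF T xE] bops_closed[OF Wb xE]] by simp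
    then show ?thesis using sub x b by blast
  qed
  then show ?thesis using \<epsilon> D by blast
qed

lemma zero_weakly_compact_op:
  assumes E: "seminormed_space E" and F: "seminormed_space F" and sep: "separating F"
  shows "\<exists>W. weakly_compact_op E F W"
proof -
  interpret E: seminormed_space E by fact
  interpret F: seminormed_space F by fact
  let ?W = "\<lambda>x\<in>vcarrier E. F.vzero"
  have "?W \<in> vcarrier (bounded_ops E F)"
    by (rule bounded_opsI[where C = 0]) auto
  moreover have "?W ` unit_ball E \<subseteq> {F.vzero}" using E.ball_closed by auto
  moreover have "compactin (weak_topology F) {F.vzero}"
    using topspace_weak_topology[OF F] by (simp add: compactin_sing)
  ultimately show ?thesis
    using relatively_weakly_compact_subset[OF F sep] unfolding weakly_compact_op_def by blast
qed

lemma weak_essential_norm_lowerI: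
  assumes "seminormed_space E" "seminormed_space F" "separating F"
    and "\<And>W. weakly_compact_op E F W \<Longrightarrow> c \<le> op_norm E F (vdiff (bounded_ops E F) T W)"
  shows "c \<le> weak_essential_norm E F T"
  unfolding weak_essential_norm_def using zero_weakly_compact_op[OF assms(1-3)] assms(4)
  by (intro cInf_greatest) auto

lemma weak_essential_norm_le:
  assumes T: "T \<in> vcarrier (bounded_ops E F)" and E: "seminormed_space E" and F: "seminormed_space F"
    and W: "weakly_compact_op E F W"
  shows "weak_essential_norm E F T \<le> op_norm E F (vdiff (bounded_ops E F) T W)"
proof -
  interpret L: seminormed_space "bounded_ops E F" using E F by (rule seminormed_bounded_ops)
  show ?thesis unfolding weak_essential_norm_def
    using W T by (intro cInf_lower bdd_belowI[of _ 0])
      (auto simp: weakly_compact_op_def intro!: L.norm_nonneg)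
qed

lemma de_blasi_op_le_weak_essential_norm:
  assumes T: "T \<in> vcarrier (bounded_ops E F)" and E: "seminormed_space E" and F: "seminormed_space F"
    and sep: "separating F"
  shows "de_blasi_op E F T \<le> weak_essential_norm E F T"
proof (rule weak_essential_norm_lowerI[OF E F sep])
  interpret L: seminormed_space "bounded_ops E F" using E F by (rule seminormed_bounded_ops)
  fix W assume W: "weakly_compact_op E F W"
  then have Wb: "W \<in> vcarrier (bounded_ops E F)" by (simp add: weakly_compact_op_def)
  have n: "0 \<le> op_norm E F (vdiff (bounded_ops E F) T W)" using T Wb by (intro L.norm_nonneg) auto
  show "de_blasi_op E F T \<le> op_norm E F (vdiff (bounded_ops E F) T W)"
  proof (rule field_le_epsilon)
    fix e :: real assume "e > 0"
    then have "op_norm E F (vdiff (bounded_ops E F) T W) + e \<in> de_blasi_radii E F T"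
      using n by (intro de_blasi_radiiI[OF T E F W]) auto
    then show "de_blasi_op E F T \<le> op_norm E F (vdiff (bounded_ops E F) T W) + e"
      unfolding de_blasi_op_def de_blasi_def
      by (intro cInf_lower bdd_belowI[of _ 0]) auto
  qed
qed

lemma de_blasi_radii_nonempty:
  assumes T: "T \<in> vcarrier (bounded_ops E F)" and E: "seminormed_space E" and F: "seminormed_space F"
    and sep: "separating F"
  shows "de_blasi_radii E F T \<noteq> {}"
proof -
  interpret L: seminormed_space "bounded_ops E F" using E F by (rule seminormed_bounded_ops)
  obtain W where W: "weakly_compact_op E F W" using zero_weakly_compact_op[OF E F sep] by blast
  then have "W \<in> vcarrier (bounded_ops E F)" by (simp add: weakly_compact_op_def)
  then have "0 \<le> op_norm E F (vdiff (bounded_ops E F) T W)" using T by (intro L.norm_nonneg) auto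
  then have "op_norm E F (vdiff (bounded_ops E F) T W) + 1 \<in> de_blasi_radii E F T"
    by (intro de_blasi_radiiI[OF T E F W]) auto
  then show ?thesis by (metis empty_iff)
qed

text \<open>
  The operator norm is a supremum in the reals, so it bounds its values only once it is known to be
  finite.
\<close>

lemma residuum_op_norm_bdd:
  assumes T: "T \<in> vcarrier (bounded_ops E F)" and E: "seminormed_space E" and F: "seminormed_space F"
    and sep: "separating F" and A: "A \<in> unit_ball (residuum E)"
  shows "vnorm (residuum F) (residuum_op E F T A) \<le> op_norm (residuum E) (residuum F) (residuum_op E F T)"
proof -
  obtain \<epsilon> where "\<epsilon> \<in> de_blasi_radii E F T" using de_blasi_radii_nonempty[OF T E F sep] by blast
  then have "vnorm (residuum F) (residuum_op E F T B) \<le> \<epsilon>" if "B \<in> unit_ball (residuum E)" for B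
    using residuum_op_norm_le[OF T E F _ _ _ that] by fastforce
  then show ?thesis unfolding bounded_ops_sel using A by (intro cSUP_upper bdd_aboveI2[of _ _ \<epsilon>])
qed

lemma residuum_op_norm_le_de_blasi:
  assumes T: "T \<in> vcarrier (bounded_ops E F)" and E: "seminormed_space E" and F: "seminormed_space F"
    and sep: "separating F"
  shows "op_norm (residuum E) (residuum F) (residuum_op E F T) \<le> de_blasi_op E F T"
  unfolding de_blasi_op_def de_blasi_def
proof (rule cInf_greatest[OF de_blasi_radii_nonempty[OF T E F sep]])
  fix \<epsilon> assume "\<epsilon> \<in> de_blasi_radii E F T"
  then have "vnorm (residuum F) (residuum_op E F T B) \<le> \<epsilon>" if "B \<in> unit_ball (residuum E)" for B
    using residuum_op_norm_le[OF T E F _ _ _ that] by fastforce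
  then show "op_norm (residuum E) (residuum F) (residuum_op E F T) \<le> \<epsilon>"
    unfolding bounded_ops_sel by (intro cSUP_least residuum_ball_nonempty[OF E])
qed

lemma adjoint_diff:
  assumes T: "T \<in> vcarrier (bounded_ops E F)" and S: "S \<in> vcarrier (bounded_ops E F)"
    and E: "seminormed_space E" and F: "seminormed_space F"
  shows "adjoint_op E F (vdiff (bounded_ops E F) T S)
    = vdiff (bounded_ops (dual F) (dual E)) (adjoint_op E F T) (adjoint_op E F S)"
proof (rule extensionalityI[of _ "vcarrier (dual F)"])
  interpret F: seminormed_space F by fact
  fix g assume g: "g \<in> vcarrier (dual F)"
  show "adjoint_op E F (vdiff (bounded_ops E F) T S) g
    = vdiff (bounded_ops (dual F) (dual E)) (adjoint_op E F T) (adjoint_op E F S) g"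
    using g bops_closed[OF T] bops_closed[OF S]
    by (auto simp: adjoint_op_def vdiff_def bounded_ops_sel dual_sel dual_add dual_scale)
qed (auto simp: adjoint_op_def vdiff_def bounded_ops_sel)

lemma weak_essential_norm_adjoint_le:
  assumes T: "T \<in> vcarrier (bounded_ops E F)" and E: "seminormed_space E" and F: "seminormed_space F"
    and sep: "separating F"
  shows "weak_essential_norm (dual F) (dual E) (adjoint_op E F T) \<le> weak_essential_norm E F T"
proof (rule weak_essential_norm_lowerI[OF E F sep])
  interpret L: seminormed_space "bounded_ops E F" using E F by (rule seminormed_bounded_ops)
  fix W assume W: "weakly_compact_op E F W"
  then have Wb: "W \<in> vcarrier (bounded_ops E F)" by (simp add: weakly_compact_op_def)
  have "weak_essential_norm (dual F) (dual E) (adjoint_op E F T)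
    \<le> op_norm (dual F) (dual E) (vdiff (bounded_ops (dual F) (dual E)) (adjoint_op E F T) (adjoint_op E F W))"
    using gantmacher[OF W E F] adjoint_bops(1)[OF T E F] E F
    by (intro weak_essential_norm_le seminormed_dual)
  also have "\<dots> \<le> op_norm E F (vdiff (bounded_ops E F) T W)"
    unfolding adjoint_diff[OF T Wb E F, symmetric] using T Wb E F by (intro adjoint_bops(2)) auto
  finally show "weak_essential_norm (dual F) (dual E) (adjoint_op E F T)
      \<le> op_norm E F (vdiff (bounded_ops E F) T W)" .
qed

text \<open>
  A weakly compact \<open>W\<close> between the duals induces \<open>W' = P \<circ> adjoint W \<circ> \<iota>\<close>, which is weakly compact by
  Gantmacher's theorem and the weak continuity of \<open>P\<close>. Since \<open>T = P \<circ> T'' \<circ> \<iota>\<close>, the difference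
  \<open>T - W'\<close> is \<open>P \<circ> adjoint (T' - W) \<circ> \<iota>\<close>, and neither \<open>P\<close> nor \<open>\<iota>\<close> increases norms.
\<close>

lemma weak_essential_norm_le_adjoint:
  assumes T: "T \<in> vcarrier (bounded_ops E F)" and E: "seminormed_space E" and F: "seminormed_space F"
    and sep: "separating F"
    and P: "P \<in> vcarrier (bounded_ops (bidual F) F)"
    and P_norm: "\<And>z. z \<in> vcarrier (bidual F) \<Longrightarrow> vnorm F (P z) \<le> vnorm (bidual F) z"
    and P_emb: "\<And>y. y \<in> vcarrier F \<Longrightarrow> P (canonical_embedding F y) = y"
  shows "weak_essential_norm E F T \<le> weak_essential_norm (dual F) (dual E) (adjoint_op E F T)"
proof (rule weak_essential_norm_lowerI[OF seminormed_dual[OF F] seminormed_dual[OF E] separating_dual[OF E]])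
  interpret E: seminormed_space E by fact
  interpret F: seminormed_space F by fact
  interpret E'': seminormed_space "bidual E" using E by (intro seminormed_dual)
  interpret F'': seminormed_space "bidual F" using F by (intro seminormed_dual)
  interpret L: seminormed_space "bounded_ops E F" using E F by (rule seminormed_bounded_ops)
  interpret L': seminormed_space "bounded_ops (dual F) (dual E)"
    using E F by (intro seminormed_bounded_ops seminormed_dual)
  fix W assume W: "weakly_compact_op (dual F) (dual E) W"
  then have Wb: "W \<in> vcarrier (bounded_ops (dual F) (dual E))" by (simp add: weakly_compact_op_def)
  let ?\<iota> = "canonical_embedding E"
  define V where "V = adjoint_op (dual F) (dual E) W"
  define W' where "W' = (\<lambda>x\<in>vcarrier E. P (V (?\<iota> x)))"
  have Vwc: "weakly_compact_op (bidual E) (bidual F) V"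
    unfolding V_def by (intro gantmacher[OF W] seminormed_dual E F)
  have V: "V \<in> vcarrier (bounded_ops (bidual E) (bidual F))"
    using Vwc by (simp add: weakly_compact_op_def)
  let ?D = "weak_topology (bidual F) closure_of (V ` unit_ball (bidual E))"
  have D: "compactin (weak_topology (bidual F)) ?D"
    using Vwc by (auto simp: weakly_compact_op_def relatively_weakly_compact_def)
  have sub: "V ` unit_ball (bidual E) \<subseteq> ?D"
    using bops_closed[OF V] E''.ball_closed topspace_weak_topology[OF F''.seminormed_space_axioms]
    by (intro closure_of_subset) auto
  have PD: "compactin (weak_topology F) (P ` ?D)"
    using continuous_map_weak_topology[OF P F''.seminormed_space_axioms F] D by (intro image_compactin)
  have em: "?\<iota> x \<in> vcarrier (bidual E)" "vnorm (bidual E) (?\<iota> x) \<le> vnorm E x" if "x \<in> vcarrier E" for x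
    using emb_bidual[OF E that] .
  have W'b: "W' \<in> vcarrier (bounded_ops E F)"
  proof (rule bounded_opsI)
    show "W' \<in> extensional (vcarrier E)" unfolding W'_def by (rule restrict_extensional)
    show "W' x \<in> vcarrier F" if "x \<in> vcarrier E" for x
      using bops_closed[OF P] bops_closed[OF V] em that by (simp add: W'_def)
    show "W' (vadd E x y) = vadd F (W' x) (W' y)" if "x \<in> vcarrier E" "y \<in> vcarrier E" for x y
      using bops_add[OF P] bops_add[OF V] bops_closed[OF V] em that by (simp add: W'_def emb_add)
    show "W' (vscale E c x) = vscale F c (W' x)" if "x \<in> vcarrier E" for x c
      using bops_scale[OF P] bops_scale[OF V] bops_closed[OF V] em that by (simp add: W'_def emb_scale)
    show "vnorm F (W' x) \<le> op_norm (bidual E) (bidual F) V * vnorm E x" if x: "x \<in> vcarrier E" for x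
    proof -
      have "vnorm F (W' x) \<le> vnorm (bidual F) (V (?\<iota> x))"
        using P_norm bops_closed[OF V] em x by (simp add: W'_def)
      also have "\<dots> \<le> op_norm (bidual E) (bidual F) V * vnorm (bidual E) (?\<iota> x)"
        using em x by (intro op_norm_bound[OF V] E''.seminormed_space_axioms F''.seminormed_space_axioms)
      also have "\<dots> \<le> op_norm (bidual E) (bidual F) V * vnorm E x"
        using em x by (intro mult_left_mono op_norm_nonneg[OF V] E''.seminormed_space_axioms F''.seminormed_space_axioms)
      finally show ?thesis .
    qed
  qed
  have W'wc: "weakly_compact_op E F W'"
  proof -
    have "W' ` unit_ball E \<subseteq> P ` ?D"
    proof (rule image_subsetI)
      fix x assume x: "x \<in> unit_ball E"
      then have "?\<iota> x \<in> unit_ball (bidual E)" using em[of x] by (auto simp: unit_ball_def)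
      then show "W' x \<in> P ` ?D" using x sub by (auto simp: W'_def E.ball_closed)
    qed
    then show ?thesis
      using W'b relatively_weakly_compact_subset[OF F sep PD] by (simp add: weakly_compact_op_def)
  qed
  let ?T = "adjoint_op E F T"
  let ?R = "vdiff (bounded_ops (dual F) (dual E)) ?T W"
  have Tb: "?T \<in> vcarrier (bounded_ops (dual F) (dual E))" using adjoint_bops(1)[OF T E F] .
  have Rb: "?R \<in> vcarrier (bounded_ops (dual F) (dual E))" using Tb Wb by simp
  have R'b: "adjoint_op (dual F) (dual E) ?R \<in> vcarrier (bounded_ops (bidual E) (bidual F))"
    and R'n: "op_norm (bidual E) (bidual F) (adjoint_op (dual F) (dual E) ?R) \<le> op_norm (dual F) (dual E) ?R"
    using adjoint_bops[OF Rb seminormed_dual[OF F] seminormed_dual[OF E]] by simp_all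
  have "weak_essential_norm E F T \<le> op_norm E F (vdiff (bounded_ops E F) T W')"
    by (rule weak_essential_norm_le[OF T E F W'wc])
  also have "\<dots> \<le> op_norm (dual F) (dual E) ?R"
  proof (rule op_norm_le[OF E])
    fix x assume x: "x \<in> unit_ball E"
    have xE: "x \<in> vcarrier E" using x by (rule E.ball_closed)
    have ix: "?\<iota> x \<in> unit_ball (bidual E)" using em[OF xE] x by (auto simp: unit_ball_def)
    have "P (adjoint_op (dual F) (dual E) ?R (?\<iota> x))
        = P (vdiff (bidual F) (biadjoint_op E F T (?\<iota> x)) (V (?\<iota> x)))"
      using adjoint_diff[OF Tb Wb seminormed_dual[OF F] seminormed_dual[OF E]] em(1)[OF xE]
      by (simp add: vdiff_def bounded_ops_sel V_def)
    also have "\<dots> = vdiff F (T x) (P (V (?\<iota> x)))"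
      using bops_diff[OF P F''.seminormed_space_axioms] emb_bidual(1)[OF F bops_closed[OF T xE]]
        bops_closed[OF V em(1)[OF xE]] P_emb[OF bops_closed[OF T xE]]
      by (simp add: biadjoint_emb[OF T E F xE])
    also have "\<dots> = vdiff (bounded_ops E F) T W' x"
      using xE by (simp add: vdiff_def bounded_ops_sel W'_def)
    finally have "vnorm F (vdiff (bounded_ops E F) T W' x)
        \<le> vnorm (bidual F) (adjoint_op (dual F) (dual E) ?R (?\<iota> x))"
      using P_norm[OF bops_closed[OF R'b em(1)[OF xE]]] by simp
    also have "\<dots> \<le> op_norm (dual F) (dual E) ?R"
      using op_norm_ball[OF R'b E''.seminormed_space_axioms ix] R'n by linarith
    finally show "vnorm F (vdiff (bounded_ops E F) T W' x) \<le> op_norm (dual F) (dual E) ?R" .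
  qed
  finally show "weak_essential_norm E F T \<le> op_norm (dual F) (dual E) ?R" .
qed

section \<open>Essentially bounded functions\<close>

lemma separating_if_definite:
  assumes E: "seminormed_space E"
    and definite: "\<And>x. x \<in> vcarrier E \<Longrightarrow> vnorm E x = 0 \<Longrightarrow> x = vscale E 0 x"
  shows "separating E"
  unfolding separating_def
proof (intro ballI impI)
  interpret seminormed_space E by fact
  fix x y assume x: "x \<in> vcarrier E" and y: "y \<in> vcarrier E" and eq: "\<forall>f\<in>vcarrier (dual E). f x = f y"
  obtain f where f: "f \<in> unit_ball (dual E)" "f (vdiff E x y) = of_real (vnorm E (vdiff E x y))"
    using norming_functional[OF E diff_closed[OF x y]] by blast
  then have fd: "f \<in> vcarrier (dual E)" by (simp add: unit_ball_def)
  then have "f (vdiff E x y) = 0" using eq dual_diff[OF fd E x y] by simp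
  then have "vnorm E (vdiff E x y) = 0" using f(2) by simp
  then have "vdiff E x y = vzero" using definite[OF diff_closed[OF x y]] x y by (simp add: scale_0)
  then show "x = y" using diff_add_cancel[OF x y] y by simp
qed

definition ae_class :: "'x measure \<Rightarrow> ('x \<Rightarrow> 'k::real_normed_field) \<Rightarrow> ('x \<Rightarrow> 'k) set" where
  "ae_class M f = ae_equal M `` {f}"

lemma ess_boundedI:
  fixes f :: "'x \<Rightarrow> 'k::{real_normed_field,euclidean_space}"
  assumes f: "f \<in> borel_measurable M" and le: "AE x in M. norm (f x) \<le> C"
  shows "f \<in> ess_bounded M"
proof -
  have "esssup M (\<lambda>x. ereal (norm (f x))) \<le> ereal C"
    using f le by (intro esssup_I) auto
  then have "esssup M (\<lambda>x. ereal (norm (f x))) < \<infinity>" by (rule le_less_trans) simp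
  then show ?thesis using f by (simp add: ess_bounded_def ess_norm_def)
qed

lemma ess_bounded_measurable: "f \<in> ess_bounded M \<Longrightarrow> f \<in> borel_measurable M"
  by (simp add: ess_bounded_def)

lemma AE_le_ess_norm:
  fixes f :: "'x \<Rightarrow> 'k::{real_normed_field,euclidean_space}"
  assumes f: "f \<in> ess_bounded M"
  shows "AE x in M. norm (f x) \<le> real_of_ereal (ess_norm M f)"
proof -
  have ae: "AE x in M. ereal (norm (f x)) \<le> ess_norm M f"
    unfolding ess_norm_def by (rule esssup_AE)
  have fin: "ess_norm M f < \<infinity>" using f by (simp add: ess_bounded_def)
  show ?thesis
  proof (cases "ess_norm M f")
    case (real r) then show ?thesis using ae by simp
  next
    case PInf then show ?thesis using fin by simp
  next
    case MInf then show ?thesis using ae by (auto elim: eventually_mono)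
  qed
qed

lemma ess_norm_nonneg:
  fixes f :: "'x \<Rightarrow> 'k::{real_normed_field,euclidean_space}"
  assumes f: "f \<in> ess_bounded M"
  shows "0 \<le> real_of_ereal (ess_norm M f)"
proof (rule ccontr)
  assume neg: "\<not> ?thesis"
  then obtain r where r: "ess_norm M f = ereal r" "r < 0" by (cases "ess_norm M f") auto
  have "AE x in M. ereal (norm (f x)) \<le> ereal (r - 1)"
    using AE_le_ess_norm[OF f]
  proof eventually_elim
    case (elim x) then show ?case using r norm_ge_zero[of "f x"] by simp
  qed
  then have "ess_norm M f \<le> ereal (r - 1)" unfolding ess_norm_def
    using f by (intro esssup_I) (auto simp: ess_bounded_def)
  then show False using r by simp
qed

lemma ess_norm_le:
  fixes f :: "'x \<Rightarrow> 'k::{real_normed_field,euclidean_space}"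
  assumes f: "f \<in> borel_measurable M" and le: "AE x in M. norm (f x) \<le> C" and C: "0 \<le> C"
  shows "real_of_ereal (ess_norm M f) \<le> C"
proof -
  have "ess_norm M f \<le> ereal C" unfolding ess_norm_def using f le by (intro esssup_I) auto
  then show ?thesis using C by (cases "ess_norm M f") auto
qed

lemma ess_norm_cong_AE:
  fixes f g :: "'x \<Rightarrow> 'k::{real_normed_field,euclidean_space}"
  assumes "f \<in> borel_measurable M" "g \<in> borel_measurable M" "AE x in M. f x = g x"
  shows "ess_norm M f = ess_norm M g"
  unfolding ess_norm_def using assms by (intro esssup_AE_cong) auto

lemma ae_class_iff: "g \<in> ae_class M f \<longleftrightarrow> f \<in> ess_bounded M \<and> g \<in> ess_bounded M \<and> (AE x in M. f x = g x)"
  by (auto simp: ae_class_def ae_equal_def)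

lemma ae_class_eq_iff:
  assumes "f \<in> ess_bounded M" "g \<in> ess_bounded M"
  shows "ae_class M f = ae_class M g \<longleftrightarrow> (AE x in M. f x = g x)"
proof
  assume "ae_class M f = ae_class M g"
  moreover have "f \<in> ae_class M f" using assms by (simp add: ae_class_iff)
  ultimately have "f \<in> ae_class M g" by simp
  then show "AE x in M. f x = g x" by (auto simp: ae_class_iff elim: eventually_mono)
next
  assume *: "AE x in M. f x = g x"
  show "ae_class M f = ae_class M g"
  proof (intro set_eqI iffI)
    fix h assume "h \<in> ae_class M f"
    then have h: "h \<in> ess_bounded M" "AE x in M. f x = h x" by (auto simp: ae_class_iff)
    have "AE x in M. g x = h x" using h(2) * by eventually_elim simp
    then show "h \<in> ae_class M g" using h assms by (simp add: ae_class_iff)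
  next
    fix h assume "h \<in> ae_class M g"
    then have h: "h \<in> ess_bounded M" "AE x in M. g x = h x" by (auto simp: ae_class_iff)
    have "AE x in M. f x = h x" using h(2) * by eventually_elim simp
    then show "h \<in> ae_class M f" using h assms by (simp add: ae_class_iff)
  qed
qed

lemma L_infty_carrier: "vcarrier (L_infty M) = ae_class M ` ess_bounded M"
  by (auto simp: L_infty_def quotient_def ae_class_def)

lemma ae_class_closed: "f \<in> ess_bounded M \<Longrightarrow> ae_class M f \<in> vcarrier (L_infty M)"
  by (simp add: L_infty_carrier)

lemma ess_bounded_add:
  fixes f g :: "'x \<Rightarrow> 'k::{real_normed_field,euclidean_space}"
  assumes f: "f \<in> ess_bounded M" and g: "g \<in> ess_bounded M"
  shows "(\<lambda>x. f x + g x) \<in> ess_bounded M"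
proof (rule ess_boundedI)
  show "(\<lambda>x. f x + g x) \<in> borel_measurable M"
    using f g by (intro borel_measurable_add ess_bounded_measurable)
  show "AE x in M. norm (f x + g x) \<le> real_of_ereal (ess_norm M f) + real_of_ereal (ess_norm M g)"
    using AE_le_ess_norm[OF f] AE_le_ess_norm[OF g]
    by eventually_elim (rule norm_triangle_mono)
qed

lemma ess_bounded_cmult:
  fixes f :: "'x \<Rightarrow> 'k::{real_normed_field,euclidean_space}"
  assumes f: "f \<in> ess_bounded M"
  shows "(\<lambda>x. c * f x) \<in> ess_bounded M"
proof (rule ess_boundedI)
  show "(\<lambda>x. c * f x) \<in> borel_measurable M"
    using ess_bounded_measurable[OF f] by measurable
  show "AE x in M. norm (c * f x) \<le> norm c * real_of_ereal (ess_norm M f)"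
    using AE_le_ess_norm[OF f] by eventually_elim (simp add: norm_mult mult_left_mono)
qed

lemma UN_const_on: "\<lbrakk>A \<noteq> {}; \<And>a. a \<in> A \<Longrightarrow> F a = C\<rbrakk> \<Longrightarrow> (\<Union>a\<in>A. F a) = C"
  by (metis SUP_cong SUP_const)

lemma L_infty_add:
  fixes f g :: "'x \<Rightarrow> 'k::{real_normed_field,euclidean_space}"
  assumes f: "f \<in> ess_bounded M" and g: "g \<in> ess_bounded M"
  shows "vadd (L_infty M) (ae_class M f) (ae_class M g) = ae_class M (\<lambda>x. f x + g x)"
proof -
  have "ae_class M (\<lambda>x. f' x + g' x) = ae_class M (\<lambda>x. f x + g x)"
    if f': "f' \<in> ae_class M f" and g': "g' \<in> ae_class M g" for f' g'
  proof -
    have ae: "AE x in M. f x = f' x" "AE x in M. g x = g' x" and eb: "f' \<in> ess_bounded M" "g' \<in> ess_bounded M"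
      using f' g' by (auto simp: ae_class_iff)
    have "AE x in M. f' x + g' x = f x + g x" using ae by eventually_elim simp
    then show ?thesis
      using ae_class_eq_iff[OF ess_bounded_add[OF eb] ess_bounded_add[OF f g]] by blast
  qed
  then have inner: "(\<Union>g'\<in>ae_class M g. ae_class M (\<lambda>x. f' x + g' x)) = ae_class M (\<lambda>x. f x + g x)"
    if "f' \<in> ae_class M f" for f'
    using that ae_class_iff[of g M g] g by (intro UN_const_on) auto
  have "(\<Union>f'\<in>ae_class M f. \<Union>g'\<in>ae_class M g. ae_class M (\<lambda>x. f' x + g' x))
      = ae_class M (\<lambda>x. f x + g x)"
    using ae_class_iff[of f M f] f by (intro UN_const_on inner) auto
  then show ?thesis by (simp add: L_infty_def ae_class_def)
qed

lemma L_infty_scale: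
  fixes f :: "'x \<Rightarrow> 'k::{real_normed_field,euclidean_space}"
  assumes f: "f \<in> ess_bounded M"
  shows "vscale (L_infty M) c (ae_class M f) = ae_class M (\<lambda>x. c * f x)"
proof -
  have "ae_class M (\<lambda>x. c * f' x) = ae_class M (\<lambda>x. c * f x)" if f': "f' \<in> ae_class M f" for f'
  proof -
    have ae: "AE x in M. f x = f' x" and eb: "f' \<in> ess_bounded M"
      using f' by (auto simp: ae_class_iff)
    have "AE x in M. c * f' x = c * f x" using ae by eventually_elim simp
    then show ?thesis
      using ae_class_eq_iff[OF ess_bounded_cmult[OF eb] ess_bounded_cmult[OF f]] by blast
  qed
  then have "(\<Union>f'\<in>ae_class M f. ae_class M (\<lambda>x. c * f' x)) = ae_class M (\<lambda>x. c * f x)"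
    using f ae_class_iff by (intro UN_const_on) blast+
  then show ?thesis by (simp add: L_infty_def ae_class_def)
qed

lemma L_infty_norm:
  fixes f :: "'x \<Rightarrow> 'k::{real_normed_field,euclidean_space}"
  assumes f: "f \<in> ess_bounded M"
  shows "vnorm (L_infty M) (ae_class M f) = real_of_ereal (ess_norm M f)"
proof -
  have "ess_norm M g = ess_norm M f" if "g \<in> ae_class M f" for g
    using that ess_norm_cong_AE[of f M g] by (auto simp: ae_class_iff ess_bounded_measurable)
  then have "(\<Union>g\<in>ae_class M f. {ess_norm M g}) = {ess_norm M f}"
    using f ae_class_iff by (intro UN_const_on) blast+
  then have "ess_norm M ` ae_class M f = {ess_norm M f}" by (simp add: UNION_singleton_eq_range)
  then show ?thesis by (simp add: L_infty_def)
qed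

lemma L_infty_norm_le:
  fixes f :: "'x \<Rightarrow> 'k::{real_normed_field,euclidean_space}"
  assumes "f \<in> borel_measurable M" "AE x in M. norm (f x) \<le> C" "0 \<le> C"
  shows "vnorm (L_infty M) (ae_class M f) \<le> C"
  using L_infty_norm[OF ess_boundedI[OF assms(1,2)]] ess_norm_le[OF assms] by simp

lemma AE_le_L_infty_norm:
  fixes f :: "'x \<Rightarrow> 'k::{real_normed_field,euclidean_space}"
  assumes "f \<in> ess_bounded M"
  shows "AE x in M. norm (f x) \<le> vnorm (L_infty M) (ae_class M f)"
  using AE_le_ess_norm[OF assms] by (simp add: L_infty_norm[OF assms])

lemma seminormed_L_infty:
  "seminormed_space (L_infty M :: ('k::{real_normed_field,euclidean_space}, ('x \<Rightarrow> 'k) set) nspace)"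
proof -
  let ?L = "L_infty M :: ('k, ('x \<Rightarrow> 'k) set) nspace"
  note [simp] = L_infty_add L_infty_scale ess_bounded_add ess_bounded_cmult
  have zero: "(\<lambda>x. 0::'k) \<in> ess_bounded M" by (rule ess_boundedI[where C = 0]) auto
  show ?thesis
  proof
    show "vcarrier ?L \<noteq> {}" using ae_class_closed[OF zero] by blast
  next
    fix x y assume "x \<in> vcarrier ?L" "y \<in> vcarrier ?L"
    then obtain f g where f: "f \<in> ess_bounded M" "x = ae_class M f" and g: "g \<in> ess_bounded M" "y = ae_class M g"
      by (auto simp: L_infty_carrier)
    show "vadd ?L x y \<in> vcarrier ?L" using f g by (simp add: ae_class_closed)
    show "vadd ?L x y = vadd ?L y x" using f g by (simp add: add.commute)
    show "vadd ?L x (vscale ?L 0 y) = x" using f g by (simp add: zero)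
    show "vscale ?L c (vadd ?L x y) = vadd ?L (vscale ?L c x) (vscale ?L c y)" for c
      using f g by (simp add: distrib_left)
    show "vnorm ?L (vadd ?L x y) \<le> vnorm ?L x + vnorm ?L y"
    proof -
      have "vnorm ?L (ae_class M (\<lambda>t. f t + g t)) \<le> vnorm ?L (ae_class M f) + vnorm ?L (ae_class M g)"
      proof (rule L_infty_norm_le)
        show "(\<lambda>t. f t + g t) \<in> borel_measurable M"
          using f g by (intro ess_bounded_measurable ess_bounded_add)
        show "AE t in M. norm (f t + g t) \<le> vnorm ?L (ae_class M f) + vnorm ?L (ae_class M g)"
          using AE_le_L_infty_norm[OF f(1)] AE_le_L_infty_norm[OF g(1)]
          by eventually_elim (rule norm_triangle_mono)
      qed (use f g in \<open>simp add: L_infty_norm ess_norm_nonneg\<close>)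
      then show ?thesis using f g by simp
    qed
  next
    fix x y z assume "x \<in> vcarrier ?L" "y \<in> vcarrier ?L" "z \<in> vcarrier ?L"
    then obtain f g h where "f \<in> ess_bounded M" "x = ae_class M f" "g \<in> ess_bounded M" "y = ae_class M g"
      "h \<in> ess_bounded M" "z = ae_class M h"
      by (auto simp: L_infty_carrier)
    then show "vadd ?L (vadd ?L x y) z = vadd ?L x (vadd ?L y z)" by (simp add: add.assoc)
  next
    fix x and c d :: 'k assume "x \<in> vcarrier ?L"
    then obtain f where f: "f \<in> ess_bounded M" "x = ae_class M f" by (auto simp: L_infty_carrier)
    show "vscale ?L c x \<in> vcarrier ?L" using f by (simp add: ae_class_closed)
    show "vscale ?L 1 x = x" using f by simp
    show "vscale ?L c (vscale ?L d x) = vscale ?L (c * d) x" using f by (simp add: mult.assoc)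
    show "vscale ?L (c + d) x = vadd ?L (vscale ?L c x) (vscale ?L d x)" using f by (simp add: distrib_right)
    have le: "vnorm ?L (ae_class M (\<lambda>t. c * f t)) \<le> norm c * vnorm ?L (ae_class M f)"
      if f: "f \<in> ess_bounded M" for c f
    proof (rule L_infty_norm_le)
      show "(\<lambda>t. c * f t) \<in> borel_measurable M"
        using f by (intro ess_bounded_measurable ess_bounded_cmult)
      show "AE t in M. norm (c * f t) \<le> norm c * vnorm ?L (ae_class M f)"
        using AE_le_L_infty_norm[OF f] by eventually_elim (simp add: norm_mult mult_left_mono)
    qed (use f in \<open>simp add: L_infty_norm ess_norm_nonneg\<close>)
    show "vnorm ?L (vscale ?L c x) = norm c * vnorm ?L x"
    proof (cases "c = 0")
      case True
      moreover have "real_of_ereal (ess_norm M (\<lambda>t. 0::'k)) = 0"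
        by (intro antisym ess_norm_le ess_norm_nonneg zero) auto
      ultimately show ?thesis using f
        by (simp add: L_infty_norm[OF zero])
    next
      case False
      have "vnorm ?L (ae_class M f) \<le> norm (inverse c) * vnorm ?L (ae_class M (\<lambda>t. c * f t))"
        using le[OF ess_bounded_cmult[OF f(1), of c], of "inverse c"] False
        by (simp add: mult.assoc[symmetric])
      then show ?thesis using le[OF f(1), of c] False f
        by (simp add: norm_inverse norm_divide field_simps)
    qed
  qed
qed

lemma separating_L_infty:
  "separating (L_infty M :: ('k::{real_normed_field,euclidean_space}, ('x \<Rightarrow> 'k) set) nspace)"
proof (rule separating_if_definite[OF seminormed_L_infty])
  fix x assume "x \<in> vcarrier (L_infty M :: ('k, ('x \<Rightarrow> 'k) set) nspace)"
    and n: "vnorm (L_infty M :: ('k, ('x \<Rightarrow> 'k) set) nspace) x = 0"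
  then obtain f where f: "f \<in> ess_bounded M" "x = ae_class M f" by (auto simp: L_infty_carrier)
  have "AE t in M. f t = 0 * f t"
    using AE_le_L_infty_norm[OF f(1)] n f(2) by simp
  then show "x = vscale (L_infty M) 0 x"
    using f ae_class_eq_iff[OF f(1) ess_bounded_cmult[OF f(1), of 0]] L_infty_scale[OF f(1), of 0] by simp
qed

text \<open>
  Classes are handled through representatives that are bounded everywhere: sums, products and
  truncations of such functions can be formed pointwise without null sets.
\<close>

definition bounded_measurable :: "'x measure \<Rightarrow> ('x \<Rightarrow> 'v::real_normed_vector) set" where
  "bounded_measurable M = {f \<in> borel_measurable M. \<exists>C. \<forall>x. norm (f x) \<le> C}"

lemma bounded_measurableI: "\<lbrakk>f \<in> borel_measurable M; \<And>x. norm (f x) \<le> C\<rbrakk> \<Longrightarrow> f \<in> bounded_measurable M"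
  by (auto simp: bounded_measurable_def)

lemma bounded_measurableD: "f \<in> bounded_measurable M \<Longrightarrow> f \<in> borel_measurable M"
  by (simp add: bounded_measurable_def)

lemma bounded_measurable_ess_bounded:
  fixes f :: "'x \<Rightarrow> 'k::{real_normed_field,euclidean_space}"
  shows "f \<in> bounded_measurable M \<Longrightarrow> f \<in> ess_bounded M"
  by (auto simp: bounded_measurable_def intro: ess_boundedI)

lemma L_infty_representative:
  fixes x :: "('x \<Rightarrow> 'k::{real_normed_field,euclidean_space}) set"
  assumes x: "x \<in> vcarrier (L_infty M)"
  obtains f where "f \<in> bounded_measurable M" "\<And>t. norm (f t) \<le> vnorm (L_infty M) x" "x = ae_class M f"
proof -
  obtain g where g: "g \<in> ess_bounded M" "x = ae_class M g" using x by (auto simp: L_infty_carrier)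
  let ?n = "vnorm (L_infty M) x"
  define f where "f = (\<lambda>t. if norm (g t) \<le> ?n then g t else 0)"
  have [measurable]: "g \<in> borel_measurable M" using g by (simp add: ess_bounded_measurable)
  have f: "f \<in> bounded_measurable M" "\<And>t. norm (f t) \<le> ?n"
  proof -
    show n: "norm (f t) \<le> ?n" for t
      using g by (auto simp: f_def L_infty_norm ess_norm_nonneg)
    have "f \<in> borel_measurable M" unfolding f_def by measurable
    then show "f \<in> bounded_measurable M" using n by (rule bounded_measurableI)
  qed
  have "AE t in M. g t = f t"
    using AE_le_L_infty_norm[OF g(1)] unfolding g(2)[symmetric] by eventually_elim (simp add: f_def)
  then have "x = ae_class M f"
    using g ae_class_eq_iff[OF g(1) bounded_measurable_ess_bounded[OF f(1)]] by simp
  then show ?thesis using that f by blast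
qed

section \<open>Densities of bounded additive set functions\<close>

lemma (in finite_measure) AE_nonneg_if_set_integrals_nonneg:
  fixes h :: "'a \<Rightarrow> real"
  assumes h: "integrable M h" and nonneg: "\<And>A. A \<in> sets M \<Longrightarrow> 0 \<le> (\<integral>t. indicator A t * h t \<partial>M)"
  shows "AE t in M. 0 \<le> h t"
proof -
  have [measurable]: "h \<in> borel_measurable M" using h by simp
  define A where "A = {t \<in> space M. h t < 0}"
  have A[measurable]: "A \<in> sets M" unfolding A_def by measurable
  let ?g = "\<lambda>t. - (indicator A t * h t)"
  have int: "integrable M ?g" using h A by (simp add: integrable_mult_indicator[of A M h, simplified] integrable_real_mult_indicator)
  have g0: "0 \<le> ?g t" if "t \<in> space M" for t by (auto simp: A_def indicator_def)
  have "(\<integral>t. ?g t \<partial>M) \<le> 0" using nonneg[OF A] by simp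
  moreover have "0 \<le> (\<integral>t. ?g t \<partial>M)" using g0 by (intro integral_nonneg_AE) auto
  ultimately have "AE t in M. ?g t = 0"
    using integral_nonneg_eq_0_iff_AE[OF int] g0 by auto
  then show ?thesis
    using AE_space by eventually_elim (auto simp: A_def indicator_def)
qed

text \<open>
  Apply the real case to \<open>C\<bar>u\<bar> - w \<bullet> u\<close> for the countably many \<open>u\<close> of a dense set. Outside one null
  set the inequality \<open>w \<bullet> u \<le> C\<bar>u\<bar>\<close> then holds for all \<open>u\<close>, in particular for \<open>u = w\<close>. In this way
  the bound on the vector-valued density is as sharp as the bound on the set function.
\<close>

lemma (in finite_measure) AE_norm_le_if_set_integrals_le:
  fixes w :: "'a \<Rightarrow> 'v::euclidean_space"
  assumes w: "integrable M w"
    and le: "\<And>A. A \<in> sets M \<Longrightarrow> norm (\<integral>t. indicator A t *\<^sub>R w t \<partial>M) \<le> C * measure M A"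
  shows "AE t in M. norm (w t) \<le> C"
proof -
  obtain D :: "'v set" where D: "countable D" "\<And>U. open U \<Longrightarrow> U \<noteq> {} \<Longrightarrow> \<exists>d\<in>D. d \<in> U"
    using countable_dense_exists by metis
  have "AE t in M. 0 \<le> C * norm u - w t \<bullet> u" for u
  proof (rule AE_nonneg_if_set_integrals_nonneg)
    show "integrable M (\<lambda>t. C * norm u - w t \<bullet> u)" using w by simp
    fix A assume A: "A \<in> sets M"
    have iw: "integrable M (\<lambda>t. indicator A t *\<^sub>R w t)" using w A by (rule integrable_mult_indicator[rotated])
    have "(\<integral>t. indicator A t * (C * norm u - w t \<bullet> u) \<partial>M)
        = (\<integral>t. C * norm u * indicator A t - (indicator A t *\<^sub>R w t) \<bullet> u \<partial>M)"
      by (intro Bochner_Integration.integral_cong) (auto simp: algebra_simps)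
    also have "\<dots> = (\<integral>t. C * norm u * indicator A t \<partial>M) - (\<integral>t. (indicator A t *\<^sub>R w t) \<bullet> u \<partial>M)"
      using A by (intro Bochner_Integration.integral_diff integrable_mult_right integrable_inner_left iw)
        (simp add: emeasure_finite less_top[symmetric])
    also have "(\<integral>t. (indicator A t *\<^sub>R w t) \<bullet> u \<partial>M) = (\<integral>t. indicator A t *\<^sub>R w t \<partial>M) \<bullet> u"
      by (rule integral_inner_left[OF iw])
    also have "(\<integral>t. C * norm u * indicator A t \<partial>M) = C * norm u * measure M A"
      using A by (simp add: sets.Int_space_eq2)
    finally have eq: "(\<integral>t. indicator A t * (C * norm u - w t \<bullet> u) \<partial>M)
        = C * norm u * measure M A - (\<integral>t. indicator A t *\<^sub>R w t \<partial>M) \<bullet> u" .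
    have "(\<integral>t. indicator A t *\<^sub>R w t \<partial>M) \<bullet> u \<le> norm (\<integral>t. indicator A t *\<^sub>R w t \<partial>M) * norm u"
      by (rule norm_cauchy_schwarz)
    also have "\<dots> \<le> C * measure M A * norm u" using le[OF A] by (intro mult_right_mono) auto
    finally show "0 \<le> (\<integral>t. indicator A t * (C * norm u - w t \<bullet> u) \<partial>M)" unfolding eq by (simp add: mult_ac)
  qed
  then have "AE t in M. \<forall>u\<in>D. 0 \<le> C * norm u - w t \<bullet> u" using D(1) by (simp add: AE_ball_countable)
  then show ?thesis
  proof eventually_elim
    case (elim t)
    have "\<not> C * norm (w t) < w t \<bullet> w t"
    proof
      assume "C * norm (w t) < w t \<bullet> w t"
      then have "{u. C * norm u < w t \<bullet> u} \<noteq> {}" by blast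
      moreover have "open {u. C * norm u < w t \<bullet> u}" by (intro open_Collect_less continuous_intros)
      ultimately obtain d where "d \<in> D" "C * norm d < w t \<bullet> d" using D(2) by blast
      then show False using elim by fastforce
    qed
    then have sq: "norm (w t) * norm (w t) \<le> C * norm (w t)" by (simp add: dot_square_norm power2_eq_square not_less)
    show ?case
    proof (cases "w t = 0")
      case False then show ?thesis using sq by simp
    next
      \<comment> \<open>a nonzero direction shows that C is nonnegative\<close>
      case True
      obtain d where d: "d \<in> D" "d \<noteq> 0"
      proof -
        have "open (- {0::'v})" by (simp add: open_Compl)
        moreover have "- {0::'v} \<noteq> {}" using nonzero_Basis SOME_Basis by blast
        ultimately obtain d where "d \<in> D" "d \<in> - {0}" using D(2) by blast
        then show thesis using that by blast
      qed
      then have "0 \<le> C * norm d" using elim True by force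
      then have "0 \<le> C" using d by (simp add: zero_le_mult_iff)
      then show ?thesis using True by simp
    qed
  qed
qed

text \<open>
  Domination by a finite measure turns finite additivity into countable additivity, and
  Radon--Nikodym applies.
\<close>

lemma (in finite_measure) nonneg_additive_density:
  fixes \<nu> :: "'a set \<Rightarrow> real"
  assumes add: "\<And>A B. A \<in> sets M \<Longrightarrow> B \<in> sets M \<Longrightarrow> A \<inter> B = {} \<Longrightarrow> \<nu> (A \<union> B) = \<nu> A + \<nu> B"
    and nonneg: "\<And>A. A \<in> sets M \<Longrightarrow> 0 \<le> \<nu> A"
    and le: "\<And>A. A \<in> sets M \<Longrightarrow> \<nu> A \<le> C * measure M A"
  obtains h where "integrable M h" "\<And>A. A \<in> sets M \<Longrightarrow> \<nu> A = (\<integral>t. indicator A t * h t \<partial>M)"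
proof -
  have empty: "\<nu> {} = 0" using add[of "{}" "{}"] by simp
  define N where "N = measure_of (space M) (sets M) (\<lambda>A. ennreal (\<nu> A))"
  have sets_N: "sets N = sets M" "space N = space M" by (simp_all add: N_def)
  have em: "emeasure N A = ennreal (\<nu> A)" if A: "A \<in> sets M" for A
  proof (rule emeasure_measure_of[OF N_def])
    show "positive (sets N) (\<lambda>A. ennreal (\<nu> A))" by (simp add: positive_def empty)
    show "countably_additive (sets N) (\<lambda>A. ennreal (\<nu> A))"
      unfolding sets_N
    proof (rule sets.empty_continuous_imp_countably_additive)
      show "positive (sets M) (\<lambda>A. ennreal (\<nu> A))" by (simp add: positive_def empty)
      show "additive (sets M) (\<lambda>A. ennreal (\<nu> A))"
        unfolding additive_def using add nonneg by (simp add: ennreal_plus)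
      fix A :: "nat \<Rightarrow> 'a set" assume A: "range A \<subseteq> sets M" "decseq A" "(\<Inter>i. A i) = {}"
      have "(\<lambda>i. measure M (A i)) \<longlonglongrightarrow> measure M (\<Inter>i. A i)"
        using A by (intro finite_Lim_measure_decseq)
      then have "(\<lambda>i. C * measure M (A i)) \<longlonglongrightarrow> C * 0" using A by (intro tendsto_mult_left) simp
      then have lim0: "(\<lambda>i. C * measure M (A i)) \<longlonglongrightarrow> 0" by simp
      have Ai: "A i \<in> sets M" for i using A(1) by blast
      have "(\<lambda>i. \<nu> (A i)) \<longlonglongrightarrow> 0"
        by (rule tendsto_sandwich[OF _ _ tendsto_const lim0])
           (simp_all add: nonneg[OF Ai] le[OF Ai])
      then show "(\<lambda>i. ennreal (\<nu> (A i))) \<longlonglongrightarrow> 0"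
        using tendsto_ennrealI by fastforce
    qed auto
  qed (use A sets_N sets.sets_into_space in \<open>fastforce+\<close>)
  have finN: "finite_measure N"
    by (rule finite_measureI) (simp add: sets_N em)
  have ac: "absolutely_continuous M N"
    unfolding absolutely_continuous_def
  proof
    fix A assume A: "A \<in> null_sets M"
    then have "\<nu> A = 0" using le[of A] nonneg[of A] by (auto simp: null_sets_def measure_def)
    then show "A \<in> null_sets N" using A by (auto simp: null_sets_def sets_N em)
  qed
  obtain h where h: "h \<in> borel_measurable M" "AE x in M. RN_deriv M N x = ennreal (h x)" "\<And>x. 0 \<le> h x"
    using real_RN_deriv[OF finN ac sets_N(1)] by blast
  have nn: "ennreal (\<nu> A) = (\<integral>\<^sup>+t. ennreal (indicator A t * h t) \<partial>M)" if A: "A \<in> sets M" for A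
  proof -
    have "ennreal (\<nu> A) = emeasure (density M (RN_deriv M N)) A"
      using em[OF A] density_RN_deriv[OF ac sets_N(1)] by simp
    also have "\<dots> = (\<integral>\<^sup>+t. RN_deriv M N t * indicator A t \<partial>M)" using A by (simp add: emeasure_density)
    also have "\<dots> = (\<integral>\<^sup>+t. ennreal (indicator A t * h t) \<partial>M)"
      using h(2) by (intro nn_integral_cong_AE) (auto simp: indicator_def elim: eventually_mono)
    finally show ?thesis .
  qed
  have meas: "(\<lambda>t. indicator A t * h t) \<in> borel_measurable M" if "A \<in> sets M" for A
    using h(1) that by measurable
  have intA: "integrable M (\<lambda>t. indicator A t * h t)" if A: "A \<in> sets M" for A
    using meas[OF A] h(3) nn[OF A, symmetric] by (intro integrableI_nonneg) auto
  have "integrable M h"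
    using intA[OF sets.top] by (rule Bochner_Integration.integrable_cong[THEN iffD1, rotated 2]) auto
  moreover have "\<nu> A = (\<integral>t. indicator A t * h t \<partial>M)" if A: "A \<in> sets M" for A
    using integral_eq_nn_integral[of "\<lambda>t. indicator A t * h t" M] meas[OF A] h(3) nn[OF A, symmetric] nonneg[OF A]
    by simp
  ultimately show ?thesis using that by blast
qed

text \<open>
  Radon--Nikodym for each coordinate; adding \<open>C\<close> times the measure makes the coordinates
  nonnegative.
\<close>

lemma (in finite_measure) bounded_additive_density:
  fixes \<nu> :: "'a set \<Rightarrow> 'v::euclidean_space"
  assumes add: "\<And>A B. A \<in> sets M \<Longrightarrow> B \<in> sets M \<Longrightarrow> A \<inter> B = {} \<Longrightarrow> \<nu> (A \<union> B) = \<nu> A + \<nu> B"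
    and le: "\<And>A. A \<in> sets M \<Longrightarrow> norm (\<nu> A) \<le> C * measure M A"
  obtains w where "integrable M w" "AE t in M. norm (w t) \<le> C"
    "\<And>A. A \<in> sets M \<Longrightarrow> \<nu> A = (\<integral>t. indicator A t *\<^sub>R w t \<partial>M)"
proof -
  have "\<exists>h. integrable M h \<and> (\<forall>A\<in>sets M. \<nu> A \<bullet> b + C * measure M A = (\<integral>t. indicator A t * h t \<partial>M))"
    if b: "b \<in> Basis" for b
  proof -
    have b_le: "\<bar>\<nu> A \<bullet> b\<bar> \<le> C * measure M A" if "A \<in> sets M" for A
      using Basis_le_norm[OF b, of "\<nu> A"] le[OF that] by linarith
    show ?thesis
    proof (rule nonneg_additive_density[of "\<lambda>A. \<nu> A \<bullet> b + C * measure M A" "2 * C"])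
      show "\<nu> (A \<union> B) \<bullet> b + C * measure M (A \<union> B) = \<nu> A \<bullet> b + C * measure M A + (\<nu> B \<bullet> b + C * measure M B)"
        if "A \<in> sets M" "B \<in> sets M" "A \<inter> B = {}" for A B
        using add[OF that] finite_measure_Union[OF that] by (simp add: inner_add_left algebra_simps)
      show "0 \<le> \<nu> A \<bullet> b + C * measure M A" "\<nu> A \<bullet> b + C * measure M A \<le> 2 * C * measure M A" if "A \<in> sets M" for A
        using b_le[OF that] by linarith+
    qed blast
  qed
  then obtain h where h: "\<And>b. b \<in> Basis \<Longrightarrow> integrable M (h b)"
    "\<And>b A. b \<in> Basis \<Longrightarrow> A \<in> sets M \<Longrightarrow> \<nu> A \<bullet> b + C * measure M A = (\<integral>t. indicator A t * h b t \<partial>M)"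
    by metis
  define w where "w = (\<lambda>t. \<Sum>b\<in>Basis. (h b t - C) *\<^sub>R b)"
  have w: "integrable M w" unfolding w_def using h(1)
    by (intro Bochner_Integration.integrable_sum integrable_scaleR_left Bochner_Integration.integrable_diff) auto
  have \<nu>: "\<nu> A = (\<integral>t. indicator A t *\<^sub>R w t \<partial>M)" if A: "A \<in> sets M" for A
  proof (rule euclidean_eqI)
    fix b :: 'v assume b: "b \<in> Basis"
    have iw: "integrable M (\<lambda>t. indicator A t *\<^sub>R w t)" using w A by (rule integrable_mult_indicator[rotated])
    have wb: "w t \<bullet> b = h b t - C" for t using b by (simp add: w_def inner_sum_left_Basis)
    have ih: "integrable M (\<lambda>t. indicator A t * h b t)"
      using integrable_mult_indicator[OF A h(1)[OF b]] by simp
    have "(\<integral>t. indicator A t *\<^sub>R w t \<partial>M) \<bullet> b = (\<integral>t. (indicator A t *\<^sub>R w t) \<bullet> b \<partial>M)"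
      by (rule integral_inner_left[OF iw, symmetric])
    also have "\<dots> = (\<integral>t. indicator A t * h b t - C * indicator A t \<partial>M)"
      by (simp add: wb algebra_simps)
    also have "\<dots> = (\<integral>t. indicator A t * h b t \<partial>M) - C * measure M A"
      using ih A by (subst Bochner_Integration.integral_diff)
        (auto simp: emeasure_finite less_top[symmetric] sets.Int_space_eq2)
    also have "\<dots> = \<nu> A \<bullet> b" using h(2)[OF b A] by simp
    finally show "\<nu> A \<bullet> b = (\<integral>t. indicator A t *\<^sub>R w t \<partial>M) \<bullet> b" by simp
  qed
  have "AE t in M. norm (w t) \<le> C"
    using le \<nu> by (intro AE_norm_le_if_set_integrals_le[OF w]) simp
  then show ?thesis using that w \<nu> by blast
qed

section \<open>Injectivity of the space of essentially bounded functions\<close>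

text \<open>
  Simple functions with values in \<open>X\<close>, with the seminorm of the Bochner space \<open>L\<^sub>1(M; X)\<close>.
\<close>

definition simple_space ::
  "'x measure \<Rightarrow> ('k::{real_normed_field,euclidean_space}, 'a) nspace \<Rightarrow> ('k, 'x \<Rightarrow> 'a) nspace" where
  "simple_space M X =
    \<lparr>vcarrier = {s. simple_function M s \<and> (\<forall>t. s t \<in> vcarrier X)},
     vadd = (\<lambda>s s' t. vadd X (s t) (s' t)),
     vscale = (\<lambda>c s t. vscale X c (s t)),
     vnorm = (\<lambda>s. \<integral>t. vnorm X (s t) \<partial>M)\<rparr>"

lemma simple_space_sel:
  "s \<in> vcarrier (simple_space M X) \<longleftrightarrow> simple_function M s \<and> (\<forall>t. s t \<in> vcarrier X)"
  "vadd (simple_space M X) s s' = (\<lambda>t. vadd X (s t) (s' t))"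
  "vscale (simple_space M X) c s = (\<lambda>t. vscale X c (s t))"
  "vnorm (simple_space M X) s = (\<integral>t. vnorm X (s t) \<partial>M)"
  by (simp_all add: simple_space_def)

lemma (in finite_measure) integrable_simple_function_compose:
  fixes h :: "'b \<Rightarrow> real"
  assumes s: "simple_function M s"
  shows "integrable M (\<lambda>t. h (s t))"
proof -
  have f: "finite ((\<lambda>t. norm (h (s t))) ` space M)"
    using simple_functionD(1)[OF simple_function_compose1[OF s, of "\<lambda>a. norm (h a)"]] .
  obtain B where B: "\<And>t. t \<in> space M \<Longrightarrow> norm (h (s t)) \<le> B"
    using Max_ge[OF f] by blast
  show ?thesis
    by (rule integrable_const_bound[of _ B])
       (use B s in \<open>auto intro: borel_measurable_simple_function simple_function_compose1\<close>)
qed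

lemma (in finite_measure) seminormed_simple_space:
  assumes X: "seminormed_space X"
  shows "seminormed_space (simple_space M X)"
proof -
  interpret X: seminormed_space X by fact
  have "(\<lambda>_. X.vzero) \<in> vcarrier (simple_space M X)" by (simp add: simple_space_sel)
  then show ?thesis
  proof (unfold_locales, goal_cases)
    case 1 then show ?case by blast
  next
    case (2 x y) then show ?case
      by (auto simp: simple_space_sel intro: simple_function_compose2)
  next
    case (3 x c) then show ?case
      by (auto simp: simple_space_sel intro: simple_function_compose1)
  next
    case (5 x y) then show ?case by (auto simp: simple_space_sel X.add_comm)
  next
    case (12 x y)
    have "(\<integral>t. vnorm X (vadd X (x t) (y t)) \<partial>M) \<le> (\<integral>t. vnorm X (x t) + vnorm X (y t) \<partial>M)"
    proof (rule integral_mono)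
      have "simple_function M (\<lambda>t. vadd X (x t) (y t))"
        using 12 by (auto simp: simple_space_sel intro: simple_function_compose2)
      then show "integrable M (\<lambda>t. vnorm X (vadd X (x t) (y t)))"
        by (rule integrable_simple_function_compose)
    next
      show "integrable M (\<lambda>t. vnorm X (x t) + vnorm X (y t))"
        using 12 by (intro Bochner_Integration.integrable_add integrable_simple_function_compose)
          (simp_all add: simple_space_sel)
    qed (use 12 in \<open>simp add: simple_space_sel X.norm_add_le\<close>)
    then show ?case using 12 by (simp add: simple_space_sel integrable_simple_function_compose)
  qed (auto simp: simple_space_sel X.add_assoc X.add_scale_0 X.scale_scale X.scale_add_right
      X.scale_add_left X.norm_scale)
qed

text \<open>
  Only finitely many of the functions \<open>\<tau> a\<close> occur.
\<close>

lemma measurable_simple_selection: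
  fixes \<tau> :: "'a \<Rightarrow> 'x \<Rightarrow> 'v::topological_space"
  assumes s: "simple_function M s" and \<tau>: "\<And>a. a \<in> s ` space M \<Longrightarrow> \<tau> a \<in> borel_measurable M"
  shows "(\<lambda>t. \<tau> (s t) t) \<in> borel_measurable M"
proof (rule measurable_compose_countable'[of "s ` space M"])
  show "s \<in> measurable M (count_space (s ` space M))"
    using s unfolding simple_function_def by (subst measurable_count_space_eq2) auto
  show "countable (s ` space M)" using s by (intro countable_finite simple_functionD)
qed (rule \<tau>)

text \<open>
  The vector-valued extension is reduced to a scalar one. On simple functions with values in \<open>Y\<close> the
  functional \<open>F s = \<integral> T(s t)(t) dt\<close> is dominated by the \<open>L\<^sub>1\<close> seminorm of \<open>s\<close>, and Hahn--Banach extends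
  it to a functional \<open>G\<close> on all simple functions with values in \<open>X\<close>. For each \<open>x\<close> the set function
  \<open>A \<mapsto> G(1\<^sub>A x)\<close> is additive and at most \<open>\<parallel>x\<parallel>\<close> times the measure, so it has a density bounded by
  \<open>\<parallel>x\<parallel>\<close>. The class of this density is \<open>W x\<close>; uniqueness of densities gives linearity and \<open>W = T\<close>
  on \<open>Y\<close>.
\<close>

theorem (in finite_measure) L_infty_injective:
  fixes X :: "('k::{real_normed_field,euclidean_space}, 'b) nspace"
    and T :: "'b \<Rightarrow> ('a \<Rightarrow> 'k) set"
  assumes X: "seminormed_space X" and Y: "Y \<subseteq> vcarrier X" "Y \<noteq> {}"
    and Y_add: "\<And>x y. x \<in> Y \<Longrightarrow> y \<in> Y \<Longrightarrow> vadd X x y \<in> Y"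
    and Y_scale: "\<And>c x. x \<in> Y \<Longrightarrow> vscale X c x \<in> Y"
    and T_closed: "\<And>x. x \<in> Y \<Longrightarrow> T x \<in> vcarrier (L_infty M)"
    and T_add: "\<And>x y. x \<in> Y \<Longrightarrow> y \<in> Y \<Longrightarrow> T (vadd X x y) = vadd (L_infty M) (T x) (T y)"
    and T_scale: "\<And>c x. x \<in> Y \<Longrightarrow> T (vscale X c x) = vscale (L_infty M) c (T x)"
    and T_le: "\<And>x. x \<in> Y \<Longrightarrow> vnorm (L_infty M) (T x) \<le> vnorm X x"
  obtains W where "W \<in> vcarrier (bounded_ops X (L_infty M))"
    "\<And>x. x \<in> vcarrier X \<Longrightarrow> vnorm (L_infty M) (W x) \<le> vnorm X x"
    "\<And>y. y \<in> Y \<Longrightarrow> W y = T y"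
proof -
  interpret X: seminormed_space X by fact
  let ?S = "simple_space M X"
  interpret S: seminormed_space ?S using X by (rule seminormed_simple_space)
  have YX: "y \<in> vcarrier X" if "y \<in> Y" for y using that Y by blast
  have zY: "X.vzero \<in> Y" using Y(2) Y_scale[of _ 0] YX X.scale_0 by (metis ex_in_conv)
  \<comment> \<open>representatives are chosen separately for each y, so they are additive and homogeneous almost everywhere only\<close>
  have "\<exists>f. f \<in> bounded_measurable M \<and> (\<forall>t. norm (f t) \<le> vnorm (L_infty M) (T y)) \<and> T y = ae_class M f"
    if "y \<in> Y" for y
    using L_infty_representative[OF T_closed[OF that]] by metis
  then obtain \<tau> where \<tau>: "\<And>y. y \<in> Y \<Longrightarrow> \<tau> y \<in> bounded_measurable M"
    "\<And>y t. y \<in> Y \<Longrightarrow> norm (\<tau> y t) \<le> vnorm (L_infty M) (T y)"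
    "\<And>y. y \<in> Y \<Longrightarrow> T y = ae_class M (\<tau> y)" by metis
  have \<tau>m: "\<tau> y \<in> borel_measurable M" if "y \<in> Y" for y using \<tau>(1)[OF that] by (rule bounded_measurableD)
  have \<tau>e: "\<tau> y \<in> ess_bounded M" if "y \<in> Y" for y using \<tau>(1)[OF that] by (rule bounded_measurable_ess_bounded)
  have \<tau>_le: "norm (\<tau> y t) \<le> vnorm X y" if "y \<in> Y" for y t
    using \<tau>(2)[OF that, of t] T_le[OF that] by linarith
  have \<tau>_add: "AE t in M. \<tau> (vadd X x y) t = \<tau> x t + \<tau> y t" if x: "x \<in> Y" and y: "y \<in> Y" for x y
    using T_add[OF x y] \<tau>(3)[OF Y_add[OF x y]] \<tau>(3)[OF x] \<tau>(3)[OF y]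
      ae_class_eq_iff[OF \<tau>e[OF Y_add[OF x y]] ess_bounded_add[OF \<tau>e[OF x] \<tau>e[OF y]]]
    by (simp add: L_infty_add[OF \<tau>e[OF x] \<tau>e[OF y]])
  have \<tau>_scale: "AE t in M. \<tau> (vscale X c x) t = c * \<tau> x t" if x: "x \<in> Y" for c x
    using T_scale[OF x, of c] \<tau>(3)[OF Y_scale[OF x, of c]] \<tau>(3)[OF x]
      ae_class_eq_iff[OF \<tau>e[OF Y_scale[OF x, of c]] ess_bounded_cmult[OF \<tau>e[OF x], of c]]
    by (simp add: L_infty_scale[OF \<tau>e[OF x]])
  define YS where "YS = {s \<in> vcarrier ?S. \<forall>t. s t \<in> Y}"
  define F where "F = (\<lambda>s. \<integral>t. \<tau> (s t) t \<partial>M)"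
  have YS: "simple_function M s" "\<And>t. s t \<in> Y" if "s \<in> YS" for s
    using that by (auto simp: YS_def simple_space_sel)
  have F_int: "integrable M (\<lambda>t. \<tau> (s t) t)" if s: "s \<in> YS" for s
  proof (rule Bochner_Integration.integrable_bound)
    show "integrable M (\<lambda>t. vnorm X (s t))" using YS(1)[OF s] by (rule integrable_simple_function_compose)
    show "(\<lambda>t. \<tau> (s t) t) \<in> borel_measurable M"
      by (rule measurable_simple_selection[OF YS(1)[OF s]]) (use YS(2)[OF s] \<tau>m in auto)
    show "AE t in M. norm (\<tau> (s t) t) \<le> norm (vnorm X (s t))"
      using \<tau>_le YS(2)[OF s] by (intro AE_I2) (simp add: YX)
  qed
  have YS_add: "vadd ?S s s' \<in> YS" if "s \<in> YS" "s' \<in> YS" for s s'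
    using that Y_add S.add_closed[of s s'] unfolding YS_def simple_space_sel(2) by blast
  have YS_scale: "vscale ?S c s \<in> YS" if "s \<in> YS" for s c
    using that Y_scale S.scale_closed[of s c] unfolding YS_def simple_space_sel(3) by blast
  have "\<exists>G. G \<in> vcarrier (dual ?S) \<and> (\<forall>s\<in>vcarrier ?S. norm (G s) \<le> vnorm ?S s) \<and> (\<forall>s\<in>YS. G s = F s)"
  proof (rule S.hahn_banach[of YS F])
    show "YS \<subseteq> vcarrier ?S" by (auto simp: YS_def)
    have "(\<lambda>_. X.vzero) \<in> YS" using zY by (simp add: YS_def simple_space_sel)
    then show "YS \<noteq> {}" by blast
    fix s s' assume s: "s \<in> YS" and s': "s' \<in> YS"
    have "AE t in M. \<forall>p\<in>s ` space M \<times> s' ` space M. \<tau> (vadd X (fst p) (snd p)) t = \<tau> (fst p) t + \<tau> (snd p) t"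
      using YS[OF s] YS[OF s'] \<tau>_add by (intro AE_finite_allI) (auto dest: simple_functionD)
    then have "AE t in M. \<tau> (vadd X (s t) (s' t)) t = \<tau> (s t) t + \<tau> (s' t) t"
      using AE_space by eventually_elim auto
    then have "F (vadd ?S s s') = (\<integral>t. \<tau> (s t) t + \<tau> (s' t) t \<partial>M)"
      unfolding F_def using F_int[OF YS_add[OF s s']] F_int[OF s] F_int[OF s']
      by (intro integral_cong_AE) (auto simp: simple_space_sel(2))
    also have "\<dots> = F s + F s'" unfolding F_def by (intro Bochner_Integration.integral_add F_int s s')
    finally show "F (vadd ?S s s') = F s + F s'" .
  next
    fix s c assume s: "s \<in> YS"
    have "AE t in M. \<forall>a\<in>s ` space M. \<tau> (vscale X c a) t = c * \<tau> a t"
      using YS[OF s] \<tau>_scale by (intro AE_finite_allI) (auto dest: simple_functionD)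
    then have "AE t in M. \<tau> (vscale X c (s t)) t = c * \<tau> (s t) t"
      using AE_space by eventually_elim auto
    then have "F (vscale ?S c s) = (\<integral>t. c * \<tau> (s t) t \<partial>M)"
      unfolding F_def using F_int[OF YS_scale[OF s]] F_int[OF s]
      by (intro integral_cong_AE) (auto simp: simple_space_sel(3))
    then show "F (vscale ?S c s) = c * F s" by (simp add: F_def)
  next
    fix s assume s: "s \<in> YS"
    have "norm (F s) \<le> (\<integral>t. norm (\<tau> (s t) t) \<partial>M)" unfolding F_def by (rule integral_norm_bound)
    also have "\<dots> \<le> (\<integral>t. vnorm X (s t) \<partial>M)"
      using \<tau>_le YS(2)[OF s] by (intro integral_mono integrable_norm F_int s integrable_simple_function_compose YS(1)) auto
    finally show "norm (F s) \<le> vnorm ?S s" by (simp add: simple_space_sel)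
  qed (use YS_add YS_scale in blast)+
  then obtain G where G: "G \<in> vcarrier (dual ?S)" "\<And>s. s \<in> vcarrier ?S \<Longrightarrow> norm (G s) \<le> vnorm ?S s"
    "\<And>s. s \<in> YS \<Longrightarrow> G s = F s" by blast
  define step where "step = (\<lambda>(A::'a set) x t. if t \<in> A then x else X.vzero)"
  have step: "step A x \<in> vcarrier ?S" if A: "A \<in> sets M" and x: "x \<in> vcarrier X" for A x
  proof -
    have "simple_function M (\<lambda>t. if t \<in> A then x else X.vzero)"
      using A by (intro simple_function_If_set simple_function_const) (simp add: sets.Int_space_eq1)
    then show ?thesis using x by (simp add: step_def simple_space_sel)
  qed
  have step_norm: "vnorm ?S (step A x) = vnorm X x * measure M A" if A: "A \<in> sets M" for A x
  proof -
    have "vnorm ?S (step A x) = (\<integral>t. vnorm X x * indicator A t \<partial>M)"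
      unfolding simple_space_sel by (intro Bochner_Integration.integral_cong) (auto simp: step_def indicator_def)
    then show ?thesis using A by (simp add: sets.Int_space_eq2)
  qed
  have "\<exists>w. integrable M w \<and> (AE t in M. norm (w t) \<le> vnorm X x) \<and>
      (\<forall>A\<in>sets M. G (step A x) = (\<integral>t. indicator A t *\<^sub>R w t \<partial>M))" if x: "x \<in> vcarrier X" for x
  proof (rule bounded_additive_density[of "\<lambda>A. G (step A x)" "vnorm X x"])
    fix A B assume A: "A \<in> sets M" and B: "B \<in> sets M" and "A \<inter> B = {}"
    then have "step (A \<union> B) x = vadd ?S (step A x) (step B x)"
      using x by (auto simp: step_def simple_space_sel fun_eq_iff)
    then show "G (step (A \<union> B) x) = G (step A x) + G (step B x)"
      using dual_add[OF G(1) step[OF A x] step[OF B x]] by simp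
  next
    fix A assume A: "A \<in> sets M"
    show "norm (G (step A x)) \<le> vnorm X x * measure M A"
      using G(2)[OF step[OF A x]] step_norm[OF A] by simp
  qed blast
  then obtain w where w: "\<And>x. x \<in> vcarrier X \<Longrightarrow> integrable M (w x)"
    "\<And>x. x \<in> vcarrier X \<Longrightarrow> AE t in M. norm (w x t) \<le> vnorm X x"
    "\<And>x A. x \<in> vcarrier X \<Longrightarrow> A \<in> sets M \<Longrightarrow> G (step A x) = (\<integral>t. indicator A t *\<^sub>R w x t \<partial>M)"
    by metis
  have we: "w x \<in> ess_bounded M" if "x \<in> vcarrier X" for x
    using w(1,2)[OF that] by (intro ess_boundedI) auto
  have unique: "AE t in M. u t = v t"
    if u: "integrable M u" and v: "integrable M v"
      and eq: "\<And>A. A \<in> sets M \<Longrightarrow> (\<integral>t. indicator A t *\<^sub>R u t \<partial>M) = (\<integral>t. indicator A t *\<^sub>R v t \<partial>M)"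
    for u v :: "'a \<Rightarrow> 'k"
  proof -
    have "AE t in M. norm (u t - v t) \<le> 0"
    proof (rule AE_norm_le_if_set_integrals_le)
      fix A assume A: "A \<in> sets M"
      have "(\<integral>t. indicator A t *\<^sub>R (u t - v t) \<partial>M)
          = (\<integral>t. indicator A t *\<^sub>R u t \<partial>M) - (\<integral>t. indicator A t *\<^sub>R v t \<partial>M)"
        unfolding scaleR_diff_right
        by (intro Bochner_Integration.integral_diff integrable_mult_indicator A u v)
      then show "norm (\<integral>t. indicator A t *\<^sub>R (u t - v t) \<partial>M) \<le> 0 * measure M A" using eq[OF A] by simp
    qed (use u v in simp)
    then show ?thesis by (auto elim: eventually_mono)
  qed
  define W where "W = (\<lambda>x\<in>vcarrier X. ae_class M (w x))"
  have W_le: "vnorm (L_infty M) (W x) \<le> vnorm X x" if x: "x \<in> vcarrier X" for x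
    using L_infty_norm_le[OF ess_bounded_measurable[OF we[OF x]] w(2)[OF x]] x by (simp add: W_def)
  have "W \<in> vcarrier (bounded_ops X (L_infty M))"
  proof (rule bounded_opsI[where C = 1])
    show "W \<in> extensional (vcarrier X)" unfolding W_def by (rule restrict_extensional)
    show "W x \<in> vcarrier (L_infty M)" if "x \<in> vcarrier X" for x
      using we[OF that] that by (simp add: W_def ae_class_closed)
    show "vnorm (L_infty M) (W x) \<le> 1 * vnorm X x" if "x \<in> vcarrier X" for x using W_le[OF that] by simp
    show "W (vadd X x y) = vadd (L_infty M) (W x) (W y)" if x: "x \<in> vcarrier X" and y: "y \<in> vcarrier X" for x y
    proof -
      have xy: "vadd X x y \<in> vcarrier X" using x y by simp
      have "AE t in M. w (vadd X x y) t = w x t + w y t"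
      proof (rule unique)
        fix A assume A: "A \<in> sets M"
        have e: "step A (vadd X x y) = vadd ?S (step A x) (step A y)"
          using x y by (auto simp: step_def simple_space_sel fun_eq_iff)
        have "(\<integral>t. indicator A t *\<^sub>R w (vadd X x y) t \<partial>M) = G (step A x) + G (step A y)"
          using w(3)[OF xy A] dual_add[OF G(1) step[OF A x] step[OF A y]] e by simp
        also have "\<dots> = (\<integral>t. indicator A t *\<^sub>R w x t \<partial>M) + (\<integral>t. indicator A t *\<^sub>R w y t \<partial>M)"
          using w(3)[OF x A] w(3)[OF y A] by simp
        also have "\<dots> = (\<integral>t. indicator A t *\<^sub>R (w x t + w y t) \<partial>M)"
          unfolding scaleR_add_right
          by (intro Bochner_Integration.integral_add[symmetric] integrable_mult_indicator A w(1) x y)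
        finally show "(\<integral>t. indicator A t *\<^sub>R w (vadd X x y) t \<partial>M) = (\<integral>t. indicator A t *\<^sub>R (w x t + w y t) \<partial>M)" .
      qed (use w(1) x y xy in auto)
      then show ?thesis
        using x y xy ae_class_eq_iff[OF we[OF xy] ess_bounded_add[OF we[OF x] we[OF y]]]
        by (simp add: W_def L_infty_add[OF we[OF x] we[OF y]])
    qed
    show "W (vscale X c x) = vscale (L_infty M) c (W x)" if x: "x \<in> vcarrier X" for x c
    proof -
      have cx: "vscale X c x \<in> vcarrier X" using x by simp
      have "AE t in M. w (vscale X c x) t = c * w x t"
      proof (rule unique)
        fix A assume A: "A \<in> sets M"
        have e: "step A (vscale X c x) = vscale ?S c (step A x)"
          using x by (auto simp: step_def simple_space_sel fun_eq_iff)
        have "(\<integral>t. indicator A t *\<^sub>R w (vscale X c x) t \<partial>M) = c * G (step A x)"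
          using w(3)[OF cx A] dual_scale[OF G(1) step[OF A x]] e by simp
        also have "\<dots> = c * (\<integral>t. indicator A t *\<^sub>R w x t \<partial>M)"
          using w(3)[OF x A] by simp
        also have "\<dots> = (\<integral>t. c * (indicator A t *\<^sub>R w x t) \<partial>M)"
          by (rule Bochner_Integration.integral_mult_right[symmetric, OF integrable_mult_indicator[OF A w(1)[OF x]]])
        finally show "(\<integral>t. indicator A t *\<^sub>R w (vscale X c x) t \<partial>M) = (\<integral>t. indicator A t *\<^sub>R (c * w x t) \<partial>M)"
          by simp
      qed (use w(1) x cx in auto)
      then show ?thesis
        using x cx ae_class_eq_iff[OF we[OF cx] ess_bounded_cmult[OF we[OF x], of c]]
        by (simp add: W_def L_infty_scale[OF we[OF x]])
    qed
  qed
  moreover have "W y = T y" if y: "y \<in> Y" for y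
  proof -
    have yX: "y \<in> vcarrier X" using y by (rule YX)
    have \<tau>i: "integrable M (\<tau> y)"
      using \<tau>m[OF y] \<tau>_le[OF y] by (intro integrable_const_bound[of _ "vnorm X y"]) auto
    have "AE t in M. w y t = \<tau> y t"
    proof (rule unique)
      fix A assume A: "A \<in> sets M"
      have "step A y \<in> YS" using step[OF A yX] y zY by (auto simp: YS_def step_def)
      then have "(\<integral>t. indicator A t *\<^sub>R w y t \<partial>M) = F (step A y)"
        using w(3)[OF yX A] G(3) by simp
      also have "\<dots> = (\<integral>t. indicator A t *\<^sub>R \<tau> y t \<partial>M)"
        unfolding F_def using \<tau>_le[OF zY]
        by (intro Bochner_Integration.integral_cong) (auto simp: step_def indicator_def)
      finally show "(\<integral>t. indicator A t *\<^sub>R w y t \<partial>M) = (\<integral>t. indicator A t *\<^sub>R \<tau> y t \<partial>M)" .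
    qed (use w(1)[OF yX] \<tau>i in auto)
    then show ?thesis
      using yX ae_class_eq_iff[OF we[OF yX] \<tau>e[OF y]] \<tau>(3)[OF y] by (simp add: W_def)
  qed
  ultimately show ?thesis using that W_le by blast
qed


text \<open>
  Extend the inverse of the canonical embedding; by the norming functionals it has norm one.
\<close>

lemma (in finite_measure) L_infty_bidual_projection:
  obtains P where
    "P \<in> vcarrier (bounded_ops (bidual (L_infty M)) (L_infty M :: ('k::{real_normed_field,euclidean_space}, ('a \<Rightarrow> 'k) set) nspace))"
    "\<And>z. z \<in> vcarrier (bidual (L_infty M)) \<Longrightarrow> vnorm (L_infty M) (P z) \<le> vnorm (bidual (L_infty M)) z"
    "\<And>y. y \<in> vcarrier (L_infty M) \<Longrightarrow> P (canonical_embedding (L_infty M) y) = y"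
proof -
  let ?L = "L_infty M :: ('k, ('a \<Rightarrow> 'k) set) nspace"
  let ?\<iota> = "canonical_embedding ?L"
  have L: "seminormed_space ?L" by (rule seminormed_L_infty)
  interpret L: seminormed_space ?L by (rule L)
  interpret L': seminormed_space "dual ?L" using L by (rule seminormed_dual)
  interpret L'': seminormed_space "bidual ?L" using L by (intro seminormed_dual)
  have inj: "x = y" if "x \<in> vcarrier ?L" "y \<in> vcarrier ?L" "?\<iota> x = ?\<iota> y" for x y
    using separating_L_infty that emb_apply unfolding separating_def by metis
  define T where "T = (\<lambda>z. SOME y. y \<in> vcarrier ?L \<and> z = ?\<iota> y)"
  have T: "T (?\<iota> y) = y" if "y \<in> vcarrier ?L" for y
    unfolding T_def using that inj by (intro some_equality) auto
  have "\<exists>P. P \<in> vcarrier (bounded_ops (bidual ?L) ?L) \<and>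
      (\<forall>z\<in>vcarrier (bidual ?L). vnorm ?L (P z) \<le> vnorm (bidual ?L) z) \<and> (\<forall>z\<in>embedded ?L. P z = T z)"
  proof (rule L_infty_injective[of "bidual ?L" "embedded ?L" T])
    show "embedded ?L \<subseteq> vcarrier (bidual ?L)" using emb_bidual(1)[OF L] by blast
    show "embedded ?L \<noteq> {}" using L.nonempty by simp
    show "T x \<in> vcarrier ?L" if "x \<in> embedded ?L" for x using that T by auto
    fix x c assume "x \<in> embedded ?L"
    then obtain a where a: "a \<in> vcarrier ?L" "x = ?\<iota> a" by blast
    have sc: "vscale (bidual ?L) c x = ?\<iota> (vscale ?L c a)" unfolding a(2) by (rule emb_scale[OF a(1), symmetric])
    show "vscale (bidual ?L) c x \<in> embedded ?L" unfolding sc using L.scale_closed[OF a(1)] by blast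
    show "T (vscale (bidual ?L) c x) = vscale ?L c (T x)"
      unfolding sc unfolding a(2) using T[OF L.scale_closed[OF a(1)]] T[OF a(1)] by simp
    fix y assume "y \<in> embedded ?L"
    then obtain b where b: "b \<in> vcarrier ?L" "y = ?\<iota> b" by blast
    have ad: "vadd (bidual ?L) x y = ?\<iota> (vadd ?L a b)" unfolding a(2) b(2) by (rule emb_add[OF a(1) b(1), symmetric])
    show "vadd (bidual ?L) x y \<in> embedded ?L" unfolding ad using L.add_closed[OF a(1) b(1)] by blast
    show "T (vadd (bidual ?L) x y) = vadd ?L (T x) (T y)"
      unfolding ad unfolding a(2) b(2) using T[OF L.add_closed[OF a(1) b(1)]] T[OF a(1)] T[OF b(1)] by simp
  next
    show "vnorm ?L (T x) \<le> vnorm (bidual ?L) x" if x: "x \<in> embedded ?L" for x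
    proof -
      obtain y where y: "y \<in> vcarrier ?L" "x = ?\<iota> y" using x by blast
      obtain f where f: "f \<in> unit_ball (dual ?L)" "f y = of_real (vnorm ?L y)"
        using norming_functional[OF L y(1)] by blast
      have fd: "f \<in> vcarrier (dual ?L)" using f by (simp add: unit_ball_def)
      have "vnorm ?L y = norm (x f)" using f fd y by (simp add: emb_apply)
      also have "\<dots> \<le> vnorm (bidual ?L) x"
        using emb_bidual(1)[OF L y(1)] f(1) y(2) L'.seminormed_space_axioms by (intro dual_norm_ball) auto
      finally show ?thesis using T y by simp
    qed
  qed (use L''.seminormed_space_axioms in blast)+
  then obtain P where "P \<in> vcarrier (bounded_ops (bidual ?L) ?L)"
    "\<And>z. z \<in> vcarrier (bidual ?L) \<Longrightarrow> vnorm ?L (P z) \<le> vnorm (bidual ?L) z"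
    "\<And>z. z \<in> embedded ?L \<Longrightarrow> P z = T z" by blast
  then show ?thesis using that[of P] T by simp
qed

definition pair_space :: "('k, 'a) nspace \<Rightarrow> ('a \<times> 'a \<Rightarrow> real) \<Rightarrow> ('k, 'a \<times> 'a) nspace" where
  "pair_space E p =
    \<lparr>vcarrier = vcarrier E \<times> vcarrier E,
     vadd = (\<lambda>u v. (vadd E (fst u) (fst v), vadd E (snd u) (snd v))),
     vscale = (\<lambda>c u. (vscale E c (fst u), vscale E c (snd u))),
     vnorm = p\<rparr>"

text \<open>
  On the diagonal of \<open>E \<times> E\<close> the operator \<open>(x, x) \<mapsto> T x\<close> is dominated by the seminorm
  \<open>m x + r\<parallel>y\<parallel>\<close>. A dominated extension \<open>V\<close> gives \<open>W x = V (x, 0)\<close> and \<open>T x - W x = V (0, x)\<close>.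
\<close>

lemma (in finite_measure) L_infty_operator_decomposition:
  fixes E :: "('k::{real_normed_field,euclidean_space}, 'b) nspace"
    and T :: "'b \<Rightarrow> ('a \<Rightarrow> 'k) set"
  assumes E: "seminormed_space E" and T: "T \<in> vcarrier (bounded_ops E (L_infty M))"
    and m_add: "\<And>x y. x \<in> vcarrier E \<Longrightarrow> y \<in> vcarrier E \<Longrightarrow> m (vadd E x y) \<le> m x + m y"
    and m_scale: "\<And>c x. x \<in> vcarrier E \<Longrightarrow> m (vscale E c x) = norm c * m x"
    and m_le: "\<And>x. x \<in> vcarrier E \<Longrightarrow> m x \<le> C * vnorm E x"
    and r: "0 \<le> r" and T_le: "\<And>x. x \<in> vcarrier E \<Longrightarrow> vnorm (L_infty M) (T x) \<le> m x + r * vnorm E x"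
  obtains W where "W \<in> vcarrier (bounded_ops E (L_infty M))"
    "\<And>x. x \<in> vcarrier E \<Longrightarrow> vnorm (L_infty M) (W x) \<le> m x"
    "\<And>x. x \<in> vcarrier E \<Longrightarrow> vnorm (L_infty M) (vdiff (L_infty M) (T x) (W x)) \<le> r * vnorm E x"
proof -
  let ?L = "L_infty M :: ('k, ('a \<Rightarrow> 'k) set) nspace"
  interpret E: seminormed_space E by fact
  interpret L: seminormed_space ?L by (rule seminormed_L_infty)
  define p where "p = (\<lambda>u::'b\<times>'b. m (fst u) + r * vnorm E (snd u))"
  let ?X = "pair_space E p"
  have sel: "vcarrier ?X = vcarrier E \<times> vcarrier E"
    "vadd ?X (x, y) (x', y') = (vadd E x x', vadd E y y')"
    "vscale ?X c (x, y) = (vscale E c x, vscale E c y)" "vnorm ?X (x, y) = m x + r * vnorm E y" for x y x' y' c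
    by (simp_all add: pair_space_def p_def)
  have X: "seminormed_space ?X"
  proof
    fix u v assume u: "u \<in> vcarrier ?X" and v: "v \<in> vcarrier ?X"
    show "vnorm ?X (vadd ?X u v) \<le> vnorm ?X u + vnorm ?X v"
    proof (cases u; cases v)
      fix x y x' y' assume [simp]: "u = (x, y)" "v = (x', y')"
      have "r * vnorm E (vadd E y y') \<le> r * (vnorm E y + vnorm E y')"
        using u v r by (intro mult_left_mono E.norm_add_le) (auto simp: sel)
      then show ?thesis using m_add[of x x'] u v by (simp add: sel algebra_simps)
    qed
  qed (auto simp: sel E.nonempty E.add_assoc E.add_comm E.add_scale_0 E.scale_scale E.scale_add_right
      E.scale_add_left E.norm_scale m_scale algebra_simps E.add_left_commute)
  let ?Y = "(\<lambda>x. (x, x)) ` vcarrier E"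
  have "\<exists>V. V \<in> vcarrier (bounded_ops ?X ?L) \<and> (\<forall>u\<in>vcarrier ?X. vnorm ?L (V u) \<le> vnorm ?X u) \<and>
      (\<forall>u\<in>?Y. V u = (T \<circ> fst) u)"
  proof (rule L_infty_injective[OF X, of ?Y "T \<circ> fst"])
    show "?Y \<noteq> {}" using E.nonempty by simp
    show "?Y \<subseteq> vcarrier ?X" by (auto simp: sel)
    fix u c assume "u \<in> ?Y"
    then obtain x where x: "x \<in> vcarrier E" "u = (x, x)" by blast
    show "vscale ?X c u \<in> ?Y" using E.scale_closed[OF x(1), of c] by (simp add: x(2) sel)
    show "(T \<circ> fst) u \<in> vcarrier ?L" using bops_closed[OF T x(1)] by (simp add: x(2))
    show "(T \<circ> fst) (vscale ?X c u) = vscale ?L c ((T \<circ> fst) u)"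
      using bops_scale[OF T x(1), of c] by (simp add: x(2) sel)
    show "vnorm ?L ((T \<circ> fst) u) \<le> vnorm ?X u" using T_le[OF x(1)] by (simp add: x(2) sel)
    fix v assume "v \<in> ?Y"
    then obtain y where y: "y \<in> vcarrier E" "v = (y, y)" by blast
    show "vadd ?X u v \<in> ?Y" using E.add_closed[OF x(1) y(1)] by (simp add: x(2) y(2) sel)
    show "(T \<circ> fst) (vadd ?X u v) = vadd ?L ((T \<circ> fst) u) ((T \<circ> fst) v)"
      using bops_add[OF T x(1) y(1)] by (simp add: x(2) y(2) sel)
  qed blast
  then obtain V where V: "V \<in> vcarrier (bounded_ops ?X ?L)"
    "\<And>u. u \<in> vcarrier ?X \<Longrightarrow> vnorm ?L (V u) \<le> vnorm ?X u"
    "\<And>x. x \<in> vcarrier E \<Longrightarrow> V (x, x) = T x" by force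
  have m0: "m E.vzero = 0" using m_scale[OF E.zero_closed, of 0] by simp
  have in_X: "(x, y) \<in> vcarrier ?X" if "x \<in> vcarrier E" "y \<in> vcarrier E" for x y
    using that by (simp add: sel)
  define W where "W = (\<lambda>x\<in>vcarrier E. V (x, E.vzero))"
  have W_le: "vnorm ?L (W x) \<le> m x" if "x \<in> vcarrier E" for x
    using V(2)[OF in_X[OF that E.zero_closed]] that by (simp add: W_def sel)
  have "W \<in> vcarrier (bounded_ops E ?L)"
  proof (rule bounded_opsI)
    show "W \<in> extensional (vcarrier E)" unfolding W_def by (rule restrict_extensional)
    show "W x \<in> vcarrier ?L" if "x \<in> vcarrier E" for x
      using bops_closed[OF V(1) in_X] that by (simp add: W_def)
    show "W (vadd E x y) = vadd ?L (W x) (W y)" if "x \<in> vcarrier E" "y \<in> vcarrier E" for x y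
      using bops_add[OF V(1) in_X in_X, of x E.vzero y E.vzero] that by (simp add: W_def sel)
    show "W (vscale E c x) = vscale ?L c (W x)" if "x \<in> vcarrier E" for c x
      using bops_scale[OF V(1) in_X, of x E.vzero c] that by (simp add: W_def sel)
    show "vnorm ?L (W x) \<le> C * vnorm E x" if "x \<in> vcarrier E" for x
      using W_le[OF that] m_le[OF that] by linarith
  qed
  moreover have "vnorm ?L (vdiff ?L (T x) (W x)) \<le> r * vnorm E x" if x: "x \<in> vcarrier E" for x
  proof -
    have "vdiff ?X (x, x) (x, E.vzero) = (E.vzero, x)"
      using x by (simp add: vdiff_def sel E.add_neg)
    then have "vdiff ?L (T x) (W x) = V (E.vzero, x)"
      using bops_diff[OF V(1) X in_X[OF x x] in_X[OF x E.zero_closed]] V(3)[OF x] x by (simp add: W_def)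
    then show ?thesis using V(2)[OF in_X[OF E.zero_closed x]] by (simp add: sel m0)
  qed
  ultimately show ?thesis using that W_le by blast
qed

section \<open>Charges\<close>

lemma bounded_measurable_const: "(\<lambda>_. c) \<in> bounded_measurable M"
  by (rule bounded_measurableI[of _ _ "norm c"]) auto

lemma bounded_measurable_add:
  fixes f g :: "'x \<Rightarrow> 'v::euclidean_space"
  assumes f: "f \<in> bounded_measurable M" and g: "g \<in> bounded_measurable M"
  shows "(\<lambda>t. f t + g t) \<in> bounded_measurable M"
proof -
  obtain B C where "\<And>t. norm (f t) \<le> B" "\<And>t. norm (g t) \<le> C"
    using f g by (auto simp: bounded_measurable_def)
  then have "norm (f t + g t) \<le> B + C" for t by (rule norm_triangle_mono)
  moreover have "(\<lambda>t. f t + g t) \<in> borel_measurable M"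
    using bounded_measurableD[OF f] bounded_measurableD[OF g] by measurable
  ultimately show ?thesis by (rule bounded_measurableI[rotated])
qed

lemma bounded_measurable_mult:
  fixes f g :: "'x \<Rightarrow> 'k::{real_normed_field,euclidean_space}"
  assumes f: "f \<in> bounded_measurable M" and g: "g \<in> bounded_measurable M"
  shows "(\<lambda>t. f t * g t) \<in> bounded_measurable M"
proof -
  obtain B C where BC: "\<And>t. norm (f t) \<le> B" "\<And>t. norm (g t) \<le> C"
    using f g by (auto simp: bounded_measurable_def)
  then have "norm (f t * g t) \<le> B * C" for t
    unfolding norm_mult by (intro mult_mono) (auto intro: order_trans[OF norm_ge_zero])
  moreover have "(\<lambda>t. f t * g t) \<in> borel_measurable M"
    using bounded_measurableD[OF f] bounded_measurableD[OF g] by measurable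
  ultimately show ?thesis by (rule bounded_measurableI[rotated])
qed

lemma bounded_measurable_scaleR:
  fixes f :: "'x \<Rightarrow> 'v::euclidean_space"
  assumes g: "g \<in> bounded_measurable M" and f: "f \<in> bounded_measurable M"
  shows "(\<lambda>t. g t *\<^sub>R f t) \<in> bounded_measurable M"
proof -
  obtain B C where BC: "\<And>t. norm (f t) \<le> B" "\<And>t. norm (g t) \<le> C"
    using f g by (auto simp: bounded_measurable_def)
  then have "norm (g t *\<^sub>R f t) \<le> C * B" for t
    unfolding norm_scaleR using order_trans[OF abs_ge_zero BC(2)[unfolded real_norm_def]]
    by (intro mult_mono) auto
  moreover have "(\<lambda>t. g t *\<^sub>R f t) \<in> borel_measurable M"
    using bounded_measurableD[OF f] bounded_measurableD[OF g] by measurable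
  ultimately show ?thesis by (rule bounded_measurableI[rotated])
qed

lemma bounded_measurable_norm:
  fixes f :: "'x \<Rightarrow> 'v::euclidean_space"
  assumes f: "f \<in> bounded_measurable M"
  shows "(\<lambda>t. norm (f t)) \<in> bounded_measurable M"
  using f unfolding bounded_measurable_def by auto

lemma bounded_measurable_power:
  fixes f :: "'x \<Rightarrow> 'k::{real_normed_field,euclidean_space}"
  assumes f: "f \<in> bounded_measurable M"
  shows "(\<lambda>t. (f t)\<^sup>2) \<in> bounded_measurable M"
  unfolding power2_eq_square using f f by (rule bounded_measurable_mult)

lemma bounded_measurable_indicator: "A \<in> sets M \<Longrightarrow> (indicator A :: 'x \<Rightarrow> real) \<in> bounded_measurable M"
  by (rule bounded_measurableI[of _ _ 1]) (auto simp: indicator_def)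

definition nonneg_bounded :: "'x measure \<Rightarrow> ('x \<Rightarrow> real) set" where
  "nonneg_bounded M = {u \<in> bounded_measurable M. \<forall>t. 0 \<le> u t}"

lemma nonneg_bounded_norm:
  fixes f :: "'x \<Rightarrow> 'v::euclidean_space"
  shows "f \<in> bounded_measurable M \<Longrightarrow> (\<lambda>t. norm (f t)) \<in> nonneg_bounded M"
  by (simp add: nonneg_bounded_def bounded_measurable_norm)

lemma nonneg_bounded_norm_sq:
  fixes f :: "'x \<Rightarrow> 'v::euclidean_space"
  shows "f \<in> bounded_measurable M \<Longrightarrow> (\<lambda>t. (norm (f t))\<^sup>2) \<in> nonneg_bounded M"
  by (simp add: nonneg_bounded_def bounded_measurable_norm bounded_measurable_power)

lemma nonneg_bounded_add:
  "\<lbrakk>u \<in> nonneg_bounded M; v \<in> nonneg_bounded M\<rbrakk> \<Longrightarrow> (\<lambda>t. u t + v t) \<in> nonneg_bounded M"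
  by (simp add: nonneg_bounded_def bounded_measurable_add)

lemma nonneg_bounded_cmult:
  "\<lbrakk>u \<in> nonneg_bounded M; 0 \<le> c\<rbrakk> \<Longrightarrow> (\<lambda>t. c * u t) \<in> nonneg_bounded M"
  by (simp add: nonneg_bounded_def bounded_measurable_mult bounded_measurable_const)

lemma nonneg_bounded_const: "0 \<le> c \<Longrightarrow> (\<lambda>_. c) \<in> nonneg_bounded M"
  by (simp add: nonneg_bounded_def bounded_measurable_const)

lemma nonneg_bounded_indicator: "A \<in> sets M \<Longrightarrow> indicator A \<in> nonneg_bounded M"
  by (simp add: nonneg_bounded_def bounded_measurable_indicator)

text \<open>
  A charge is a positive additive functional on the cone of nonnegative bounded measurable functions
  that ignores null sets, that is, integration against a finitely additive measure that is absolutely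
  continuous with respect to \<open>M\<close>. Restricting it to nonnegative functions avoids splitting functions
  into positive and negative parts.
\<close>

locale charge =
  fixes M :: "'x measure" and \<mu> :: "('x \<Rightarrow> real) \<Rightarrow> real"
  assumes nonneg: "u \<in> nonneg_bounded M \<Longrightarrow> 0 \<le> \<mu> u"
    and add: "\<lbrakk>u \<in> nonneg_bounded M; v \<in> nonneg_bounded M\<rbrakk> \<Longrightarrow> \<mu> (\<lambda>t. u t + v t) = \<mu> u + \<mu> v"
    and cmult: "\<lbrakk>u \<in> nonneg_bounded M; 0 \<le> c\<rbrakk> \<Longrightarrow> \<mu> (\<lambda>t. c * u t) = c * \<mu> u"
    and cong_AE: "\<lbrakk>u \<in> nonneg_bounded M; v \<in> nonneg_bounded M; AE t in M. u t = v t\<rbrakk> \<Longrightarrow> \<mu> u = \<mu> v"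
begin

lemma mono:
  assumes u: "u \<in> nonneg_bounded M" and v: "v \<in> nonneg_bounded M" and le: "\<And>t. u t \<le> v t"
  shows "\<mu> u \<le> \<mu> v"
proof -
  have "(\<lambda>t. v t + (-1) * u t) \<in> bounded_measurable M"
    using u v by (intro bounded_measurable_add bounded_measurable_mult bounded_measurable_const)
      (auto simp: nonneg_bounded_def)
  then have d: "(\<lambda>t. v t - u t) \<in> nonneg_bounded M" using le by (simp add: nonneg_bounded_def)
  have "\<mu> v = \<mu> u + \<mu> (\<lambda>t. v t - u t)" using add[OF u d] by simp
  then show ?thesis using nonneg[OF d] by simp
qed

end

lemma charge_zero: "charge M (\<lambda>_. 0)"
  by unfold_locales auto

lemma charge_add:
  assumes "charge M \<mu>" "charge M \<nu>"
  shows "charge M (\<lambda>u. \<mu> u + \<nu> u)"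
proof -
  interpret m: charge M \<mu> by fact
  interpret n: charge M \<nu> by fact
  show ?thesis
  proof
    fix u v assume "u \<in> nonneg_bounded M" "v \<in> nonneg_bounded M" "AE t in M. u t = v t"
    then show "\<mu> u + \<nu> u = \<mu> v + \<nu> v" by (intro arg_cong2[of _ _ _ _ "(+)"] m.cong_AE n.cong_AE)
  qed (simp_all add: m.nonneg n.nonneg m.add n.add m.cmult n.cmult distrib_left)
qed

lemma charge_cmult:
  assumes "charge M \<mu>" "0 \<le> c"
  shows "charge M (\<lambda>u. c * \<mu> u)"
proof -
  interpret m: charge M \<mu> by fact
  show ?thesis
  proof
    fix u v assume "u \<in> nonneg_bounded M" "v \<in> nonneg_bounded M" "AE t in M. u t = v t"
    then show "c * \<mu> u = c * \<mu> v" by (intro arg_cong[of _ _ "(*) c"] m.cong_AE)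
  qed (simp_all add: m.nonneg m.add m.cmult distrib_left assms(2))
qed

text \<open>
  The modulus of the functional \<open>\<phi>\<close> in the dual Banach lattice, evaluated at \<open>u\<close>.
\<close>

definition variation :: "'x measure \<Rightarrow> (('x \<Rightarrow> 'k::{real_normed_field,euclidean_space}) set \<Rightarrow> 'k) \<Rightarrow> ('x \<Rightarrow> real) \<Rightarrow> real" where
  "variation M \<phi> u =
    (SUP h\<in>{h \<in> bounded_measurable M. \<forall>t. norm (h t) \<le> u t}. norm (\<phi> (ae_class M h)))"

lemma
  fixes f g :: "'x \<Rightarrow> 'k::{real_normed_field,euclidean_space}"
  assumes \<phi>: "\<phi> \<in> vcarrier (dual (L_infty M))" and f: "f \<in> bounded_measurable M"
  shows functional_class_add: "g \<in> bounded_measurable M \<Longrightarrow>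
      \<phi> (ae_class M (\<lambda>t. f t + g t)) = \<phi> (ae_class M f) + \<phi> (ae_class M g)"
    and functional_class_cmult: "\<phi> (ae_class M (\<lambda>t. c * f t)) = c * \<phi> (ae_class M f)"
    and functional_class_le: "(\<And>t. norm (f t) \<le> B) \<Longrightarrow>
      norm (\<phi> (ae_class M f)) \<le> vnorm (dual (L_infty M)) \<phi> * B"
proof -
  note fe = bounded_measurable_ess_bounded[OF f]
  interpret L': seminormed_space "dual (L_infty M) :: ('k, ('x \<Rightarrow> 'k) set \<Rightarrow> 'k) nspace"
    by (intro seminormed_dual seminormed_L_infty)
  show "\<phi> (ae_class M (\<lambda>t. f t + g t)) = \<phi> (ae_class M f) + \<phi> (ae_class M g)"
    if g: "g \<in> bounded_measurable M"
    using dual_add[OF \<phi> ae_class_closed[OF fe] ae_class_closed[OF bounded_measurable_ess_bounded[OF g]]]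
    by (simp add: L_infty_add[OF fe bounded_measurable_ess_bounded[OF g]])
  show "\<phi> (ae_class M (\<lambda>t. c * f t)) = c * \<phi> (ae_class M f)"
    using dual_scale[OF \<phi> ae_class_closed[OF fe]] by (simp add: L_infty_scale[OF fe])
  show "norm (\<phi> (ae_class M f)) \<le> vnorm (dual (L_infty M)) \<phi> * B" if B: "\<And>t. norm (f t) \<le> B"
  proof -
    have "0 \<le> B" using B order_trans[OF norm_ge_zero] by blast
    then have "vnorm (L_infty M) (ae_class M f) \<le> B"
      using B bounded_measurableD[OF f] by (intro L_infty_norm_le) auto
    then show ?thesis
      using dual_norm_bound[OF \<phi> seminormed_L_infty ae_class_closed[OF fe]]
        mult_left_mono[OF _ L'.norm_nonneg[OF \<phi>]] by (meson order_trans)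
  qed
qed

context
  fixes M :: "'x measure" and \<phi> :: "('x \<Rightarrow> 'k::{real_normed_field,euclidean_space}) set \<Rightarrow> 'k"
  assumes \<phi>: "\<phi> \<in> vcarrier (dual (L_infty M))"
begin

lemma variation_upper:
  assumes u: "u \<in> nonneg_bounded M" and h: "h \<in> bounded_measurable M" "\<And>t. norm (h t) \<le> u t"
  shows "norm (\<phi> (ae_class M h)) \<le> variation M \<phi> u"
  unfolding variation_def
proof (rule cSUP_upper)
  obtain B where B: "\<And>t. norm (u t) \<le> B" using u unfolding nonneg_bounded_def bounded_measurable_def by blast
  show "bdd_above ((\<lambda>h. norm (\<phi> (ae_class M h))) ` {h \<in> bounded_measurable M. \<forall>t. norm (h t) \<le> u t})"
  proof (rule bdd_aboveI2)
    fix h :: "'x \<Rightarrow> 'k" assume "h \<in> {h \<in> bounded_measurable M. \<forall>t. norm (h t) \<le> u t}"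
    then have "h \<in> bounded_measurable M" "\<And>t. norm (h t) \<le> B" using B by (auto intro: order_trans abs_ge_self)
       (metis B abs_ge_self order_trans real_norm_def)
    then show "norm (\<phi> (ae_class M h)) \<le> vnorm (dual (L_infty M)) \<phi> * B"
      by (rule functional_class_le[OF \<phi>])
  qed
qed (use h in simp)

lemma variation_least:
  assumes u: "u \<in> nonneg_bounded M"
    and le: "\<And>h. h \<in> bounded_measurable M \<Longrightarrow> (\<And>t. norm (h t) \<le> u t) \<Longrightarrow> norm (\<phi> (ae_class M h)) \<le> c"
  shows "variation M \<phi> u \<le> c"
  unfolding variation_def
proof (rule cSUP_least)
  have "(\<lambda>_. 0) \<in> {h \<in> bounded_measurable M. \<forall>t. norm (h t :: 'k) \<le> u t}"
    using u by (simp add: bounded_measurable_const nonneg_bounded_def)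
  then show "{h \<in> bounded_measurable M. \<forall>t. norm (h t :: 'k) \<le> u t} \<noteq> {}" by blast
qed (use le in blast)

lemma variation_cmult_le:
  assumes u: "u \<in> nonneg_bounded M" and c: "0 < c"
  shows "variation M \<phi> (\<lambda>t. c * u t) \<le> c * variation M \<phi> u"
proof (rule variation_least)
  show "(\<lambda>t. c * u t) \<in> nonneg_bounded M" using u c by (intro nonneg_bounded_cmult) auto
  fix h :: "'x \<Rightarrow> 'k" assume h: "h \<in> bounded_measurable M" "\<And>t. norm (h t) \<le> c * u t"
  let ?k = "\<lambda>t. of_real (inverse c) * h t"
  have k: "?k \<in> bounded_measurable M" using h by (intro bounded_measurable_mult bounded_measurable_const)
  have "norm (?k t) \<le> u t" for t
    using h(2)[of t] c unfolding norm_mult norm_of_real by (simp add: field_simps)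
  then have "norm (\<phi> (ae_class M ?k)) \<le> variation M \<phi> u" by (intro variation_upper u k)
  moreover have "norm (\<phi> (ae_class M ?k)) = inverse c * norm (\<phi> (ae_class M h))"
    unfolding functional_class_cmult[OF \<phi> h(1)] norm_mult norm_of_real using c by simp
  ultimately have "inverse c * norm (\<phi> (ae_class M h)) \<le> variation M \<phi> u" by linarith
  then show "norm (\<phi> (ae_class M h)) \<le> c * variation M \<phi> u" using c by (simp add: field_simps)
qed

text \<open>
  A function below \<open>u\<close> is changed on a null set only when it is cut off where it exceeds \<open>v\<close>.
\<close>

lemma variation_AE_le:
  assumes u: "u \<in> nonneg_bounded M" and v: "v \<in> nonneg_bounded M" and ae: "AE t in M. u t = v t"
  shows "variation M \<phi> u \<le> variation M \<phi> v"
proof (rule variation_least[OF u])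
  fix h :: "'x \<Rightarrow> 'k" assume h: "h \<in> bounded_measurable M" "\<And>t. norm (h t) \<le> u t"
  define k where "k = (\<lambda>t. if norm (h t) \<le> v t then h t else 0)"
  have [measurable]: "h \<in> borel_measurable M" "v \<in> borel_measurable M"
    using h(1) v by (auto simp: nonneg_bounded_def bounded_measurableD)
  have "k \<in> borel_measurable M" unfolding k_def by measurable
  moreover have kv: "norm (k t) \<le> v t" for t using v by (auto simp: k_def nonneg_bounded_def)
  moreover obtain B where "\<And>t. norm (h t) \<le> B" using h(1) by (auto simp: bounded_measurable_def)
  then have "norm (k t) \<le> B" for t using order_trans[OF norm_ge_zero] by (auto simp: k_def)
  ultimately have k: "k \<in> bounded_measurable M" by (intro bounded_measurableI)
  have "AE t in M. h t = k t" using ae by eventually_elim (metis h(2) k_def)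
  then have "ae_class M h = ae_class M k"
    using ae_class_eq_iff[OF bounded_measurable_ess_bounded[OF h(1)] bounded_measurable_ess_bounded[OF k]] by blast
  then show "norm (\<phi> (ae_class M h)) \<le> variation M \<phi> v" using variation_upper[OF v k kv] by simp
qed

text \<open>
  Additivity is the Riesz decomposition: a function \<open>h\<close> with \<open>\<bar>h\<bar> \<le> u + v\<close> is the sum of \<open>h u / (u + v)\<close>
  and \<open>h v / (u + v)\<close>; conversely, functions below \<open>u\<close> and \<open>v\<close> can be rotated so that the values of
  \<open>\<phi>\<close> add up without cancellation.
\<close>

lemma charge_variation: "charge M (variation M \<phi>)"
proof
  fix u assume u: "u \<in> nonneg_bounded M"
  have "norm (\<phi> (ae_class M (\<lambda>_. 0))) \<le> variation M \<phi> u"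
    using u by (intro variation_upper bounded_measurable_const) (auto simp: nonneg_bounded_def)
  then show "0 \<le> variation M \<phi> u" using order_trans[OF norm_ge_zero] by blast
  fix c :: real assume c: "0 \<le> c"
  show "variation M \<phi> (\<lambda>t. c * u t) = c * variation M \<phi> u"
  proof (cases "c = 0")
    case True
    have z: "(\<lambda>t. 0 * u t) \<in> nonneg_bounded M" using u by (intro nonneg_bounded_cmult) auto
    have "variation M \<phi> (\<lambda>t. 0 * u t) \<le> 0"
    proof (rule variation_least[OF z])
      fix h :: "'x \<Rightarrow> 'k" assume h: "h \<in> bounded_measurable M" "\<And>t. norm (h t) \<le> 0 * u t"
      then show "norm (\<phi> (ae_class M h)) \<le> 0" using functional_class_le[OF \<phi> h(1), of 0] by simp
    qed
    moreover have "norm (\<phi> (ae_class M (\<lambda>_. 0))) \<le> variation M \<phi> (\<lambda>t. 0 * u t)"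
      by (intro variation_upper z bounded_measurable_const) auto
    ultimately show ?thesis using True order_trans[OF norm_ge_zero[of "\<phi> (ae_class M (\<lambda>_. 0))"]] by (simp add: antisym)
  next
    case False
    then have c: "c > 0" using c by simp
    have cu: "(\<lambda>t. c * u t) \<in> nonneg_bounded M" using u c by (intro nonneg_bounded_cmult) auto
    have "variation M \<phi> (\<lambda>t. inverse c * (c * u t)) \<le> inverse c * variation M \<phi> (\<lambda>t. c * u t)"
      using c by (intro variation_cmult_le cu) auto
    moreover have "(\<lambda>t. inverse c * (c * u t)) = u" using c by auto
    ultimately have "variation M \<phi> u \<le> inverse c * variation M \<phi> (\<lambda>t. c * u t)" by simp
    then show ?thesis using variation_cmult_le[OF u c] c by (simp add: field_simps)
  qed
next
  fix u v assume u: "u \<in> nonneg_bounded M" and v: "v \<in> nonneg_bounded M"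
  show "variation M \<phi> u = variation M \<phi> v" if "AE t in M. u t = v t"
    using variation_AE_le[OF u v that] variation_AE_le[OF v u] that by (simp add: eq_commute)
  have uv: "(\<lambda>t. u t + v t) \<in> nonneg_bounded M" using u v by (rule nonneg_bounded_add)
  show "variation M \<phi> (\<lambda>t. u t + v t) = variation M \<phi> u + variation M \<phi> v"
  proof (rule antisym)
    show "variation M \<phi> (\<lambda>t. u t + v t) \<le> variation M \<phi> u + variation M \<phi> v"
    proof (rule variation_least[OF uv])
      fix h :: "'x \<Rightarrow> 'k" assume h: "h \<in> bounded_measurable M" "\<And>t. norm (h t) \<le> u t + v t"
      have um: "u \<in> borel_measurable M" "\<And>t. 0 \<le> u t" and vm: "v \<in> borel_measurable M" "\<And>t. 0 \<le> v t"
        using u v by (auto simp: nonneg_bounded_def bounded_measurableD)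
      have part: "(\<lambda>t. (w t / (u t + v t)) *\<^sub>R h t) \<in> bounded_measurable M
          \<and> (\<forall>t. norm ((w t / (u t + v t)) *\<^sub>R h t) \<le> w t)"
        if w: "w \<in> borel_measurable M" "\<And>t. 0 \<le> w t" "\<And>t. w t \<le> u t + v t" for w
      proof
        have "(\<lambda>t. w t / (u t + v t)) \<in> borel_measurable M" using um vm w by measurable
        moreover have "norm (w t / (u t + v t)) \<le> 1" for t using w(2)[of t] w(3)[of t] by (auto simp: divide_le_eq_1)
        ultimately show "(\<lambda>t. (w t / (u t + v t)) *\<^sub>R h t) \<in> bounded_measurable M"
          by (intro bounded_measurable_scaleR h bounded_measurableI)
        show "\<forall>t. norm ((w t / (u t + v t)) *\<^sub>R h t) \<le> w t"
        proof
          fix t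
          show "norm ((w t / (u t + v t)) *\<^sub>R h t) \<le> w t"
          proof (cases "u t + v t = 0")
            case False
            then have pos: "u t + v t > 0" using um(2)[of t] vm(2)[of t] by linarith
            have "norm ((w t / (u t + v t)) *\<^sub>R h t) = w t / (u t + v t) * norm (h t)"
              using w(2)[of t] pos by simp
            also have "\<dots> \<le> w t / (u t + v t) * (u t + v t)"
              using h(2)[of t] w(2)[of t] pos by (intro mult_left_mono) auto
            also have "\<dots> = w t" using pos by simp
            finally show ?thesis .
          qed (use w in simp)
        qed
      qed
      let ?h1 = "\<lambda>t. (u t / (u t + v t)) *\<^sub>R h t" and ?h2 = "\<lambda>t. (v t / (u t + v t)) *\<^sub>R h t"
      have h1: "?h1 \<in> bounded_measurable M" "\<And>t. norm (?h1 t) \<le> u t"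
        and h2: "?h2 \<in> bounded_measurable M" "\<And>t. norm (?h2 t) \<le> v t"
        using part[OF um(1)] part[OF vm(1)] um vm by auto
      have "h t = ?h1 t + ?h2 t" for t
      proof (cases "u t + v t = 0")
        case True then show ?thesis using h(2)[of t] by simp
      next
        case False
        have "?h1 t + ?h2 t = ((u t + v t) / (u t + v t)) *\<^sub>R h t"
          unfolding add_divide_distrib scaleR_add_left ..
        then show ?thesis using False by simp
      qed
      then have "h = (\<lambda>t. ?h1 t + ?h2 t)" by blast
      then have "\<phi> (ae_class M h) = \<phi> (ae_class M ?h1) + \<phi> (ae_class M ?h2)"
        using functional_class_add[OF \<phi> h1(1) h2(1)] by simp
      then have "norm (\<phi> (ae_class M h)) \<le> norm (\<phi> (ae_class M ?h1)) + norm (\<phi> (ae_class M ?h2))"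
        by (simp only: norm_triangle_ineq)
      also have "\<dots> \<le> variation M \<phi> u + variation M \<phi> v"
        by (intro add_mono variation_upper[OF u h1] variation_upper[OF v h2])
      finally show "norm (\<phi> (ae_class M h)) \<le> variation M \<phi> u + variation M \<phi> v" .
    qed
    show "variation M \<phi> u + variation M \<phi> v \<le> variation M \<phi> (\<lambda>t. u t + v t)"
    proof -
      have *: "norm (\<phi> (ae_class M h)) + norm (\<phi> (ae_class M k)) \<le> variation M \<phi> (\<lambda>t. u t + v t)"
        if h: "h \<in> bounded_measurable M" "\<And>t. norm (h t) \<le> u t"
          and k: "k \<in> bounded_measurable M" "\<And>t. norm (k t) \<le> v t" for h k :: "'x \<Rightarrow> 'k"
      proof -
        let ?a = "csgn (\<phi> (ae_class M h))" and ?b = "csgn (\<phi> (ae_class M k))"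
        have ah: "(\<lambda>t. ?a * h t) \<in> bounded_measurable M" and bk: "(\<lambda>t. ?b * k t) \<in> bounded_measurable M"
          using h k by (auto intro: bounded_measurable_mult bounded_measurable_const)
        have "\<phi> (ae_class M (\<lambda>t. ?a * h t + ?b * k t)) = of_real (norm (\<phi> (ae_class M h)) + norm (\<phi> (ae_class M k)))"
          using functional_class_add[OF \<phi> ah bk] functional_class_cmult[OF \<phi> h(1), of ?a]
            functional_class_cmult[OF \<phi> k(1), of ?b] by (simp add: csgn_mult_self)
        then have "norm (\<phi> (ae_class M h)) + norm (\<phi> (ae_class M k))
            = norm (\<phi> (ae_class M (\<lambda>t. ?a * h t + ?b * k t)))" by (simp del: of_real_add)
        also have "\<dots> \<le> variation M \<phi> (\<lambda>t. u t + v t)"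
        proof (rule variation_upper[OF uv bounded_measurable_add[OF ah bk]])
          show "norm (?a * h t + ?b * k t) \<le> u t + v t" for t
            using norm_triangle_ineq[of "?a * h t" "?b * k t"] h(2)[of t] k(2)[of t] by (simp add: norm_mult)
        qed
        finally show ?thesis .
      qed
      have "variation M \<phi> u \<le> variation M \<phi> (\<lambda>t. u t + v t) - norm (\<phi> (ae_class M k))"
        if k: "k \<in> bounded_measurable M" "\<And>t. norm (k t) \<le> v t" for k
        using *[OF _ _ k] by (intro variation_least[OF u]) (force simp: algebra_simps)
      then have "variation M \<phi> v \<le> variation M \<phi> (\<lambda>t. u t + v t) - variation M \<phi> u"
        by (intro variation_least[OF v]) (force simp: algebra_simps)
      then show ?thesis by simp
    qed
  qed
qed

end

section \<open>Operators dominated by a charge are weakly compact\<close>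

definition representative ::
  "'x measure \<Rightarrow> ('x \<Rightarrow> 'k::{real_normed_field,euclidean_space}) set \<Rightarrow> 'x \<Rightarrow> 'k" where
  "representative M x = (SOME f. f \<in> bounded_measurable M \<and>
     (\<forall>t. norm (f t) \<le> vnorm (L_infty M) x) \<and> x = ae_class M f)"

lemma
  fixes x :: "('x \<Rightarrow> 'k::{real_normed_field,euclidean_space}) set"
  assumes x: "x \<in> vcarrier (L_infty M)"
  shows representative_bounded: "representative M x \<in> bounded_measurable M"
    and representative_le: "norm (representative M x t) \<le> vnorm (L_infty M) x"
    and ae_class_representative: "ae_class M (representative M x) = x"
proof -
  have "\<exists>f. f \<in> bounded_measurable M \<and> (\<forall>t. norm (f t) \<le> vnorm (L_infty M) x) \<and> x = ae_class M f"
    using L_infty_representative[OF x] by metis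
  then have "representative M x \<in> bounded_measurable M \<and>
    (\<forall>t. norm (representative M x t) \<le> vnorm (L_infty M) x) \<and> x = ae_class M (representative M x)"
    unfolding representative_def by (rule someI_ex)
  then show "representative M x \<in> bounded_measurable M" "norm (representative M x t) \<le> vnorm (L_infty M) x"
    "ae_class M (representative M x) = x" by auto
qed

lemma representative_ae_class:
  fixes f :: "'x \<Rightarrow> 'k::{real_normed_field,euclidean_space}"
  assumes f: "f \<in> bounded_measurable M"
  shows "AE t in M. representative M (ae_class M f) t = f t"
proof -
  note fe = bounded_measurable_ess_bounded[OF f]
  note c = ae_class_closed[OF fe]
  show ?thesis
    using ae_class_representative[OF c]
      ae_class_eq_iff[OF bounded_measurable_ess_bounded[OF representative_bounded[OF c]] fe] by simp
qed

context charge
begin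

definition charge_norm :: "('x \<Rightarrow> 'k::{real_normed_field,euclidean_space}) set \<Rightarrow> real" where
  "charge_norm x = \<mu> (\<lambda>t. norm (representative M x t))"

definition charge_sq :: "('x \<Rightarrow> 'k::{real_normed_field,euclidean_space}) set \<Rightarrow> real" where
  "charge_sq x = \<mu> (\<lambda>t. (norm (representative M x t))\<^sup>2)"

lemma charge_norm_class:
  assumes f: "f \<in> bounded_measurable M"
  shows "charge_norm (ae_class M f) = \<mu> (\<lambda>t. norm (f t))"
  unfolding charge_norm_def
proof (rule cong_AE)
  show "AE t in M. norm (representative M (ae_class M f) t) = norm (f t)"
    using representative_ae_class[OF f] by eventually_elim simp
qed (intro nonneg_bounded_norm representative_bounded ae_class_closed bounded_measurable_ess_bounded f)+

lemma charge_sq_class: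
  assumes f: "f \<in> bounded_measurable M"
  shows "charge_sq (ae_class M f) = \<mu> (\<lambda>t. (norm (f t))\<^sup>2)"
  unfolding charge_sq_def
proof (rule cong_AE)
  show "AE t in M. (norm (representative M (ae_class M f) t))\<^sup>2 = (norm (f t))\<^sup>2"
    using representative_ae_class[OF f] by eventually_elim simp
qed (intro nonneg_bounded_norm_sq representative_bounded ae_class_closed bounded_measurable_ess_bounded f)+

lemma L_infty_class_ops:
  fixes x y :: "('x \<Rightarrow> 'k::{real_normed_field,euclidean_space}) set"
  assumes x: "x \<in> vcarrier (L_infty M)"
  shows "y \<in> vcarrier (L_infty M) \<Longrightarrow>
      vadd (L_infty M) x y = ae_class M (\<lambda>t. representative M x t + representative M y t)"
    and "vscale (L_infty M) c x = ae_class M (\<lambda>t. c * representative M x t)"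
  using L_infty_add[OF bounded_measurable_ess_bounded[OF representative_bounded[OF x]]
      bounded_measurable_ess_bounded[OF representative_bounded], of y]
    L_infty_scale[OF bounded_measurable_ess_bounded[OF representative_bounded[OF x]], of c] x
  by (simp_all add: ae_class_representative)

lemma charge_norm_add:
  fixes x y :: "('x \<Rightarrow> 'k::{real_normed_field,euclidean_space}) set"
  assumes x: "x \<in> vcarrier (L_infty M)" and y: "y \<in> vcarrier (L_infty M)"
  shows "charge_norm (vadd (L_infty M) x y) \<le> charge_norm x + charge_norm y"
proof -
  let ?f = "representative M x" and ?g = "representative M y"
  have f: "?f \<in> bounded_measurable M" and g: "?g \<in> bounded_measurable M"
    using x y by (auto intro: representative_bounded)
  have "charge_norm (vadd (L_infty M) x y) = \<mu> (\<lambda>t. norm (?f t + ?g t))"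
    unfolding L_infty_class_ops(1)[OF x y] by (rule charge_norm_class[OF bounded_measurable_add[OF f g]])
  also have "\<dots> \<le> \<mu> (\<lambda>t. norm (?f t) + norm (?g t))"
    by (intro mono nonneg_bounded_norm nonneg_bounded_add bounded_measurable_add f g norm_triangle_ineq)
  also have "\<dots> = charge_norm x + charge_norm y"
    unfolding charge_norm_def by (intro add nonneg_bounded_norm f g)
  finally show ?thesis .
qed

lemma charge_norm_scale:
  fixes x :: "('x \<Rightarrow> 'k::{real_normed_field,euclidean_space}) set"
  assumes x: "x \<in> vcarrier (L_infty M)"
  shows "charge_norm (vscale (L_infty M) c x) = norm c * charge_norm x"
proof -
  let ?f = "representative M x"
  have f: "?f \<in> bounded_measurable M" using x by (rule representative_bounded)
  have "charge_norm (vscale (L_infty M) c x) = \<mu> (\<lambda>t. norm (c * ?f t))"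
    unfolding L_infty_class_ops(2)[OF x]
    by (rule charge_norm_class[OF bounded_measurable_mult[OF bounded_measurable_const f]])
  then show ?thesis
    unfolding charge_norm_def norm_mult using cmult[OF nonneg_bounded_norm[OF f], of "norm c"] by simp
qed

lemma charge_norm_le:
  fixes x :: "('x \<Rightarrow> 'k::{real_normed_field,euclidean_space}) set"
  assumes x: "x \<in> vcarrier (L_infty M)"
  shows "charge_norm x \<le> \<mu> (\<lambda>_. 1) * vnorm (L_infty M) x"
proof -
  interpret L: seminormed_space "L_infty M :: ('k, ('x \<Rightarrow> 'k) set) nspace" by (rule seminormed_L_infty)
  have n: "0 \<le> vnorm (L_infty M) x" using x by (rule L.norm_nonneg)
  have "charge_norm x \<le> \<mu> (\<lambda>_. vnorm (L_infty M) x * 1)"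
    unfolding charge_norm_def using n
    by (intro mono nonneg_bounded_norm representative_bounded x nonneg_bounded_const)
      (simp_all add: representative_le[OF x])
  also have "\<dots> = vnorm (L_infty M) x * \<mu> (\<lambda>_. 1)"
    using n by (intro cmult nonneg_bounded_const) auto
  finally show ?thesis by (simp add: mult.commute)
qed

lemma charge_sq_nonneg:
  fixes x :: "('x \<Rightarrow> 'k::{real_normed_field,euclidean_space}) set"
  shows "x \<in> vcarrier (L_infty M) \<Longrightarrow> 0 \<le> charge_sq x"
  unfolding charge_sq_def by (intro nonneg nonneg_bounded_norm_sq representative_bounded)

text \<open>
  A form of the Cauchy--Schwarz inequality that needs no square roots: integrate
  \<open>a \<le> s/2 + a\<^sup>2/(2s)\<close>.
\<close>

lemma charge_norm_le_charge_sq: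
  fixes x :: "('x \<Rightarrow> 'k::{real_normed_field,euclidean_space}) set"
  assumes x: "x \<in> vcarrier (L_infty M)" and s: "s > 0"
  shows "charge_norm x \<le> s / 2 * \<mu> (\<lambda>_. 1) + charge_sq x / (2 * s)"
proof -
  let ?f = "representative M x"
  have f: "?f \<in> bounded_measurable M" using x by (rule representative_bounded)
  have i: "(\<lambda>t. (s / 2) * 1) \<in> nonneg_bounded M" "(\<lambda>t. (1 / (2 * s)) * (norm (?f t))\<^sup>2) \<in> nonneg_bounded M"
    using s by (intro nonneg_bounded_cmult nonneg_bounded_const nonneg_bounded_norm_sq f; simp)+
  have amgm: "a \<le> s / 2 * 1 + 1 / (2 * s) * a\<^sup>2" for a :: real
  proof -
    have "0 \<le> (a - s)\<^sup>2 / (2 * s)" using s by simp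
    also have "\<dots> = s / 2 * 1 + 1 / (2 * s) * a\<^sup>2 - a" using s by (simp add: field_simps power2_eq_square)
    finally show ?thesis by simp
  qed
  have "charge_norm x \<le> \<mu> (\<lambda>t. s / 2 * 1 + 1 / (2 * s) * (norm (?f t))\<^sup>2)"
    unfolding charge_norm_def by (intro mono nonneg_bounded_norm f nonneg_bounded_add i amgm)
  also have "\<dots> = \<mu> (\<lambda>t. s / 2 * 1) + \<mu> (\<lambda>t. 1 / (2 * s) * (norm (?f t))\<^sup>2)"
    by (rule add[OF i])
  also have "\<mu> (\<lambda>t. s / 2 * 1) = s / 2 * \<mu> (\<lambda>_. 1)" using s by (intro cmult nonneg_bounded_const) auto
  also have "\<mu> (\<lambda>t. 1 / (2 * s) * (norm (?f t))\<^sup>2) = 1 / (2 * s) * charge_sq x"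
    unfolding charge_sq_def using s by (intro cmult nonneg_bounded_norm_sq f) auto
  finally show ?thesis by simp
qed

text \<open>
  The midpoint is written in the form in which \<open>ball_convex\<close> produces it.
\<close>

lemma charge_sq_parallelogram:
  fixes x y :: "('x \<Rightarrow> 'k::{real_normed_field,euclidean_space}) set"
  assumes x: "x \<in> vcarrier (L_infty M)" and y: "y \<in> vcarrier (L_infty M)"
  shows "charge_sq (vdiff (L_infty M) x y) + 4 * charge_sq
      (vadd (L_infty M) (vscale (L_infty M) (of_real (1 - 1/2)) x) (vscale (L_infty M) (of_real (1/2)) y))
    = 2 * charge_sq x + 2 * charge_sq y"
proof -
  interpret L: seminormed_space "L_infty M :: ('k, ('x \<Rightarrow> 'k) set) nspace" by (rule seminormed_L_infty)
  let ?f = "representative M x" and ?g = "representative M y"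
  have f: "?f \<in> bounded_measurable M" and g: "?g \<in> bounded_measurable M"
    using x y by (auto intro: representative_bounded)
  have sc: "(\<lambda>t. c * ?f t) \<in> bounded_measurable M" "(\<lambda>t. c * ?g t) \<in> bounded_measurable M" for c
    by (intro bounded_measurable_mult bounded_measurable_const f g)+
  have d: "charge_sq (vdiff (L_infty M) x y) = \<mu> (\<lambda>t. (norm (?f t + (- 1) * ?g t))\<^sup>2)"
  proof -
    have "vdiff (L_infty M) x y = ae_class M (\<lambda>t. ?f t + (- 1) * ?g t)"
      unfolding vdiff_def L_infty_class_ops(2)[OF y]
      using L_infty_add[OF bounded_measurable_ess_bounded[OF f] bounded_measurable_ess_bounded[OF sc(2)[of "- 1"]]]
      by (simp add: ae_class_representative[OF x])
    then show ?thesis using charge_sq_class[OF bounded_measurable_add[OF f sc(2)[of "- 1"]]] by simp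
  qed
  let ?h = "of_real (1/2) :: 'k"
  have m: "charge_sq (vadd (L_infty M) (vscale (L_infty M) (of_real (1 - 1/2)) x) (vscale (L_infty M) ?h y))
      = \<mu> (\<lambda>t. (norm (?h * ?f t + ?h * ?g t))\<^sup>2)"
  proof -
    have e: "of_real (1 - 1/2) = ?h" by simp
    show ?thesis unfolding e L_infty_class_ops(2)[OF x] L_infty_class_ops(2)[OF y]
        L_infty_add[OF bounded_measurable_ess_bounded[OF sc(1)] bounded_measurable_ess_bounded[OF sc(2)]]
      by (rule charge_sq_class[OF bounded_measurable_add[OF sc]])
  qed
  have n1: "(\<lambda>t. (norm (?f t + (- 1) * ?g t))\<^sup>2) \<in> nonneg_bounded M"
    and n2: "(\<lambda>t. (norm (?h * ?f t + ?h * ?g t))\<^sup>2) \<in> nonneg_bounded M"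
    and n3: "(\<lambda>t. (norm (?f t))\<^sup>2) \<in> nonneg_bounded M" "(\<lambda>t. (norm (?g t))\<^sup>2) \<in> nonneg_bounded M"
    by (intro nonneg_bounded_norm_sq bounded_measurable_add f g sc)+
  have n4: "(\<lambda>t. 4 * (norm (?h * ?f t + ?h * ?g t))\<^sup>2) \<in> nonneg_bounded M"
    "(\<lambda>t. 2 * (norm (?f t))\<^sup>2) \<in> nonneg_bounded M" "(\<lambda>t. 2 * (norm (?g t))\<^sup>2) \<in> nonneg_bounded M"
    using n2 n3 by (auto intro!: nonneg_bounded_cmult)
  have pt: "(norm (a + (- 1) * b))\<^sup>2 + 4 * (norm (?h * a + ?h * b))\<^sup>2 = 2 * (norm a)\<^sup>2 + 2 * (norm b)\<^sup>2" for a b :: 'k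
  proof -
    have "norm (?h * a + ?h * b) = (1/2) * norm (a + b)"
      unfolding distrib_left[symmetric] norm_mult norm_of_real by simp
    then have "4 * (norm (?h * a + ?h * b))\<^sup>2 = (norm (a + b))\<^sup>2" by (simp only:) (simp add: power_mult_distrib power2_eq_square)
    moreover have "(norm (a - b))\<^sup>2 + (norm (a + b))\<^sup>2 = 2 * (norm a)\<^sup>2 + 2 * (norm b)\<^sup>2"
      unfolding power2_norm_eq_inner by (simp add: inner_diff_left inner_diff_right inner_add_left inner_add_right)
    moreover have "a + (- 1) * b = a - b" by simp
    ultimately show ?thesis by (simp only:)
  qed
  have "charge_sq (vdiff (L_infty M) x y) + 4 * \<mu> (\<lambda>t. (norm (?h * ?f t + ?h * ?g t))\<^sup>2)
      = \<mu> (\<lambda>t. (norm (?f t + (- 1) * ?g t))\<^sup>2) + \<mu> (\<lambda>t. 4 * (norm (?h * ?f t + ?h * ?g t))\<^sup>2)"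
    unfolding d using cmult[OF n2, of 4] by simp
  also have "\<dots> = \<mu> (\<lambda>t. (norm (?f t + (- 1) * ?g t))\<^sup>2 + 4 * (norm (?h * ?f t + ?h * ?g t))\<^sup>2)"
    by (rule add[OF n1 n4(1), symmetric])
  also have "\<dots> = \<mu> (\<lambda>t. 2 * (norm (?f t))\<^sup>2 + 2 * (norm (?g t))\<^sup>2)" unfolding pt ..
  also have "\<dots> = 2 * charge_sq x + 2 * charge_sq y"
    unfolding add[OF n4(2,3)] charge_sq_def using cmult[OF n3(1), of 2] cmult[OF n3(2), of 2] by simp
  finally show ?thesis unfolding m .
qed

text \<open>
  Let \<open>C(\<Phi>, e)\<close> be the set of \<open>x\<close> in the unit ball with \<open>\<bar>z \<phi> - \<phi> x\<bar> < e\<close> for \<open>\<phi> \<in> \<Phi>\<close>. These sets are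
  convex and, by Goldstine's theorem, nonempty. Let \<open>q\<close> be the infimum of \<open>charge_sq\<close> on such a set and
  choose \<open>i0\<close> such that \<open>q i0\<close> almost attains the supremum \<open>\<alpha>\<close> of these infima. As in the proof that
  closed convex sets in Hilbert space have unique points of minimal norm, the parallelogram law shows
  that almost minimal points of \<open>C i0\<close> are close to each other in the seminorm of \<open>charge_sq\<close>, hence in
  \<open>charge_norm\<close>. For any \<open>\<psi>\<close> that is dominated by \<open>charge_norm\<close> one of these points also nearly
  satisfies \<open>z \<psi> = \<psi> x\<close>; so they all do, and one almost minimal point \<open>x\<close> serves all \<open>\<psi>\<close>.
\<close>

lemma uniform_approximation:
  fixes z :: "(('x \<Rightarrow> 'k::{real_normed_field,euclidean_space}) set \<Rightarrow> 'k) \<Rightarrow> 'k"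
  assumes z: "z \<in> unit_ball (bidual (L_infty M))" and \<eta>: "\<eta> > 0"
  obtains x where "x \<in> unit_ball (L_infty M)"
    "\<And>\<psi> b. \<lbrakk>\<psi> \<in> vcarrier (dual (L_infty M)); 0 \<le> b;
      \<And>v. v \<in> vcarrier (L_infty M) \<Longrightarrow> norm (\<psi> v) \<le> b * charge_norm v\<rbrakk> \<Longrightarrow> norm (z \<psi> - \<psi> x) \<le> b * \<eta>"
proof -
  let ?L = "L_infty M :: ('k, ('x \<Rightarrow> 'k) set) nspace"
  have L: "seminormed_space ?L" by (rule seminormed_L_infty)
  interpret L: seminormed_space ?L by (rule L)
  define \<mu>1 where "\<mu>1 = \<mu> (\<lambda>_. 1)"
  have \<mu>1: "\<mu>1 \<ge> 0" unfolding \<mu>1_def by (intro nonneg nonneg_bounded_const) simp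
  \<comment> \<open>chosen such that the bound of charge_norm_le_charge_sq for a point with charge_sq at most 8 s^2 is exactly the given tolerance\<close>
  define s where "s = 2 * \<eta> / (\<mu>1 + 8)"
  have s: "s > 0" "s / 2 * \<mu>1 + 8 * s\<^sup>2 / (2 * s) = \<eta>"
    using \<eta> \<mu>1 by (auto simp: s_def field_simps power2_eq_square add_nonneg_eq_0_iff)
  define \<delta> where "\<delta> = s\<^sup>2"
  have \<delta>: "\<delta> > 0" using s by (simp add: \<delta>_def)
  define I where "I = {(\<Phi>, e). finite \<Phi> \<and> \<Phi> \<subseteq> vcarrier (dual ?L) \<and> (e::real) > 0}"
  define C where "C = (\<lambda>(\<Phi>, e). {x \<in> unit_ball ?L. \<forall>\<phi>\<in>\<Phi>. norm (z \<phi> - \<phi> x) < e})"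
  define q where "q = (\<lambda>i. INF x\<in>C i. charge_sq x)"
  have Cne: "C i \<noteq> {}" if i: "i \<in> I" for i
  proof -
    obtain \<Phi> e where ie: "i = (\<Phi>, e)" "finite \<Phi>" "\<Phi> \<subseteq> vcarrier (dual ?L)" "e > 0" using i by (auto simp: I_def)
    obtain x where "x \<in> unit_ball ?L" "\<And>\<phi>. \<phi> \<in> \<Phi> \<Longrightarrow> norm (z \<phi> - \<phi> x) < e"
      using goldstine[OF L z ie(2-4)] by blast
    then have "x \<in> C i" by (simp add: C_def ie(1))
    then show ?thesis by blast
  qed
  have CL: "x \<in> unit_ball ?L" "x \<in> vcarrier ?L" if "x \<in> C i" for x i
    using that L.ball_closed by (auto simp: C_def split: prod.splits)
  have bdd: "bdd_below (charge_sq ` C i)" for i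
    by (rule bdd_belowI2[of _ 0]) (rule charge_sq_nonneg[OF CL(2)])
  have q_le: "q i \<le> charge_sq x" if "x \<in> C i" for x i
    unfolding q_def using bdd that by (rule cINF_lower)
  have q_near: "\<exists>x\<in>C i. charge_sq x < q i + \<delta>" if "i \<in> I" for i
    using cINF_less_iff[OF Cne[OF that] bdd, of "q i + \<delta>"] \<delta> by (simp add: q_def)
  have sq1: "charge_sq x \<le> \<mu>1" if x: "x \<in> unit_ball ?L" for x
    unfolding charge_sq_def \<mu>1_def
  proof (rule mono)
    have xL: "x \<in> vcarrier ?L" using x by (rule L.ball_closed)
    show "(\<lambda>t. (norm (representative M x t))\<^sup>2) \<in> nonneg_bounded M"
      by (intro nonneg_bounded_norm_sq representative_bounded xL)
    fix t
    have "norm (representative M x t) \<le> 1"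
      using representative_le[OF xL, of t] x by (simp add: unit_ball_def)
    then show "(norm (representative M x t))\<^sup>2 \<le> 1" by (simp add: power_le_one)
  qed (simp add: nonneg_bounded_const)
  have q1: "q i \<le> \<mu>1" if "i \<in> I" for i
    using Cne[OF that] q_le sq1 CL by (meson all_not_in_conv order_trans)
  have Ine: "({}, 1) \<in> I" by (simp add: I_def)
  have qbdd: "bdd_above (q ` I)" using q1 by (rule bdd_aboveI2)
  define \<alpha> where "\<alpha> = (SUP i\<in>I. q i)"
  have q\<alpha>: "q i \<le> \<alpha>" if "i \<in> I" for i unfolding \<alpha>_def using that qbdd by (rule cSUP_upper)
  obtain i0 where i0: "i0 \<in> I" "q i0 > \<alpha> - \<delta>"
    using less_cSUP_iff[of I q "\<alpha> - \<delta>"] Ine qbdd \<delta> by (force simp: \<alpha>_def)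
  obtain \<Phi>0 e0 where ie0: "i0 = (\<Phi>0, e0)" by force
  obtain x where x: "x \<in> C i0" "charge_sq x < q i0 + \<delta>" using q_near[OF i0(1)] by blast
  show ?thesis
  proof (rule that[OF CL(1)[OF x(1)]])
    fix \<psi> b assume \<psi>: "\<psi> \<in> vcarrier (dual ?L)" and b: "0 \<le> b"
      and dom: "\<And>v. v \<in> vcarrier ?L \<Longrightarrow> norm (\<psi> v) \<le> b * charge_norm v"
    show "norm (z \<psi> - \<psi> x) \<le> b * \<eta>"
    proof (rule field_le_epsilon)
      fix e1 :: real assume e1: "e1 > 0"
      let ?i = "(insert \<psi> \<Phi>0, min e0 e1)"
      have iI: "?i \<in> I" using i0(1) \<psi> e1 by (simp add: I_def ie0)
      obtain x' where x': "x' \<in> C ?i" "charge_sq x' < q ?i + \<delta>" using q_near[OF iI] by blast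
      have x'0: "x' \<in> C i0" using x'(1) by (auto simp: C_def ie0)
      have near: "norm (z \<psi> - \<psi> x') < e1" using x'(1) by (auto simp: C_def)
      let ?y = "vadd ?L (vscale ?L (of_real (1 - 1/2)) x) (vscale ?L (of_real (1/2)) x')"
      have "?y \<in> C i0"
      proof -
        have "norm (z \<phi> - \<phi> ?y) < e0" if \<phi>: "\<phi> \<in> \<Phi>0" for \<phi>
        proof -
          have \<phi>d: "\<phi> \<in> vcarrier (dual ?L)" using \<phi> i0(1) by (auto simp: I_def ie0)
          have \<phi>y: "\<phi> ?y = of_real (1 - 1/2) * \<phi> x + of_real (1/2) * \<phi> x'"
            using dual_add[OF \<phi>d L.scale_closed L.scale_closed, OF CL(2)[OF x(1)] CL(2)[OF x'0]]
              dual_scale[OF \<phi>d CL(2)[OF x(1)]] dual_scale[OF \<phi>d CL(2)[OF x'0]] by metis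
          have "z \<phi> - \<phi> ?y = of_real (1/2) * (z \<phi> - \<phi> x) + of_real (1/2) * (z \<phi> - \<phi> x')"
            unfolding \<phi>y by (simp add: field_simps)
          also have "norm \<dots> \<le> norm (of_real (1/2) * (z \<phi> - \<phi> x)) + norm (of_real (1/2) * (z \<phi> - \<phi> x'))"
            by (rule norm_triangle_ineq)
          also have "\<dots> = 1/2 * norm (z \<phi> - \<phi> x) + 1/2 * norm (z \<phi> - \<phi> x')"
            unfolding norm_mult norm_of_real by simp
          finally show ?thesis using x(1) x'0 \<phi> by (fastforce simp: C_def ie0)
        qed
        moreover have "?y \<in> unit_ball ?L"
          using CL(1)[OF x(1)] CL(1)[OF x'0] by (intro L.ball_convex) auto
        ultimately show ?thesis by (simp add: C_def ie0)
      qed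
      then have "charge_sq ?y > \<alpha> - \<delta>" using q_le i0(2) by fastforce
      moreover have "charge_sq x < \<alpha> + \<delta>" "charge_sq x' < \<alpha> + \<delta>"
        using x(2) x'(2) q\<alpha>[OF i0(1)] q\<alpha>[OF iI] by linarith+
      ultimately have "charge_sq (vdiff ?L x' x) < 8 * \<delta>"
      proof -
        let ?y' = "vadd ?L (vscale ?L (of_real (1 - 1/2)) x') (vscale ?L (of_real (1/2)) x)"
        have e: "?y' = ?y"
          using L.add_comm[of "vscale ?L (of_real (1/2)) x'" "vscale ?L (of_real (1/2)) x"]
            CL(2)[OF x(1)] CL(2)[OF x'0] by simp
        assume "charge_sq ?y > \<alpha> - \<delta>" "charge_sq x < \<alpha> + \<delta>" "charge_sq x' < \<alpha> + \<delta>"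
        then show ?thesis
          using charge_sq_parallelogram[OF CL(2)[OF x'0] CL(2)[OF x(1)], unfolded e] by linarith
      qed
      have dL: "vdiff ?L x' x \<in> vcarrier ?L" using CL(2)[OF x(1)] CL(2)[OF x'0] by (rule L.diff_closed[rotated])
      have "charge_norm (vdiff ?L x' x) \<le> s / 2 * \<mu>1 + charge_sq (vdiff ?L x' x) / (2 * s)"
        unfolding \<mu>1_def by (rule charge_norm_le_charge_sq[OF dL s(1)])
      also have "\<dots> \<le> s / 2 * \<mu>1 + 8 * \<delta> / (2 * s)"
        using \<open>charge_sq (vdiff ?L x' x) < 8 * \<delta>\<close> s(1) by (intro add_left_mono divide_right_mono) auto
      also have "\<dots> = \<eta>" using s(2) by (simp add: \<delta>_def)
      finally have "b * charge_norm (vdiff ?L x' x) \<le> b * \<eta>" using b by (rule mult_left_mono)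
      then have "norm (\<psi> x' - \<psi> x) \<le> b * \<eta>"
        using dom[OF dL] dual_diff[OF \<psi> L CL(2)[OF x'0] CL(2)[OF x(1)]] by simp
      then show "norm (z \<psi> - \<psi> x) \<le> b * \<eta> + e1"
        using norm_triangle_ineq[of "z \<psi> - \<psi> x'" "\<psi> x' - \<psi> x"] near by simp
    qed
  qed
qed

text \<open>
  The functionals \<open>f \<circ> W\<close> with \<open>f\<close> in the dual ball are dominated by \<open>charge_norm\<close>, so
  \<open>uniform_approximation\<close> approximates the biadjoint at \<open>z\<close> in norm by vectors \<open>W x\<close> of \<open>F\<close>. The
  projection \<open>P\<close> replaces completeness of \<open>F\<close>: a point of the bidual that is a limit of points of
  \<open>F\<close> equals its own projection.
\<close>

theorem weakly_compact_op_if_charge_dominated: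
  fixes W :: "('x \<Rightarrow> 'k::{real_normed_field,euclidean_space}) set \<Rightarrow> 'b"
  assumes F: "seminormed_space F" and sep: "separating F"
    and P: "P \<in> vcarrier (bounded_ops (bidual F) F)"
    and P_norm: "\<And>z. z \<in> vcarrier (bidual F) \<Longrightarrow> vnorm F (P z) \<le> vnorm (bidual F) z"
    and P_emb: "\<And>y. y \<in> vcarrier F \<Longrightarrow> P (canonical_embedding F y) = y"
    and W: "W \<in> vcarrier (bounded_ops (L_infty M) F)"
    and dom: "\<And>x. x \<in> vcarrier (L_infty M) \<Longrightarrow> vnorm F (W x) \<le> charge_norm x"
  shows "weakly_compact_op (L_infty M) F W"
proof (rule weakly_compact_opI[OF W seminormed_L_infty F sep])
  let ?L = "L_infty M :: ('k, ('x \<Rightarrow> 'k) set) nspace"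
  have L: "seminormed_space ?L" by (rule seminormed_L_infty)
  interpret L: seminormed_space ?L by (rule L)
  interpret F: seminormed_space F by fact
  interpret F': seminormed_space "dual F" using F by (rule seminormed_dual)
  interpret F'': seminormed_space "bidual F" using F by (intro seminormed_dual)
  fix z assume z: "z \<in> unit_ball (bidual ?L)"
  have zb: "z \<in> vcarrier (bidual ?L)" using z by (simp add: unit_ball_def)
  let ?Z = "biadjoint_op ?L F W z"
  have Z: "?Z \<in> vcarrier (bidual F)"
    using adjoint_dual(1)[OF adjoint_bops(1)[OF W L F] seminormed_dual[OF F] seminormed_dual[OF L] zb] .
  have Zf: "?Z f = z (adjoint_op ?L F W f)" if "f \<in> vcarrier (dual F)" for f
    using that by (rule adjoint_apply[OF zb])
  have PZ: "P ?Z \<in> vcarrier F" using bops_closed[OF P Z] .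
  have "z (adjoint_op ?L F W f) = f (P ?Z)" if f: "f \<in> vcarrier (dual F)" for f
  proof -
    have n: "0 \<le> vnorm (dual F) f" using f by (rule F'.norm_nonneg)
    have "norm (z (adjoint_op ?L F W f) - f (P ?Z)) \<le> 2 * vnorm (dual F) f * \<eta>" if \<eta>: "\<eta> > 0" for \<eta>
    proof -
      obtain x where x: "x \<in> unit_ball ?L"
        "\<And>\<psi> b. \<lbrakk>\<psi> \<in> vcarrier (dual ?L); 0 \<le> b;
          \<And>v. v \<in> vcarrier ?L \<Longrightarrow> norm (\<psi> v) \<le> b * charge_norm v\<rbrakk> \<Longrightarrow> norm (z \<psi> - \<psi> x) \<le> b * \<eta>"
        using uniform_approximation[OF z \<eta>] by blast
      have xL: "x \<in> vcarrier ?L" using x(1) by (rule L.ball_closed)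
      have Wx: "W x \<in> vcarrier F" using bops_closed[OF W xL] .
      have approx: "norm (z (adjoint_op ?L F W g) - g (W x)) \<le> vnorm (dual F) g * \<eta>"
        if g: "g \<in> vcarrier (dual F)" for g
      proof -
        have "norm (adjoint_op ?L F W g v) \<le> vnorm (dual F) g * charge_norm v" if v: "v \<in> vcarrier ?L" for v
        proof -
          have "norm (g (W v)) \<le> vnorm (dual F) g * vnorm F (W v)"
            by (rule dual_norm_bound[OF g F bops_closed[OF W v]])
          also have "\<dots> \<le> vnorm (dual F) g * charge_norm v"
            by (intro mult_left_mono dom[OF v] F'.norm_nonneg[OF g])
          finally show ?thesis using adjoint_apply[OF g v] by simp
        qed
        then show ?thesis
          using x(2)[OF adjoint_dual(1)[OF W L F g] F'.norm_nonneg[OF g]] adjoint_apply[OF g xL] by simp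
      qed
      have eW: "canonical_embedding F (W x) \<in> vcarrier (bidual F)" using emb_bidual(1)[OF F Wx] .
      have "vnorm (bidual F) (vdiff (bidual F) ?Z (canonical_embedding F (W x))) \<le> \<eta>"
      proof (rule dual_norm_le'[OF F'.seminormed_space_axioms])
        fix g assume g: "g \<in> vcarrier (dual F)"
        have "vdiff (bidual F) ?Z (canonical_embedding F (W x)) g = z (adjoint_op ?L F W g) - g (W x)"
          using g by (simp add: vdiff_def dual_sel Zf emb_apply)
        then show "norm (vdiff (bidual F) ?Z (canonical_embedding F (W x)) g) \<le> \<eta> * vnorm (dual F) g"
          using approx[OF g] by (simp add: mult.commute)
      qed (use \<eta> in simp)
      then have "vnorm F (P (vdiff (bidual F) ?Z (canonical_embedding F (W x)))) \<le> \<eta>"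
        using P_norm[OF F''.diff_closed[OF Z eW]] by linarith
      then have "vnorm F (vdiff F (P ?Z) (W x)) \<le> \<eta>"
        using bops_diff[OF P F''.seminormed_space_axioms Z eW] P_emb[OF Wx] by simp
      then have "norm (f (vdiff F (P ?Z) (W x))) \<le> vnorm (dual F) f * \<eta>"
        using dual_norm_bound[OF f F F.diff_closed[OF PZ Wx]] n by (meson mult_left_mono order_trans)
      then have "norm (f (P ?Z) - f (W x)) \<le> vnorm (dual F) f * \<eta>"
        using dual_diff[OF f F PZ Wx] by simp
      then show ?thesis
        using approx[OF f] norm_triangle_ineq4[of "z (adjoint_op ?L F W f) - f (W x)" "f (P ?Z) - f (W x)"]
        by simp
    qed
    note bound = this
    have "norm (z (adjoint_op ?L F W f) - f (P ?Z)) \<le> 0"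
    proof (rule field_le_epsilon)
      fix e :: real assume e: "e > 0"
      have "2 * vnorm (dual F) f * (e / (2 * vnorm (dual F) f + 1)) \<le> e"
        using n e by (simp add: field_simps)
      then show "norm (z (adjoint_op ?L F W f) - f (P ?Z)) \<le> 0 + e"
        using bound[of "e / (2 * vnorm (dual F) f + 1)"] n e by fastforce
    qed
    then show ?thesis by simp
  qed
  then show "\<exists>y\<in>vcarrier F. \<forall>f\<in>vcarrier (dual F). z (adjoint_op ?L F W f) = f y" using PZ by blast
qed

end

section \<open>Disjoint sequences\<close>

lemma charge_sum:
  fixes N :: nat
  assumes "\<And>i. i < N \<Longrightarrow> charge M (\<mu> i)"
  shows "charge M (\<lambda>u. \<Sum>i<N. \<mu> i u)"
  using assms
proof (induction N)
  case 0 then show ?case by (simp add: charge_zero)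
next
  case (Suc N)
  have "charge M (\<lambda>u. (\<Sum>i<N. \<mu> i u) + \<mu> N u)" using Suc by (intro charge_add) auto
  then show ?case by simp
qed

lemma (in charge) indicator_Union_le:
  assumes "\<And>i. i < N \<Longrightarrow> B i \<in> sets M"
  shows "\<mu> (indicator (\<Union>i<N. B i)) \<le> (\<Sum>i<(N::nat). \<mu> (indicator (B i)))"
  using assms
proof (induction N)
  case 0
  have "\<mu> (\<lambda>t. 0 * 0) = 0 * \<mu> (\<lambda>_. 0)" by (intro cmult nonneg_bounded_const) auto
  moreover have "indicator {} = (\<lambda>t. 0 * 0 :: real)" by auto
  ultimately show ?case by simp
next
  case (Suc N)
  have m: "(\<Union>i<N. B i) \<in> sets M" "B N \<in> sets M" using Suc.prems by auto
  have "\<mu> (indicator (\<Union>i<Suc N. B i)) \<le> \<mu> (\<lambda>t. indicator (\<Union>i<N. B i) t + indicator (B N) t)"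
    using Suc.prems
    by (intro mono nonneg_bounded_add nonneg_bounded_indicator m sets.finite_UN)
      (auto simp: indicator_def lessThan_Suc)
  also have "\<dots> = \<mu> (indicator (\<Union>i<N. B i)) + \<mu> (indicator (B N))"
    by (intro add nonneg_bounded_indicator m)
  finally show ?case using Suc by simp
qed

locale L_infty_operator =
  fixes M :: "'x measure" and F :: "('k::{real_normed_field,euclidean_space}, 'b) nspace"
    and T :: "('x \<Rightarrow> 'k) set \<Rightarrow> 'b"
  assumes F: "seminormed_space F" and T: "T \<in> vcarrier (bounded_ops (L_infty M) F)"
begin

sublocale L: seminormed_space "L_infty M :: ('k, ('x \<Rightarrow> 'k) set) nspace" by (rule seminormed_L_infty)
sublocale F: seminormed_space F by (rule F)
sublocale F': seminormed_space "dual F" using F by (rule seminormed_dual)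
sublocale L': seminormed_space "dual (L_infty M) :: ('k, ('x \<Rightarrow> 'k) set \<Rightarrow> 'k) nspace"
  by (intro seminormed_dual seminormed_L_infty)

lemmas LS = L.seminormed_space_axioms

definition image_norm :: "('x \<Rightarrow> 'k) \<Rightarrow> real" where
  "image_norm f = vnorm F (T (ae_class M f))"

definition bound :: real where "bound = op_norm (L_infty M) F T"

definition pullback :: "('b \<Rightarrow> 'k) \<Rightarrow> ('x \<Rightarrow> 'k) set \<Rightarrow> 'k" where
  "pullback g = adjoint_op (L_infty M) F T g"

definition unit_functions :: "('x \<Rightarrow> 'k) set" where
  "unit_functions = {f \<in> bounded_measurable M. \<forall>t. norm (f t) \<le> 1}"

lemma bound_nonneg: "0 \<le> bound"
  unfolding bound_def by (rule op_norm_nonneg[OF T LS F])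

lemma class_closed: "f \<in> bounded_measurable M \<Longrightarrow> ae_class M f \<in> vcarrier (L_infty M)"
  for f :: "'x \<Rightarrow> 'k"
  by (intro ae_class_closed bounded_measurable_ess_bounded)

lemma image_norm_add:
  assumes f: "f \<in> bounded_measurable M" and g: "g \<in> bounded_measurable M"
  shows "image_norm (\<lambda>t. f t + g t) \<le> image_norm f + image_norm g"
proof -
  have "T (ae_class M (\<lambda>t. f t + g t)) = vadd F (T (ae_class M f)) (T (ae_class M g))"
    using bops_add[OF T class_closed[OF f] class_closed[OF g]]
      L_infty_add[OF bounded_measurable_ess_bounded[OF f] bounded_measurable_ess_bounded[OF g]] by simp
  then show ?thesis
    unfolding image_norm_def
    using F.norm_add_le[OF bops_closed[OF T class_closed[OF f]] bops_closed[OF T class_closed[OF g]]] by simp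
qed

lemma image_norm_cmult:
  assumes f: "f \<in> bounded_measurable M"
  shows "image_norm (\<lambda>t. c * f t) = norm c * image_norm f"
proof -
  have "T (ae_class M (\<lambda>t. c * f t)) = vscale F c (T (ae_class M f))"
    using bops_scale[OF T class_closed[OF f]] L_infty_scale[OF bounded_measurable_ess_bounded[OF f]] by simp
  then show ?thesis
    unfolding image_norm_def using F.norm_scale[OF bops_closed[OF T class_closed[OF f]]] by simp
qed

lemma image_norm_le:
  assumes f: "f \<in> bounded_measurable M" and le: "\<And>t. norm (f t) \<le> c"
  shows "image_norm f \<le> bound * c"
proof -
  have c: "0 \<le> c" using le order_trans[OF norm_ge_zero] by blast
  have "image_norm f \<le> bound * vnorm (L_infty M) (ae_class M f)"
    unfolding image_norm_def bound_def by (rule op_norm_bound[OF T LS F class_closed[OF f]])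
  also have "\<dots> \<le> bound * c"
    using bounded_measurableD[OF f] le c by (intro mult_left_mono bound_nonneg L_infty_norm_le) auto
  finally show ?thesis .
qed

lemma image_norm_sum:
  assumes "\<And>i. i < N \<Longrightarrow> f i \<in> bounded_measurable M"
  shows "(\<lambda>t. \<Sum>i<N. f i t) \<in> bounded_measurable M \<and>
    image_norm (\<lambda>t. \<Sum>i<(N::nat). f i t) \<le> (\<Sum>i<N. image_norm (f i))"
  using assms
proof (induction N)
  case 0
  then show ?case using image_norm_le[OF bounded_measurable_const[of 0], of 0] by (simp add: bounded_measurable_const)
next
  case (Suc N)
  then have IH: "(\<lambda>t. \<Sum>i<N. f i t) \<in> bounded_measurable M"
    "image_norm (\<lambda>t. \<Sum>i<N. f i t) \<le> (\<Sum>i<N. image_norm (f i))" and fN: "f N \<in> bounded_measurable M"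
    by auto
  show ?case
    using bounded_measurable_add[OF IH(1) fN] image_norm_add[OF IH(1) fN] IH(2) by simp
qed

lemma pullback_dual: "g \<in> vcarrier (dual F) \<Longrightarrow> pullback g \<in> vcarrier (dual (L_infty M))"
  unfolding pullback_def by (rule adjoint_dual(1)[OF T LS F])

lemma pullback_apply:
  "\<lbrakk>g \<in> vcarrier (dual F); x \<in> vcarrier (L_infty M)\<rbrakk> \<Longrightarrow> pullback g x = g (T x)"
  unfolding pullback_def by (rule adjoint_apply)

lemma restrict_bounded:
  fixes f :: "'x \<Rightarrow> 'k"
  shows "\<lbrakk>A \<in> sets M; f \<in> bounded_measurable M\<rbrakk> \<Longrightarrow> (\<lambda>t. indicator A t *\<^sub>R f t) \<in> bounded_measurable M"
  by (intro bounded_measurable_scaleR bounded_measurable_indicator)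

lemma restrict_unit:
  "\<lbrakk>A \<in> sets M; f \<in> unit_functions\<rbrakk> \<Longrightarrow> (\<lambda>t. indicator A t *\<^sub>R f t) \<in> unit_functions"
  using restrict_bounded by (auto simp: unit_functions_def indicator_def)

text \<open>
  The level \<open>r\<close> is attached to functions in the unit ball, so that no norm of \<open>f\<close> appears; homogeneity
  gives the general case in \<open>dominated_bound\<close>.
\<close>

definition dominated_on :: "'x set \<Rightarrow> real \<Rightarrow> bool" where
  "dominated_on A r \<longleftrightarrow> (\<exists>\<mu>. charge M \<mu> \<and> (\<forall>f\<in>unit_functions.
     image_norm (\<lambda>t. indicator A t *\<^sub>R f t) \<le> \<mu> (\<lambda>t. norm (f t)) + r))"

definition bump :: "'x set \<Rightarrow> ('b \<Rightarrow> 'k) \<Rightarrow> ('x \<Rightarrow> 'k) \<Rightarrow> real \<Rightarrow> bool" where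
  "bump B g f r \<longleftrightarrow> B \<in> sets M \<and> g \<in> unit_ball (dual F) \<and> f \<in> unit_functions \<and>
     (\<forall>t. t \<notin> B \<longrightarrow> f t = 0) \<and> r < pullback g (ae_class M f) \<bullet> 1"

text \<open>
  A large multiple \<open>c \<mu>\<close> does not dominate, so some \<open>f\<close> in the unit ball has an image of norm above \<open>r\<close>
  although \<open>\<mu>(\<bar>f\<bar>)\<close> is tiny. The set where \<open>\<bar>f\<bar> \<ge> \<eta>\<close> has small charge by Markov's inequality, and
  the part of \<open>f\<close> outside of it contributes little.
\<close>

lemma bump_exists:
  assumes A: "A \<in> sets M" and bad: "\<not> dominated_on A r" and \<mu>: "charge M \<mu>" and \<delta>: "\<delta> > 0" and \<epsilon>: "\<epsilon> > 0"
  obtains B g f where "B \<subseteq> A" "bump B g f (r - \<epsilon>)" "\<mu> (indicator B) < \<delta>"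
proof -
  interpret charge M \<mu> by (rule \<mu>)
  define \<eta> where "\<eta> = \<epsilon> / (bound + 1)"
  have \<eta>: "\<eta> > 0" "bound * \<eta> < \<epsilon>" using \<epsilon> bound_nonneg by (auto simp: \<eta>_def field_simps)
  define c where "c = (bound + \<bar>r\<bar> + 1) / (\<delta> * \<eta>)"
  have c: "c > 0" using \<delta> \<eta> bound_nonneg by (auto simp: c_def intro!: divide_pos_pos)
  have "charge M (\<lambda>u. c * \<mu> u)" using c by (intro charge_cmult \<mu>) auto
  then obtain f where f: "f \<in> unit_functions"
    "image_norm (\<lambda>t. indicator A t *\<^sub>R f t) > c * \<mu> (\<lambda>t. norm (f t)) + r"
    using bad unfolding dominated_on_def by (meson not_le)
  have fb: "f \<in> bounded_measurable M" and f1: "\<And>t. norm (f t) \<le> 1" using f(1) by (auto simp: unit_functions_def)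
  have [measurable]: "f \<in> borel_measurable M" using fb by (rule bounded_measurableD)
  define B where "B = A \<inter> {t \<in> space M. \<eta> \<le> norm (f t)}"
  have B: "B \<in> sets M" unfolding B_def using A by measurable
  have AB: "A - B \<in> sets M" using A B by blast
  have small: "norm (indicator (A - B) t *\<^sub>R f t) \<le> \<eta>" for t
    using \<eta>(1) sets.sets_into_space[OF A] by (auto simp: B_def indicator_def)
  have "image_norm (\<lambda>t. indicator A t *\<^sub>R f t) \<le> bound * 1"
    using f1 by (intro image_norm_le restrict_bounded A fb) (auto simp: indicator_def)
  then have "c * \<mu> (\<lambda>t. norm (f t)) < bound + \<bar>r\<bar> + 1" using f(2) by linarith
  also have "\<dots> = c * (\<delta> * \<eta>)" using \<delta> \<eta> by (simp add: c_def)
  finally have "\<mu> (\<lambda>t. norm (f t)) < \<delta> * \<eta>"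
    using c by (simp only: mult_less_cancel_left_pos)
  moreover have "\<eta> * \<mu> (indicator B) \<le> \<mu> (\<lambda>t. norm (f t))"
  proof -
    have "\<eta> * \<mu> (indicator B) = \<mu> (\<lambda>t. \<eta> * indicator B t)"
      using \<eta> by (intro cmult[symmetric] nonneg_bounded_indicator B) auto
    also have "\<dots> \<le> \<mu> (\<lambda>t. norm (f t))"
      using \<eta> by (intro mono nonneg_bounded_cmult nonneg_bounded_indicator B nonneg_bounded_norm fb)
        (auto simp: B_def indicator_def)
    finally show ?thesis .
  qed
  ultimately have "\<eta> * \<mu> (indicator B) < \<eta> * \<delta>" by (simp add: mult.commute)
  then have \<mu>B: "\<mu> (indicator B) < \<delta>" using \<eta> by simp
  let ?f = "\<lambda>t. indicator B t *\<^sub>R f t"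
  have "(\<lambda>t. indicator A t *\<^sub>R f t) = (\<lambda>t. ?f t + indicator (A - B) t *\<^sub>R f t)"
    by (auto simp: B_def indicator_def)
  then have "image_norm (\<lambda>t. indicator A t *\<^sub>R f t) \<le> image_norm ?f + image_norm (\<lambda>t. indicator (A - B) t *\<^sub>R f t)"
    using image_norm_add[OF restrict_bounded[OF B fb] restrict_bounded[OF AB fb]] by simp
  also have "\<dots> \<le> image_norm ?f + bound * \<eta>"
    by (intro add_left_mono image_norm_le restrict_bounded AB fb small)
  finally have "r - \<epsilon> < image_norm ?f"
    using f(2) \<eta>(2) c nonneg[OF nonneg_bounded_norm[OF fb]] mult_nonneg_nonneg[of c "\<mu> (\<lambda>t. norm (f t))"] by linarith
  moreover have cl: "ae_class M ?f \<in> vcarrier (L_infty M)" by (intro class_closed restrict_bounded B fb)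
  obtain g where g: "g \<in> unit_ball (dual F)" "g (T (ae_class M ?f)) = of_real (vnorm F (T (ae_class M ?f)))"
    using norming_functional[OF F bops_closed[OF T cl]] by blast
  have gd: "g \<in> vcarrier (dual F)" using g by (simp add: unit_ball_def)
  have "pullback g (ae_class M ?f) \<bullet> 1 = image_norm ?f"
    using g(2) by (simp add: pullback_apply[OF gd cl] image_norm_def)
  ultimately have "bump B g ?f (r - \<epsilon>)"
    unfolding bump_def using B g restrict_unit[OF B f(1)] by auto
  then show ?thesis using that[of B g ?f] \<mu>B by (auto simp: B_def)
qed

text \<open>
  Each new bump is cut down by the sets of the later ones. The later sets are therefore chosen small
  for the variation of the pullback of the new functional, in addition to \<open>\<mu>\<close>; so the induction takes
  the first bump first and all \<open>\<mu>\<close>, \<open>\<delta>\<close>, \<open>\<epsilon>\<close> are general. This works for finitely many sets only,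
  because a charge need not be countably subadditive.
\<close>

lemma disjoint_bumps_exist:
  assumes A: "A \<in> sets M" and bad: "\<not> dominated_on A r"
  shows "\<lbrakk>charge M \<mu>; \<delta> > 0; \<epsilon> > 0\<rbrakk> \<Longrightarrow>
    \<exists>B g f. (\<forall>i<N. B i \<subseteq> A \<and> bump (B i) (g i) (f i) (r - \<epsilon>) \<and> \<mu> (indicator (B i)) < \<delta>) \<and>
      disjoint_family_on B {..<N::nat}"
proof (induction N arbitrary: \<mu> \<delta> \<epsilon>)
  case 0 then show ?case by (simp add: disjoint_family_on_def)
next
  case (Suc N)
  interpret \<mu>: charge M \<mu> by (rule Suc.prems)
  obtain B0 g0 f0 where 0: "B0 \<subseteq> A" "bump B0 g0 f0 (r - \<epsilon> / 2)" "\<mu> (indicator B0) < \<delta>"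
    using bump_exists[OF A bad Suc.prems(1,2), of "\<epsilon> / 2"] Suc.prems(3) by auto
  have B0: "B0 \<in> sets M" and g0: "g0 \<in> unit_ball (dual F)" "g0 \<in> vcarrier (dual F)" and f0: "f0 \<in> unit_functions"
    and f00: "\<And>t. t \<notin> B0 \<Longrightarrow> f0 t = 0" and f0r: "r - \<epsilon> / 2 < pullback g0 (ae_class M f0) \<bullet> 1"
    using 0(2) by (auto simp: bump_def unit_ball_def)
  have f0b: "f0 \<in> bounded_measurable M" and f01: "\<And>t. norm (f0 t) \<le> 1" using f0 by (auto simp: unit_functions_def)
  let ?v = "variation M (pullback g0)"
  have pg: "pullback g0 \<in> vcarrier (dual (L_infty M))" using g0(2) by (rule pullback_dual)
  interpret v: charge M ?v by (rule charge_variation[OF pg])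
  have ch: "charge M (\<lambda>u. \<mu> u + ?v u)" by (intro charge_add \<mu>.charge_axioms v.charge_axioms)
  define \<delta>' where "\<delta>' = min \<delta> (\<epsilon> / (2 * (real N + 1)))"
  have \<delta>': "\<delta>' > 0" using Suc.prems by (simp add: \<delta>'_def)
  obtain B g f where IH: "\<And>i. i < N \<Longrightarrow> B i \<subseteq> A" "\<And>i. i < N \<Longrightarrow> bump (B i) (g i) (f i) (r - \<epsilon>)"
    "\<And>i. i < N \<Longrightarrow> \<mu> (indicator (B i)) + ?v (indicator (B i)) < \<delta>'" "disjoint_family_on B {..<N}"
    using Suc.IH[OF ch \<delta>' Suc.prems(3)] by blast
  have Bm: "B i \<in> sets M" if "i < N" for i using IH(2)[OF that] by (simp add: bump_def)
  define U where "U = (\<Union>i<N. B i)"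
  have U: "U \<in> sets M" unfolding U_def using Bm by (intro sets.finite_UN) auto
  have v_le: "?v (indicator (B i)) \<le> \<epsilon> / (2 * (real N + 1))" and \<mu>_le: "\<mu> (indicator (B i)) < \<delta>" if "i < N" for i
    using IH(3)[OF that] \<mu>.nonneg[OF nonneg_bounded_indicator[OF Bm[OF that]]]
      v.nonneg[OF nonneg_bounded_indicator[OF Bm[OF that]]] by (auto simp: \<delta>'_def)
  have "?v (indicator U) \<le> (\<Sum>i<N. ?v (indicator (B i)))" unfolding U_def by (rule v.indicator_Union_le[OF Bm])
  also have "\<dots> \<le> (\<Sum>i<N. \<epsilon> / (2 * (real N + 1)))" using v_le by (intro sum_mono) auto
  also have "\<dots> \<le> \<epsilon> / 2" using Suc.prems(3) by (simp add: field_simps)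
  finally have vU: "?v (indicator U) \<le> \<epsilon> / 2" .
  define B0' where "B0' = B0 - U"
  let ?f = "\<lambda>t. indicator B0' t *\<^sub>R f0 t" and ?d = "\<lambda>t. indicator U t *\<^sub>R f0 t"
  have B0': "B0' \<in> sets M" using B0 U by (auto simp: B0'_def)
  have split: "f0 = (\<lambda>t. ?f t + ?d t)" using f00 by (auto simp: B0'_def indicator_def)
  have "pullback g0 (ae_class M f0) = pullback g0 (ae_class M ?f) + pullback g0 (ae_class M ?d)"
    using functional_class_add[OF pg restrict_bounded[OF B0' f0b] restrict_bounded[OF U f0b]] split by simp
  moreover have "norm (pullback g0 (ae_class M ?d)) \<le> ?v (indicator U)"
    using f01 by (intro variation_upper[OF pg] nonneg_bounded_indicator U restrict_bounded f0b) (auto simp: indicator_def)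
  moreover have "pullback g0 (ae_class M ?d) \<bullet> 1 \<le> norm (pullback g0 (ae_class M ?d))" by (rule re_le_norm)
  ultimately have "r - \<epsilon> < pullback g0 (ae_class M ?f) \<bullet> 1"
    using f0r vU by (simp add: inner_add_left)
  then have bump0: "bump B0' g0 ?f (r - \<epsilon>)"
    unfolding bump_def using B0' g0 restrict_unit[OF B0' f0] by auto
  have \<mu>0: "\<mu> (indicator B0') < \<delta>"
    using 0(3) \<mu>.mono[OF nonneg_bounded_indicator[OF B0'] nonneg_bounded_indicator[OF B0]]
    by (fastforce simp: B0'_def indicator_def)
  have dj: "x \<notin> B i" if "i < N" "x \<in> B0'" for i x using that by (auto simp: B0'_def U_def)
  have dj': "x \<notin> B j" if "i < N" "j < N" "i \<noteq> j" "x \<in> B i" for i j x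
    using IH(4) that unfolding disjoint_family_on_def by blast
  show ?case
  proof (intro exI[of _ "B(N := B0')"] exI[of _ "g(N := g0)"] exI[of _ "f(N := ?f)"] conjI allI impI)
    fix i assume "i < Suc N"
    then have "i = N \<or> i < N" by auto
    then show "(B(N := B0')) i \<subseteq> A" "bump ((B(N := B0')) i) ((g(N := g0)) i) ((f(N := ?f)) i) (r - \<epsilon>)"
      "\<mu> (indicator ((B(N := B0')) i)) < \<delta>"
      using IH(1,2) \<mu>_le bump0 \<mu>0 0(1) by (auto simp: B0'_def)
  next
    show "disjoint_family_on (B(N := B0')) {..<Suc N}"
      unfolding disjoint_family_on_def
    proof (intro ballI impI)
      fix m n assume mn: "m \<in> {..<Suc N}" "n \<in> {..<Suc N}" "m \<noteq> n"
      then consider "m = N" "n < N" | "n = N" "m < N" | "m < N" "n < N" by fastforce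
      then show "(B(N := B0')) m \<inter> (B(N := B0')) n = {}"
      proof cases
        case 1 then show ?thesis using dj[of n] by auto
      next
        case 2 then show ?thesis using dj[of m] by auto
      next
        case 3 then show ?thesis using dj'[of m n] mn(3) by auto
      qed
    qed
  qed
qed

text \<open>
  This passes from finite families to sequences. Take \<open>N\<close> disjoint bumps with \<open>bound \<le> \<epsilon> N\<close>. If the
  operator were dominated at level \<open>r - \<epsilon>\<close> on the complement of each \<open>B i\<close>, then averaging the
  identity \<open>N f = (\<Sum>i. f 1\<^bsub>A - B i\<^esub>) + f 1\<^sub>U\<close>, where \<open>U\<close> is the union of the \<open>B i\<close>, would dominate it on
  \<open>A\<close> at level \<open>r - \<epsilon> + bound / N \<le> r\<close>. So one of the bumps can be removed without destroying the
  failure of domination.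
\<close>

lemma bump_with_bad_complement:
  assumes A: "A \<in> sets M" and bad: "\<not> dominated_on A r" and \<mu>: "charge M \<mu>" and \<delta>: "\<delta> > 0" and \<epsilon>: "\<epsilon> > 0"
  obtains B g f where "B \<subseteq> A" "bump B g f (r - \<epsilon>)" "\<mu> (indicator B) < \<delta>" "\<not> dominated_on (A - B) (r - \<epsilon>)"
proof -
  obtain N :: nat where "bound / \<epsilon> < real N" using reals_Archimedean2 by blast
  then have N: "bound \<le> \<epsilon> * N" "N > 0"
    using \<epsilon> bound_nonneg by (auto simp: field_simps intro: Nat.gr0I)
  obtain B g f where B: "\<And>i. i < N \<Longrightarrow> B i \<subseteq> A" "\<And>i. i < N \<Longrightarrow> bump (B i) (g i) (f i) (r - \<epsilon>)"
    "\<And>i. i < N \<Longrightarrow> \<mu> (indicator (B i)) < \<delta>" "disjoint_family_on B {..<N}"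
    using disjoint_bumps_exist[OF A bad \<mu> \<delta> \<epsilon>, of N] by blast
  have Bm: "B i \<in> sets M" if "i < N" for i using B(2)[OF that] by (simp add: bump_def)
  have "\<exists>i<N. \<not> dominated_on (A - B i) (r - \<epsilon>)"
  proof (rule ccontr)
    assume "\<not> ?thesis"
    then have "\<forall>i. i < N \<longrightarrow> (\<exists>\<mu>. charge M \<mu> \<and> (\<forall>f\<in>unit_functions.
        image_norm (\<lambda>t. indicator (A - B i) t *\<^sub>R f t) \<le> \<mu> (\<lambda>t. norm (f t)) + (r - \<epsilon>)))"
      unfolding dominated_on_def by blast
    then obtain \<nu> where \<nu>: "\<And>i. i < N \<Longrightarrow> charge M (\<nu> i)"
      "\<And>i f. i < N \<Longrightarrow> f \<in> unit_functions \<Longrightarrow>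
        image_norm (\<lambda>t. indicator (A - B i) t *\<^sub>R f t) \<le> \<nu> i (\<lambda>t. norm (f t)) + (r - \<epsilon>)" by metis
    define U where "U = (\<Union>i<N. B i)"
    have U: "U \<in> sets M" unfolding U_def using Bm by (intro sets.finite_UN) auto
    have "dominated_on A r" unfolding dominated_on_def
    proof (intro exI conjI ballI)
      show "charge M (\<lambda>u. inverse (real N) * (\<Sum>i<N. \<nu> i u))"
        by (intro charge_cmult charge_sum \<nu>) auto
      fix f assume f: "f \<in> unit_functions"
      have fb: "f \<in> bounded_measurable M" and f1: "\<And>t. norm (f t) \<le> 1" using f by (auto simp: unit_functions_def)
      have pt: "of_real (real N) * (indicator A t *\<^sub>R f t)
          = (\<Sum>i<N. indicator (A - B i) t *\<^sub>R f t) + indicator U t *\<^sub>R f t" for t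
      proof -
        have "(\<Sum>i<N. indicator (A - B i) t) = (\<Sum>i<N. indicator A t - (indicator (B i) t :: real))"
          using B(1) by (intro sum.cong) (auto simp: indicator_def)
        also have "\<dots> = real N * indicator A t - indicator U t"
          unfolding U_def indicator_UN_disjoint[OF finite_lessThan B(4)] by (simp add: sum_subtractf)
        finally have "real N * indicator A t = (\<Sum>i<N. indicator (A - B i) t) + (indicator U t :: real)" by simp
        then have "(real N * indicator A t) *\<^sub>R f t = (\<Sum>i<N. indicator (A - B i) t *\<^sub>R f t) + indicator U t *\<^sub>R f t"
          by (simp add: scaleR_add_left scaleR_left.sum)
        then show ?thesis by (simp add: scaleR_conv_of_real mult.assoc)
      qed
      have rb: "(\<lambda>t. indicator (A - B i) t *\<^sub>R f t) \<in> bounded_measurable M" if "i < N" for i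
        using A Bm[OF that] fb by (intro restrict_bounded) auto
      have "real N * image_norm (\<lambda>t. indicator A t *\<^sub>R f t)
          = image_norm (\<lambda>t. of_real (real N) * (indicator A t *\<^sub>R f t))"
        using image_norm_cmult[OF restrict_bounded[OF A fb], of "of_real (real N)"] unfolding norm_of_real by simp
      also have "\<dots> \<le> image_norm (\<lambda>t. \<Sum>i<N. indicator (A - B i) t *\<^sub>R f t) + image_norm (\<lambda>t. indicator U t *\<^sub>R f t)"
        unfolding pt using image_norm_sum[of N "\<lambda>i t. indicator (A - B i) t *\<^sub>R f t"] rb
        by (intro image_norm_add restrict_bounded U fb) auto
      also have "\<dots> \<le> (\<Sum>i<N. \<nu> i (\<lambda>t. norm (f t)) + (r - \<epsilon>)) + bound * 1"
      proof (rule add_mono)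
        show "image_norm (\<lambda>t. \<Sum>i<N. indicator (A - B i) t *\<^sub>R f t) \<le> (\<Sum>i<N. \<nu> i (\<lambda>t. norm (f t)) + (r - \<epsilon>))"
          using image_norm_sum[of N "\<lambda>i t. indicator (A - B i) t *\<^sub>R f t"] rb
            sum_mono[of "{..<N}" "\<lambda>i. image_norm (\<lambda>t. indicator (A - B i) t *\<^sub>R f t)" "\<lambda>i. \<nu> i (\<lambda>t. norm (f t)) + (r - \<epsilon>)"] \<nu>(2) f
          by fastforce
        show "image_norm (\<lambda>t. indicator U t *\<^sub>R f t) \<le> bound * 1"
          using f1 by (intro image_norm_le restrict_bounded U fb) (auto simp: indicator_def)
      qed
      also have "\<dots> \<le> (\<Sum>i<N. \<nu> i (\<lambda>t. norm (f t))) + real N * r"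
      proof -
        have "(\<Sum>i<N. \<nu> i (\<lambda>t. norm (f t)) + (r - \<epsilon>))
            = (\<Sum>i<N. \<nu> i (\<lambda>t. norm (f t))) + real N * (r - \<epsilon>)" by (simp only: sum.distrib) simp
        then show ?thesis using N by (simp add: right_diff_distrib mult.commute)
      qed
      finally show "image_norm (\<lambda>t. indicator A t *\<^sub>R f t) \<le> inverse (real N) * (\<Sum>i<N. \<nu> i (\<lambda>t. norm (f t))) + r"
        using N(2) by (simp add: field_simps)
    qed
    then show False using bad by blast
  qed
  then obtain i where "i < N" "\<not> dominated_on (A - B i) (r - \<epsilon>)" by blast
  then show ?thesis using that[of "B i" "g i" "f i"] B by blast
qed

text \<open>
  Iterate \<open>bump_with_bad_complement\<close>, losing \<open>\<epsilon> 2\<^sup>-\<^sup>n\<close> of the level in step \<open>n\<close> and adding the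
  variation of each new pullback to the charge that controls the later sets.
\<close>

lemma disjoint_bump_sequence:
  assumes bad: "\<not> dominated_on (space M) r" and \<epsilon>: "\<epsilon> > 0"
  obtains B g f where "\<And>n::nat. bump (B n) (g n) (f n) (r - \<epsilon>)" "\<And>m n. m < n \<Longrightarrow> B m \<inter> B n = {}"
    "\<And>m n. m < n \<Longrightarrow> variation M (pullback (g m)) (indicator (B n)) < \<epsilon> * (1/2)^n"
proof -
  define lev where "lev = (\<lambda>n::nat. r - \<epsilon> * (1 - (1/2)^n))"
  define P where "P = (\<lambda>n (A, B::'x set, g::'b\<Rightarrow>'k, f::'x\<Rightarrow>'k, \<mu>). A \<in> sets M \<and> \<not> dominated_on A (lev n) \<and> charge M \<mu>)"
  define Q where "Q = (\<lambda>n (A, B::'x set, g::'b\<Rightarrow>'k, f::'x\<Rightarrow>'k, \<mu>::('x\<Rightarrow>real)\<Rightarrow>real) (A', B', g', f', \<mu>').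
     B' \<subseteq> A \<and> A' = A - B' \<and> bump B' g' f' (r - \<epsilon>) \<and> \<mu> (indicator B') < \<epsilon> * (1/2)^n \<and>
     \<mu>' = (\<lambda>u. \<mu> u + variation M (pullback g') u))"
  have "\<exists>s. \<forall>n. P n (s n) \<and> Q n (s n) (s (Suc n))"
  proof (rule dependent_nat_choice)
    \<comment> \<open>the components B, g and f of the initial state are arbitrary: the sequence starts with the state after it\<close>
    show "\<exists>x. P 0 x"
      using bad by (intro exI[of _ "(space M, {}, undefined, undefined, \<lambda>_. 0)"]) (simp add: P_def lev_def charge_zero)
    fix x n assume Px: "P n x"
    obtain A B g f \<mu> where x: "x = (A, B, g, f, \<mu>)" by (metis prod_cases5)
    have A: "A \<in> sets M" and bA: "\<not> dominated_on A (lev n)" and \<mu>: "charge M \<mu>" using Px by (auto simp: P_def x)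
    have e: "\<epsilon> * (1/2)^(Suc n) > 0" "\<epsilon> * (1/2)^n > 0" using \<epsilon> by auto
    obtain B' g' f' where B': "B' \<subseteq> A" "bump B' g' f' (lev n - \<epsilon> * (1/2)^(Suc n))" "\<mu> (indicator B') < \<epsilon> * (1/2)^n"
      "\<not> dominated_on (A - B') (lev n - \<epsilon> * (1/2)^(Suc n))"
      using bump_with_bad_complement[OF A bA \<mu> e(2,1)] by blast
    have lev: "lev n - \<epsilon> * (1/2)^(Suc n) = lev (Suc n)" by (simp add: lev_def algebra_simps)
    have "r - \<epsilon> \<le> lev (Suc n)" using \<epsilon> by (simp add: lev_def algebra_simps)
    then have b: "bump B' g' f' (r - \<epsilon>)" using B'(2) unfolding lev bump_def by auto
    have "charge M (\<lambda>u. \<mu> u + variation M (pullback g') u)"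
      using b by (intro charge_add \<mu> charge_variation pullback_dual) (auto simp: bump_def unit_ball_def)
    then show "\<exists>y. P (Suc n) y \<and> Q n x y"
      using A B' b unfolding lev
      by (intro exI[of _ "(A - B', B', g', f', \<lambda>u. \<mu> u + variation M (pullback g') u)"])
        (auto simp: P_def Q_def x bump_def)
  qed
  then obtain s where s: "\<And>n. P n (s n)" "\<And>n. Q n (s n) (s (Suc n))" by blast
  define A where "A = (\<lambda>n. fst (s n))"
  define B where "B = (\<lambda>n. fst (snd (s n)))"
  define g where "g = (\<lambda>n. fst (snd (snd (s n))))"
  define f where "f = (\<lambda>n. fst (snd (snd (snd (s n)))))"
  define \<mu> where "\<mu> = (\<lambda>n. snd (snd (snd (snd (s n)))))"
  have sn: "s n = (A n, B n, g n, f n, \<mu> n)" for n by (simp add: A_def B_def g_def f_def \<mu>_def)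
  have q: "B (Suc n) \<subseteq> A n" "A (Suc n) = A n - B (Suc n)" "bump (B (Suc n)) (g (Suc n)) (f (Suc n)) (r - \<epsilon>)"
    "\<mu> n (indicator (B (Suc n))) < \<epsilon> * (1/2)^n"
    "\<mu> (Suc n) = (\<lambda>u. \<mu> n u + variation M (pullback (g (Suc n))) u)" for n
    using s(2)[of n] unfolding sn Q_def by auto
  have ch: "charge M (\<mu> n)" for n using s(1)[of n] unfolding sn P_def by auto
  have gd: "g (Suc n) \<in> vcarrier (dual F)" for n using q(3)[of n] by (simp add: bump_def unit_ball_def)
  have Bm: "B (Suc n) \<in> sets M" for n using q(3)[of n] by (simp add: bump_def)
  have var_nonneg: "0 \<le> variation M (pullback (g (Suc m))) u" if "u \<in> nonneg_bounded M" for m u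
    using charge.nonneg[OF charge_variation[OF pullback_dual[OF gd]] that] .
  have decA: "A (m + k) \<subseteq> A m" for m k by (induction k) (use q(2) in auto)
  have dj: "B (Suc m) \<inter> B (Suc n) = {}" if mn: "m < n" for m n
  proof -
    obtain k where k: "n = Suc m + k" using mn less_iff_Suc_add[of m n] by auto
    have "B (Suc n) \<subseteq> A n" by (rule q(1))
    also have "\<dots> \<subseteq> A (Suc m)" unfolding k by (rule decA)
    finally show ?thesis using q(2)[of m] by blast
  qed
  have var_le: "variation M (pullback (g (Suc m))) u \<le> \<mu> (Suc m + k) u" if u: "u \<in> nonneg_bounded M" for m k u
  proof (induction k)
    case 0 then show ?case using charge.nonneg[OF ch u] q(5)[of m] by simp
  next
    case (Suc k) then show ?case using var_nonneg[OF u, of "Suc m + k"] q(5)[of "Suc m + k"] by simp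
  qed
  show ?thesis
  proof (rule that[of "\<lambda>n. B (Suc n)" "\<lambda>n. g (Suc n)" "\<lambda>n. f (Suc n)"])
    show "bump (B (Suc n)) (g (Suc n)) (f (Suc n)) (r - \<epsilon>)" for n by (rule q(3))
    fix m n :: nat assume mn: "m < n"
    show "B (Suc m) \<inter> B (Suc n) = {}" using mn by (rule dj)
    obtain k where k: "n = Suc m + k" using mn less_iff_Suc_add[of m n] by auto
    have "variation M (pullback (g (Suc m))) (indicator (B (Suc n))) \<le> \<mu> n (indicator (B (Suc n)))"
      using var_le[OF nonneg_bounded_indicator[OF Bm[of n]], of m k] by (simp add: k)
    then show "variation M (pullback (g (Suc m))) (indicator (B (Suc n))) < \<epsilon> * (1/2)^n"
      using q(4)[of n] by linarith
  qed
qed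

end

section \<open>The residuum operator of an operator that is not dominated\<close>

text \<open>
  Otherwise every \<open>h\<close> has a neighbourhood that the sequence leaves for good; finitely many of them
  cover the compact dual ball, so the sequence would leave the ball.
\<close>

lemma dual_ball_cluster_point:
  assumes E: "seminormed_space E" and g: "\<And>n::nat. g n \<in> unit_ball (dual E)"
  obtains h where "h \<in> unit_ball (dual E)"
    "\<And>Y e m. \<lbrakk>finite Y; Y \<subseteq> vcarrier E; e > 0\<rbrakk> \<Longrightarrow> \<exists>n\<ge>m. \<forall>y\<in>Y. norm (g n y - h y) < e"
proof -
  let ?K = "unit_ball (dual E)" and ?P = "pointwise_topology E"
  have K: "compactin ?P ?K" using E by (rule banach_alaoglu)
  define near where "near = (\<lambda>h Y e m. \<exists>n\<ge>m. \<forall>y\<in>Y. norm (g n y - h y) < e)"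
  define bad where "bad = (\<lambda>h. \<exists>Y e m. finite Y \<and> Y \<subseteq> vcarrier E \<and> e > 0 \<and> \<not> near h Y e m)"
  have "\<exists>h\<in>?K. \<not> bad h"
  proof (rule ccontr)
    assume "\<not> ?thesis"
    then have "\<forall>h\<in>?K. bad h" by blast
    then have "\<forall>h\<in>?K. \<exists>Y e m. finite Y \<and> Y \<subseteq> vcarrier E \<and> e > 0 \<and> \<not> near h Y e m"
      unfolding bad_def .
    then obtain Y e m where Yem: "\<And>h. h \<in> ?K \<Longrightarrow> finite (Y h)" "\<And>h. h \<in> ?K \<Longrightarrow> Y h \<subseteq> vcarrier E"
      "\<And>h. h \<in> ?K \<Longrightarrow> e h > 0" "\<And>h. h \<in> ?K \<Longrightarrow> \<not> near h (Y h) (e h) (m h)"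
      by metis
    define U where "U = (\<lambda>h. (\<Inter>y\<in>Y h. {f \<in> topspace ?P. f y \<in> ball (h y) (e h)}) \<inter> topspace ?P)"
    have open_U: "openin ?P (U h)" if h: "h \<in> ?K" for h
    proof -
      have "openin ?P {f \<in> topspace ?P. f y \<in> ball (h y) (e h)}" if y: "y \<in> Y h" for y
        using Yem(2)[OF h] y
        by (intro openin_continuous_map_preimage[OF continuous_map_evaluation]) auto
      then show ?thesis unfolding U_def by (rule openin_INT[OF Yem(1)[OF h]])
    qed
    have KP: "?K \<subseteq> topspace ?P" using K by (rule compactin_subset_topspace)
    have "h \<in> U h" if "h \<in> ?K" for h using that KP Yem(3)[OF that] by (auto simp: U_def)
    then have "\<exists>\<F>. finite \<F> \<and> \<F> \<subseteq> U ` ?K \<and> ?K \<subseteq> \<Union>\<F>"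
      using compactinD[OF K, of "U ` ?K"] open_U by blast
    then obtain H where H: "finite H" "H \<subseteq> ?K" "?K \<subseteq> (\<Union>h\<in>H. U h)" by (metis finite_subset_image)
    define N where "N = (\<Sum>h\<in>H. m h)"
    have "g N \<in> (\<Union>h\<in>H. U h)" using g H(3) by blast
    then obtain h where h: "h \<in> H" "g N \<in> U h" by blast
    have "m h \<le> N" unfolding N_def using H(1) h(1) by (intro member_le_sum) auto
    then obtain y where y: "y \<in> Y h" "\<not> norm (g N y - h y) < e h"
      using Yem(4)[of h] h(1) H(2) unfolding near_def by blast
    then show False using h(2) by (auto simp: U_def dist_norm norm_minus_commute)
  qed
  then obtain h where h: "h \<in> ?K" "\<not> bad h" by blast
  show ?thesis
  proof (rule that[OF h(1)])
    fix Y e m assume Y: "finite Y" "Y \<subseteq> vcarrier E" "(e::real) > 0"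
    show "\<exists>n\<ge>m. \<forall>y\<in>Y. norm (g n y - h y) < e"
    proof (rule ccontr)
      assume "\<not> ?thesis"
      then have "\<not> near h Y e m" unfolding near_def .
      then have "bad h" unfolding bad_def using Y by (intro exI conjI)
      then show False using h(2) by simp
    qed
  qed
qed

context L_infty_operator
begin

text \<open>
  Passing to a subsequence makes \<open>g\<^sub>n(T f\<^sub>m)\<close> almost independent of \<open>n > m\<close>: first compare with a
  cluster point \<open>h0\<close> of the whole sequence, then pass to a cluster point \<open>h\<close> of the subsequence. The
  second one is needed because the subsequence need not accumulate at \<open>h0\<close>; on the vectors
  \<open>T f\<^sub>m\<close> both agree.
\<close>

lemma interpolating_sequence:
  assumes bad: "\<not> dominated_on (space M) r" and \<epsilon>: "\<epsilon> > 0"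
  obtains B g f h where "\<And>n::nat. bump (B n) (g n) (f n) (r - \<epsilon>)" "\<And>m n. m \<noteq> n \<Longrightarrow> B m \<inter> B n = {}"
    "\<And>m n. m < n \<Longrightarrow> norm (pullback (g m) (ae_class M (f n))) \<le> \<epsilon> * (1/2)^n"
    "\<And>m n. m < n \<Longrightarrow> norm (pullback (g n) (ae_class M (f m)) - pullback h (ae_class M (f m))) \<le> \<epsilon> * (1/2)^n"
    "h \<in> unit_ball (dual F)"
    "\<And>y e m. \<lbrakk>y \<in> vcarrier F; e > 0\<rbrakk> \<Longrightarrow> \<exists>n\<ge>m. norm (g n y - h y) < e"
proof -
  obtain B g f where B: "\<And>n::nat. bump (B n) (g n) (f n) (r - \<epsilon>)" "\<And>m n. m < n \<Longrightarrow> B m \<inter> B n = {}"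
    "\<And>m n. m < n \<Longrightarrow> variation M (pullback (g m)) (indicator (B n)) < \<epsilon> * (1/2)^n"
    using disjoint_bump_sequence[OF bad \<epsilon>] by blast
  have gb: "g n \<in> unit_ball (dual F)" and Bm: "B n \<in> sets M" and fb: "f n \<in> bounded_measurable M"
    and f1: "norm (f n t) \<le> 1" and f0: "t \<notin> B n \<Longrightarrow> f n t = 0" for n t
    using B(1)[of n] by (auto simp: bump_def unit_functions_def)
  have gd: "g n \<in> vcarrier (dual F)" for n using gb[of n] by (simp add: unit_ball_def)
  define y where "y = (\<lambda>n. T (ae_class M (f n)))"
  have yF: "y n \<in> vcarrier F" for n unfolding y_def by (rule bops_closed[OF T class_closed[OF fb]])
  have pb: "pullback u (ae_class M (f n)) = u (y n)" if "u \<in> vcarrier (dual F)" for u n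
    unfolding y_def by (rule pullback_apply[OF that class_closed[OF fb]])
  obtain h0 where h0: "h0 \<in> unit_ball (dual F)"
    "\<And>Y e m. \<lbrakk>finite Y; Y \<subseteq> vcarrier F; e > 0\<rbrakk> \<Longrightarrow> \<exists>n\<ge>m. \<forall>y\<in>Y. norm (g n y - h0 y) < e"
    by (rule dual_ball_cluster_point[OF F, of g, OF gb]) (rule that; (assumption | blast))
  have "\<exists>s. \<forall>n. True \<and> (s n < s (Suc n) \<and> (\<forall>i\<le>s n. norm (g (s (Suc n)) (y i) - h0 (y i)) < \<epsilon> * (1/2)^(Suc n)))"
  proof (rule dependent_nat_choice)
    fix k n :: nat
    have "\<exists>j\<ge>Suc k. \<forall>z\<in>y ` {..k}. norm (g j z - h0 z) < \<epsilon> * (1/2)^(Suc n)"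
      using yF \<epsilon> by (intro h0(2)) auto
    then show "\<exists>j. True \<and> (k < j \<and> (\<forall>i\<le>k. norm (g j (y i) - h0 (y i)) < \<epsilon> * (1/2)^(Suc n)))"
      by (auto simp: Suc_le_eq)
  qed simp
  then obtain s where s: "\<And>n. s n < s (Suc n)"
    "\<And>n i. i \<le> s n \<Longrightarrow> norm (g (s (Suc n)) (y i) - h0 (y i)) < \<epsilon> * (1/2)^(Suc n)" by blast
  have sm: "strict_mono s" using s(1) by (simp add: strict_mono_Suc_iff)
  have s_ge: "n \<le> s n" for n using sm by (rule strict_mono_imp_increasing)
  have conv: "norm (g (s n) (y (s m)) - h0 (y (s m))) < \<epsilon> * (1/2)^n" if mn: "m < n" for m n
  proof -
    obtain k where k: "n = Suc k" using mn by (cases n) auto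
    have "s m \<le> s k" using mn k sm by (simp add: strict_mono_less_eq)
    then show ?thesis unfolding k by (rule s(2))
  qed
  obtain h where h: "h \<in> unit_ball (dual F)"
    "\<And>Y e m. \<lbrakk>finite Y; Y \<subseteq> vcarrier F; e > 0\<rbrakk> \<Longrightarrow> \<exists>n\<ge>m. \<forall>y\<in>Y. norm (g (s n) y - h y) < e"
    by (rule dual_ball_cluster_point[OF F, of "\<lambda>n. g (s n)", OF gb]) (rule that; (assumption | blast))
  have hd: "h \<in> vcarrier (dual F)" using h(1) by (simp add: unit_ball_def)
  have h_eq: "h (y (s m)) = h0 (y (s m))" for m
  proof -
    have le: "norm (h (y (s m)) - h0 (y (s m))) \<le> e" if e: "e > 0" for e
    proof -
      obtain N where N: "(1/2)^N < e / (2 * \<epsilon>)" using real_arch_pow_inv[of "e / (2 * \<epsilon>)" "1/2"] e \<epsilon> by auto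
      obtain n where n: "n \<ge> max N (Suc m)" "norm (g (s n) (y (s m)) - h (y (s m))) < e / 2"
        using h(2)[of "{y (s m)}" "e / 2" "max N (Suc m)"] yF e by auto
      have "(1/2::real)^n \<le> (1/2)^N" using n(1) by (intro power_decreasing) auto
      then have "(1/2::real)^n < e / (2 * \<epsilon>)" using N by linarith
      then have "\<epsilon> * (1/2)^n < e / 2" using \<epsilon> by (simp add: field_simps)
      moreover have "norm (g (s n) (y (s m)) - h0 (y (s m))) < \<epsilon> * (1/2)^n" using n(1) by (intro conv) auto
      ultimately show ?thesis
        using n(2) norm_triangle_ineq4[of "g (s n) (y (s m)) - h0 (y (s m))" "g (s n) (y (s m)) - h (y (s m))"]
        by simp
    qed
    have "norm (h (y (s m)) - h0 (y (s m))) \<le> 0"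
    proof (rule field_le_epsilon)
      show "norm (h (y (s m)) - h0 (y (s m))) \<le> 0 + e" if "e > 0" for e using le[OF that] by simp
    qed
    then show ?thesis by simp
  qed
  show ?thesis
  proof (rule that[of "\<lambda>n. B (s n)" "\<lambda>n. g (s n)" "\<lambda>n. f (s n)" h])
    show "bump (B (s n)) (g (s n)) (f (s n)) (r - \<epsilon>)" for n by (rule B(1))
    show "B (s m) \<inter> B (s n) = {}" if "m \<noteq> n" for m n
    proof -
      have "s m \<noteq> s n" using that sm by (simp add: strict_mono_eq)
      then consider "s m < s n" | "s n < s m" by linarith
      then show ?thesis using B(2) by cases blast+
    qed
    show "norm (pullback (g (s m)) (ae_class M (f (s n)))) \<le> \<epsilon> * (1/2)^n" if mn: "m < n" for m n
    proof -
      have "norm (pullback (g (s m)) (ae_class M (f (s n)))) \<le> variation M (pullback (g (s m))) (indicator (B (s n)))"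
        using f1 f0 by (intro variation_upper[OF pullback_dual[OF gd]] nonneg_bounded_indicator Bm fb)
          (auto simp: indicator_def)
      also have "\<dots> < \<epsilon> * (1/2)^(s n)" using mn sm by (intro B(3)) (simp add: strict_mono_less)
      also have "\<dots> \<le> \<epsilon> * (1/2)^n" using \<epsilon> s_ge[of n] by (intro mult_left_mono power_decreasing) auto
      finally show ?thesis by simp
    qed
    show "norm (pullback (g (s n)) (ae_class M (f (s m))) - pullback h (ae_class M (f (s m)))) \<le> \<epsilon> * (1/2)^n"
      if mn: "m < n" for m n
      using conv[OF mn] by (simp add: pb[OF gd] pb[OF hd] h_eq)
    show "h \<in> unit_ball (dual F)" by (rule h(1))
    show "\<exists>n\<ge>m. norm (g (s n) z - h z) < e" if "z \<in> vcarrier F" "e > 0" for z e m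
      using h(2)[of "{z}" e m] that by auto
  qed
qed

text \<open>
  At each point at most one summand is nonzero, so each of these functions takes a value of some
  \<open>f\<^sub>k\<close> up to a factor of modulus at most one; for the second one the factor is \<open>1\<close> or \<open>-1\<close>.
\<close>

lemma disjoint_series:
  fixes B :: "nat \<Rightarrow> 'x set" and f :: "nat \<Rightarrow> 'x \<Rightarrow> 'k"
  assumes f: "\<And>n. f n \<in> unit_functions" and f0: "\<And>n t. t \<notin> B n \<Longrightarrow> f n t = 0"
    and dj: "\<And>m n. m \<noteq> n \<Longrightarrow> B m \<inter> B n = {}"
  obtains G where "G \<in> unit_functions"
    "\<And>m. (\<lambda>t. (\<Sum>k<m. 2 * f k t) - G t) \<in> unit_functions"
    "\<And>m c. (\<And>k. norm (c k :: 'k) \<le> 1) \<Longrightarrow> (\<lambda>t. \<Sum>k<m. c k * f k t) \<in> unit_functions"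
proof -
  have fm: "f n \<in> borel_measurable M" and f1: "norm (f n t) \<le> 1" for n t
    using f[of n] by (auto simp: unit_functions_def bounded_measurableD)
  have unitI: "h \<in> unit_functions" if "h \<in> borel_measurable M" "\<And>t. norm (h t) \<le> 1" for h
    using that by (auto simp: unit_functions_def intro: bounded_measurableI)
  define G where "G = (\<lambda>t. if \<exists>k. t \<in> B k then f (SOME k. t \<in> B k) t else 0)"
  have single: "f j t = (if j = k then f k t else 0)" if "t \<in> B k" for j k t
    using that f0[of t j] dj[of j k] by auto
  have G_in: "G t = f k t" if t: "t \<in> B k" for t k
  proof -
    have "t \<in> B (SOME k. t \<in> B k)" using t by (rule someI)
    then have "(SOME k. t \<in> B k) = k" using dj[of "SOME k. t \<in> B k" k] t by auto
    then show ?thesis using t by (auto simp: G_def)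
  qed
  have G_out: "G t = 0" if "\<And>k. t \<notin> B k" for t using that by (simp add: G_def)
  have sum_in: "(\<Sum>j<m. c j * f j t) = (if k < m then c k * f k t else 0)" if t: "t \<in> B k" for t k m and c :: "nat \<Rightarrow> 'k"
  proof -
    have "(\<Sum>j<m. c j * f j t) = (\<Sum>j<m. if j = k then c k * f k t else 0)"
    proof (rule sum.cong[OF refl])
      show "c j * f j t = (if j = k then c k * f k t else 0)" for j
        using single[OF t, of j] by (cases "j = k") simp_all
    qed
    then show ?thesis by (simp add: sum.delta)
  qed
  have sum_out: "(\<Sum>j<m. c j * f j t) = 0" if "\<And>k. t \<notin> B k" for t m and c :: "nat \<Rightarrow> 'k"
    using that f0 by (simp add: sum.neutral)
  have G_lim: "(\<lambda>m. \<Sum>j<m. 1 * f j t) \<longlonglongrightarrow> G t" for t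
  proof (cases "\<exists>k. t \<in> B k")
    case True
    then obtain k where k: "t \<in> B k" by blast
    have "\<forall>\<^sub>F m in sequentially. (\<Sum>j<m. 1 * f j t) = G t"
      using eventually_gt_at_top[of k] by eventually_elim (use sum_in[OF k, of "\<lambda>_. 1"] G_in[OF k] in simp)
    then show ?thesis by (rule tendsto_eventually)
  next
    case False
    then show ?thesis using sum_out[of t "\<lambda>_. 1"] G_out[of t] by simp
  qed
  have Gm: "G \<in> borel_measurable M"
    by (rule borel_measurable_LIMSEQ_metric[OF _ G_lim]) (use fm in measurable)
  have G1: "norm (G t) \<le> 1" for t by (simp add: G_def f1)
  show ?thesis
  proof (rule that)
    show "G \<in> unit_functions" using Gm G1 by (rule unitI)
    show "(\<lambda>t. \<Sum>k<m. c k * f k t) \<in> unit_functions" if c: "\<And>k. norm (c k) \<le> 1" for m and c :: "nat \<Rightarrow> 'k"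
    proof (rule unitI)
      show "(\<lambda>t. \<Sum>k<m. c k * f k t) \<in> borel_measurable M" using fm by measurable
      show "norm (\<Sum>k<m. c k * f k t) \<le> 1" for t
      proof (cases "\<exists>k. t \<in> B k")
        case True
        then obtain k where "t \<in> B k" by blast
        then show ?thesis using c[of k] f1[of k t] by (simp add: sum_in norm_mult mult_le_one)
      next
        case False then show ?thesis by (simp add: sum_out)
      qed
    qed
    show "(\<lambda>t. (\<Sum>k<m. 2 * f k t) - G t) \<in> unit_functions" for m
    proof (rule unitI)
      show "(\<lambda>t. (\<Sum>k<m. 2 * f k t) - G t) \<in> borel_measurable M" using fm Gm by measurable
      show "norm ((\<Sum>k<m. 2 * f k t) - G t) \<le> 1" for t
      proof (cases "\<exists>k. t \<in> B k")
        case True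
        then obtain k where k: "t \<in> B k" by blast
        show ?thesis using sum_in[OF k, of "\<lambda>_. 2" m] G_in[OF k] f1[of k t] by simp
      next
        case False then show ?thesis using sum_out[of t "\<lambda>_. 2" m] G_out[of t] by simp
      qed
    qed
  qed
qed

lemma functional_class_sum:
  fixes f :: "nat \<Rightarrow> 'x \<Rightarrow> 'k"
  assumes \<phi>: "\<phi> \<in> vcarrier (dual (L_infty M))" and f: "\<And>n. f n \<in> bounded_measurable M"
  shows "(\<lambda>t. \<Sum>k<m. c k * f k t) \<in> bounded_measurable M \<and>
    \<phi> (ae_class M (\<lambda>t. \<Sum>k<m. c k * f k t)) = (\<Sum>k<(m::nat). c k * \<phi> (ae_class M (f k)))"
proof (induction m)
  case 0
  have "\<phi> (ae_class M (\<lambda>t. 0 * 0)) = 0 * \<phi> (ae_class M (\<lambda>t. 0))"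
    by (rule functional_class_cmult[OF \<phi> bounded_measurable_const])
  then show ?case by (simp add: bounded_measurable_const)
next
  case (Suc m)
  have cf: "(\<lambda>t. c m * f m t) \<in> bounded_measurable M" by (intro bounded_measurable_mult bounded_measurable_const f)
  show ?case
    using Suc bounded_measurable_add[OF _ cf] functional_class_add[OF \<phi> _ cf] functional_class_cmult[OF \<phi> f, of "c m" m]
    by simp
qed

text \<open>
  The weak-star sum of the series of the functions \<open>f\<^sub>k\<close> in the bidual.
\<close>

definition series_functional :: "(nat \<Rightarrow> 'x \<Rightarrow> 'k) \<Rightarrow> (('x \<Rightarrow> 'k) set \<Rightarrow> 'k) \<Rightarrow> 'k" where
  "series_functional f = (\<lambda>\<phi>\<in>vcarrier (dual (L_infty M)). \<Sum>k. \<phi> (ae_class M (f k)))"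

context
  fixes B :: "nat \<Rightarrow> 'x set" and f :: "nat \<Rightarrow> 'x \<Rightarrow> 'k"
  assumes f: "\<And>n. f n \<in> unit_functions" and f0: "\<And>n t. t \<notin> B n \<Longrightarrow> f n t = 0"
    and dj: "\<And>m n. m \<noteq> n \<Longrightarrow> B m \<inter> B n = {}"
begin

lemma f_bounded: "f n \<in> bounded_measurable M"
  using f[of n] by (simp add: unit_functions_def)

text \<open>
  Rotating the summands turns the sum of moduli into one value of \<open>\<phi>\<close> at a function in the unit ball.
\<close>

lemma series_partial_le:
  assumes \<phi>: "\<phi> \<in> vcarrier (dual (L_infty M))"
  shows "(\<Sum>k<m. norm (\<phi> (ae_class M (f k)))) \<le> vnorm (dual (L_infty M)) \<phi>"
proof -
  let ?c = "\<lambda>k. csgn (\<phi> (ae_class M (f k)))"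
  let ?h = "\<lambda>t. \<Sum>k<m. ?c k * f k t"
  have h: "?h \<in> unit_functions"
  proof (rule disjoint_series[of f B, OF f f0 dj])
    fix G assume G: "\<And>m c. (\<And>k. norm (c k :: 'k) \<le> 1) \<Longrightarrow> (\<lambda>t. \<Sum>k<m. c k * f k t) \<in> unit_functions"
    show ?thesis by (rule G) simp
  qed
  have "of_real (\<Sum>k<m. norm (\<phi> (ae_class M (f k)))) = \<phi> (ae_class M ?h)"
    using functional_class_sum[OF \<phi> f_bounded, where m = m and c = ?c] by (simp add: csgn_mult_self)
  then have "(\<Sum>k<m. norm (\<phi> (ae_class M (f k)))) = norm (\<phi> (ae_class M ?h))"
    using norm_of_real[of "\<Sum>k<m. norm (\<phi> (ae_class M (f k)))", where 'a = 'k] sum_nonneg[of "{..<m}" "\<lambda>k. norm (\<phi> (ae_class M (f k)))"]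
    by (simp only: abs_of_nonneg norm_ge_zero)
  also have "\<dots> \<le> vnorm (dual (L_infty M)) \<phi> * 1"
    using h by (intro functional_class_le[OF \<phi>]) (auto simp: unit_functions_def)
  finally show ?thesis by simp
qed

lemma series_summable:
  assumes \<phi>: "\<phi> \<in> vcarrier (dual (L_infty M))"
  shows "summable (\<lambda>k. \<phi> (ae_class M (f k)))"
proof (rule summable_norm_cancel)
  show "summable (\<lambda>k. norm (\<phi> (ae_class M (f k))))"
    using series_partial_le[OF \<phi>]
    by (intro summableI_nonneg_bounded[where x = "vnorm (dual (L_infty M)) \<phi>"]) auto
qed

lemma series_functional_bidual: "series_functional f \<in> vcarrier (bidual (L_infty M))"
proof (rule dualI[where C = 1])
  show "series_functional f \<in> extensional (vcarrier (dual (L_infty M)))"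
    unfolding series_functional_def by (rule restrict_extensional)
  note cl = class_closed[OF f_bounded]
  show "series_functional f (vadd (dual (L_infty M)) \<phi> \<psi>) = series_functional f \<phi> + series_functional f \<psi>"
    if \<phi>: "\<phi> \<in> vcarrier (dual (L_infty M))" and \<psi>: "\<psi> \<in> vcarrier (dual (L_infty M))" for \<phi> \<psi>
    using suminf_add[OF series_summable[OF \<phi>] series_summable[OF \<psi>]] \<phi> \<psi> L'.add_closed[OF \<phi> \<psi>] cl
    by (simp add: series_functional_def) (simp add: dual_sel cl)
  show "series_functional f (vscale (dual (L_infty M)) c \<phi>) = c * series_functional f \<phi>"
    if \<phi>: "\<phi> \<in> vcarrier (dual (L_infty M))" for \<phi> c
    using suminf_mult[OF series_summable[OF \<phi>], of c] \<phi> L'.scale_closed[OF \<phi>] cl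
    by (simp add: series_functional_def) (simp add: dual_sel cl)
  show "norm (series_functional f \<phi>) \<le> 1 * vnorm (dual (L_infty M)) \<phi>"
    if \<phi>: "\<phi> \<in> vcarrier (dual (L_infty M))" for \<phi>
  proof -
    have "(\<lambda>m. \<Sum>k<m. \<phi> (ae_class M (f k))) \<longlonglongrightarrow> series_functional f \<phi>"
      using summable_LIMSEQ[OF series_summable[OF \<phi>]] \<phi> by (simp add: series_functional_def)
    then have "(\<lambda>m. norm (\<Sum>k<m. \<phi> (ae_class M (f k)))) \<longlonglongrightarrow> norm (series_functional f \<phi>)" by (rule tendsto_norm)
    moreover have "norm (\<Sum>k<m. \<phi> (ae_class M (f k))) \<le> 1 * vnorm (dual (L_infty M)) \<phi>" for m
      using order_trans[OF norm_sum series_partial_le[OF \<phi>]] by simp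
    ultimately show ?thesis by (intro LIMSEQ_le_const2) auto
  qed
qed

text \<open>
  The representative \<open>2x - G\<close> of the coset is the weak-star limit of functions in the unit ball, by
  the second part of \<open>disjoint_series\<close>. The factor two is what makes the lower bound for the residuum
  operator sharp: it compensates the norm of \<open>g\<^sub>n - h\<close>, which is only known to be at most two.
\<close>

lemma double_series_coset:
  "coset (bidual (L_infty M)) (embedded (L_infty M)) (vscale (bidual (L_infty M)) 2 (series_functional f))
    \<in> unit_ball (residuum (L_infty M))"
proof -
  interpret L'': seminormed_space "bidual (L_infty M) :: ('k, (('x \<Rightarrow> 'k) set \<Rightarrow> 'k) \<Rightarrow> 'k) nspace"
    by (intro seminormed_dual seminormed_L_infty)
  let ?x = "vscale (bidual (L_infty M)) 2 (series_functional f)"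
  have x: "?x \<in> vcarrier (bidual (L_infty M))" by (intro L''.scale_closed series_functional_bidual)
  obtain G where G: "G \<in> unit_functions" "\<And>m. (\<lambda>t. (\<Sum>k<m. 2 * f k t) - G t) \<in> unit_functions"
    "\<And>m c. (\<And>k. norm (c k :: 'k) \<le> 1) \<Longrightarrow> (\<lambda>t. \<Sum>k<m. c k * f k t) \<in> unit_functions"
    by (rule disjoint_series[of f B, OF f f0 dj], assumption, assumption) (rule that; (assumption | blast))
  have Gb: "G \<in> bounded_measurable M" using G(1) by (simp add: unit_functions_def)
  have mG: "(\<lambda>t. (- 1) * G t) \<in> bounded_measurable M" by (intro bounded_measurable_mult bounded_measurable_const Gb)
  let ?e = "canonical_embedding (L_infty M) (ae_class M (\<lambda>t. (- 1) * G t))"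
  let ?a = "vadd (bidual (L_infty M)) ?x ?e"
  let ?A = "coset (bidual (L_infty M)) (embedded (L_infty M)) ?x"
  have aA: "?a \<in> ?A" unfolding coset_def using class_closed[OF mG] by blast
  have "vnorm (bidual (L_infty M)) ?a \<le> 1"
  proof (rule dual_norm_le'[OF L'.seminormed_space_axioms])
    fix \<phi> :: "('x \<Rightarrow> 'k) set \<Rightarrow> 'k" assume \<phi>: "\<phi> \<in> vcarrier (dual (L_infty M))"
    let ?s = "\<lambda>m. (\<Sum>k<m. 2 * \<phi> (ae_class M (f k))) + (- 1) * \<phi> (ae_class M G)"
    have "norm (?s m) \<le> 1 * vnorm (dual (L_infty M)) \<phi>" for m
    proof -
      have s: "(\<lambda>t. \<Sum>k<m. 2 * f k t) \<in> bounded_measurable M"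
        "\<phi> (ae_class M (\<lambda>t. \<Sum>k<m. 2 * f k t)) = (\<Sum>k<m. 2 * \<phi> (ae_class M (f k)))"
        using functional_class_sum[OF \<phi> f_bounded, where m = m and c = "\<lambda>_. 2"] by auto
      have "?s m = \<phi> (ae_class M (\<lambda>t. (\<Sum>k<m. 2 * f k t) + (- 1) * G t))"
        using functional_class_add[OF \<phi> s(1) mG] s(2) functional_class_cmult[OF \<phi> Gb, of "- 1"] by simp
      also have "norm \<dots> \<le> vnorm (dual (L_infty M)) \<phi> * 1"
        using G(2)[of m] by (intro functional_class_le[OF \<phi>]) (auto simp: unit_functions_def)
      finally show ?thesis by simp
    qed
    moreover have "(\<lambda>m. norm (?s m)) \<longlonglongrightarrow> norm (?a \<phi>)"
    proof -
      have "(\<lambda>m. 2 * (\<Sum>k<m. \<phi> (ae_class M (f k))) + (- 1) * \<phi> (ae_class M G)) \<longlonglongrightarrow>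
          2 * series_functional f \<phi> + (- 1) * \<phi> (ae_class M G)"
        using summable_LIMSEQ[OF series_summable[OF \<phi>]] \<phi>
        by (intro tendsto_add tendsto_mult_left tendsto_const) (simp add: series_functional_def)
      moreover have "?a \<phi> = 2 * series_functional f \<phi> + (- 1) * \<phi> (ae_class M G)"
        using \<phi> functional_class_cmult[OF \<phi> Gb, of "- 1"] by (simp add: dual_sel emb_apply)
      ultimately show ?thesis by (intro tendsto_norm) (simp add: sum_distrib_left)
    qed
    ultimately show "norm (?a \<phi>) \<le> 1 * vnorm (dual (L_infty M)) \<phi>" by (intro LIMSEQ_le_const2) auto
  qed simp
  moreover have "vnorm (residuum (L_infty M)) ?A \<le> vnorm (bidual (L_infty M)) ?a"
    unfolding residuum_sel using coset_embedded_closed[OF LS x] aA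
    by (intro cINF_lower bdd_belowI2[of _ 0]) auto
  ultimately show ?thesis unfolding unit_ball_def residuum_sel(1) using x by simp
qed

end

end

context L_infty_operator
begin

text \<open>
  Let \<open>x\<close> be the sum of the series. An element \<open>a\<close> of the image coset is \<open>T''(2x)\<close> plus a vector \<open>w\<close>
  of \<open>F\<close>. On \<open>g\<^sub>n - h\<close>, a functional of norm at most two, \<open>w\<close> is small for infinitely many \<open>n\<close>,
  because \<open>h\<close> is a cluster point, and the first term is \<open>2(x(g\<^sub>n T) - x(h T))\<close>. In this difference the
  terms \<open>k < n\<close> nearly cancel, the terms \<open>k > n\<close> are small, and the term \<open>k = n\<close> contributes more than
  \<open>r - \<epsilon>\<close>. Hence \<open>2\<parallel>a\<parallel> \<ge> 2r\<close> up to a multiple of \<open>\<epsilon>\<close>.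
\<close>

lemma residuum_norm_ge_if_not_dominated:
  assumes sep: "separating F" and bad: "\<not> dominated_on (space M) r"
  shows "r \<le> op_norm (residuum (L_infty M)) (residuum F) (residuum_op (L_infty M) F T)"
proof (rule field_le_epsilon)
  fix e :: real assume e: "e > 0"
  define \<epsilon> where "\<epsilon> = e / 5"
  have \<epsilon>: "\<epsilon> > 0" using e by (simp add: \<epsilon>_def)
  obtain B g f h where bump: "\<And>n::nat. bump (B n) (g n) (f n) (r - \<epsilon>)" and dj: "\<And>m n. m \<noteq> n \<Longrightarrow> B m \<inter> B n = {}"
    and later: "\<And>m n. m < n \<Longrightarrow> norm (pullback (g m) (ae_class M (f n))) \<le> \<epsilon> * (1/2)^n"
    and earlier: "\<And>m n. m < n \<Longrightarrow> norm (pullback (g n) (ae_class M (f m)) - pullback h (ae_class M (f m))) \<le> \<epsilon> * (1/2)^n"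
    and h: "h \<in> unit_ball (dual F)"
    and cluster: "\<And>y e m. \<lbrakk>y \<in> vcarrier F; e > 0\<rbrakk> \<Longrightarrow> \<exists>n\<ge>m. norm (g n y - h y) < e"
    by (rule interpolating_sequence[OF bad \<epsilon>]) (rule that; (assumption | blast))
  have f: "f n \<in> unit_functions" and f0: "t \<notin> B n \<Longrightarrow> f n t = 0" and gb: "g n \<in> unit_ball (dual F)"
    and diag: "r - \<epsilon> < pullback (g n) (ae_class M (f n)) \<bullet> 1" for n t
    using bump[of n] by (auto simp: bump_def)
  have gd: "g n \<in> vcarrier (dual F)" for n using gb[of n] by (simp add: unit_ball_def)
  have hd: "h \<in> vcarrier (dual F)" using h by (simp add: unit_ball_def)
  define x1 where "x1 = series_functional f"
  have x1: "x1 \<in> vcarrier (bidual (L_infty M))"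
    unfolding x1_def by (rule series_functional_bidual[of f B, OF f f0 dj])
  have x1_eq: "x1 \<phi> = (\<Sum>k. \<phi> (ae_class M (f k)))" and x1_summable: "summable (\<lambda>k. \<phi> (ae_class M (f k)))"
    if "\<phi> \<in> vcarrier (dual (L_infty M))" for \<phi>
    using that series_summable[of f B, OF f f0 dj that] by (simp_all add: x1_def series_functional_def)
  let ?x = "vscale (bidual (L_infty M)) 2 x1"
  let ?A = "coset (bidual (L_infty M)) (embedded (L_infty M)) ?x"
  have A: "?A \<in> unit_ball (residuum (L_infty M))"
    unfolding x1_def by (rule double_series_coset[of f B, OF f f0 dj])
  have Ac: "?A \<in> vcarrier (residuum (L_infty M))" using A by (simp add: unit_ball_def)
  let ?R = "residuum_op (L_infty M) F T ?A"
  have a_ge: "r - e \<le> vnorm (bidual F) a" if a: "a \<in> ?R" for a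
  proof -
    have ab: "a \<in> vcarrier (bidual F)" using residuum_op_closed[OF T LS F Ac] a by blast
    obtain z y where zy: "z \<in> vcarrier (L_infty M)" "y \<in> vcarrier F"
      "a = vadd (bidual F) (biadjoint_op (L_infty M) F T (vadd (bidual (L_infty M)) ?x (canonical_embedding (L_infty M) z)))
        (canonical_embedding F y)"
      using a unfolding residuum_op_apply[OF Ac] by (auto simp: coset_def)
    define w where "w = vadd F (T z) y"
    have Tz: "T z \<in> vcarrier F" by (rule bops_closed[OF T zy(1)])
    have w: "w \<in> vcarrier F" unfolding w_def using Tz zy(2) by simp
    interpret L'': seminormed_space "bidual (L_infty M) :: ('k, (('x \<Rightarrow> 'k) set \<Rightarrow> 'k) \<Rightarrow> 'k) nspace"
      by (intro seminormed_dual seminormed_L_infty)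
    have x': "vadd (bidual (L_infty M)) ?x (canonical_embedding (L_infty M) z) \<in> vcarrier (bidual (L_infty M))"
      using x1 emb_bidual(1)[OF LS zy(1)] by blast
    have a_apply: "a u = 2 * x1 (pullback u) + u w" if u: "u \<in> vcarrier (dual F)" for u
    proof -
      have pu: "pullback u \<in> vcarrier (dual (L_infty M))" using u by (rule pullback_dual)
      have "a u = biadjoint_op (L_infty M) F T (vadd (bidual (L_infty M)) ?x (canonical_embedding (L_infty M) z)) u + u y"
        using u unfolding zy(3) by (simp add: dual_sel emb_apply)
      also have "biadjoint_op (L_infty M) F T (vadd (bidual (L_infty M)) ?x (canonical_embedding (L_infty M) z)) u
          = 2 * x1 (pullback u) + pullback u z"
        using biadjoint_apply[OF T LS F x' u] pu by (simp add: pullback_def dual_sel emb_apply)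
      also have "pullback u z = u (T z)" using u zy(1) by (rule pullback_apply)
      finally show ?thesis using dual_add[OF u Tz zy(2)] by (simp add: w_def)
    qed
    have ph: "pullback h \<in> vcarrier (dual (L_infty M))" using hd by (rule pullback_dual)
    have "(\<lambda>n. \<Sum>k<n. pullback h (ae_class M (f k))) \<longlonglongrightarrow> x1 (pullback h)"
      unfolding x1_eq[OF ph] by (rule summable_LIMSEQ[OF x1_summable[OF ph]])
    then obtain N where N: "\<And>n. n \<ge> N \<Longrightarrow> norm ((\<Sum>k<n. pullback h (ae_class M (f k))) - x1 (pullback h)) < \<epsilon>"
      using LIMSEQ_D \<epsilon> by blast
    obtain n where n: "n \<ge> N" "norm (g n w - h w) < \<epsilon>" using cluster[OF w \<epsilon>, of N] by blast
    let ?\<phi> = "\<lambda>k. pullback (g n) (ae_class M (f k))" and ?a = "\<lambda>k. pullback h (ae_class M (f k))"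
    have pg: "pullback (g n) \<in> vcarrier (dual (L_infty M))" using gd by (rule pullback_dual)
    \<comment> \<open>t collects the terms after n, d the differences before n, and s, up to sign, the tail of the series at the cluster point\<close>
    define t where "t = (\<Sum>k. ?\<phi> (k + Suc n))"
    have t: "norm t \<le> \<epsilon>"
    proof -
      have gs: "(\<lambda>k. \<epsilon> * (1/2)^(Suc n) * (1/2)^k) sums (\<epsilon> * (1/2)^(Suc n) * 2)"
        using geometric_sums[of "1/2::real"] by (intro sums_mult) simp
      have "norm (?\<phi> (k + Suc n)) \<le> \<epsilon> * (1/2)^(Suc n) * (1/2)^k" for k
        using later[of n "k + Suc n"] by (simp add: power_add mult_ac)
      then have "norm t \<le> (\<Sum>k. \<epsilon> * (1/2)^(Suc n) * (1/2)^k)"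
        unfolding t_def using gs by (intro norm_suminf_le) (auto simp: sums_iff)
      also have "\<dots> = \<epsilon> * (1/2)^n" using gs by (simp add: sums_iff)
      also have "\<dots> \<le> \<epsilon> * 1" using \<epsilon> by (intro mult_left_mono power_le_one) auto
      finally show ?thesis by simp
    qed
    define d where "d = (\<Sum>k<n. ?\<phi> k - ?a k)"
    have d: "norm d \<le> \<epsilon>"
    proof -
      have "norm d \<le> (\<Sum>k<n. \<epsilon> * (1/2)^n)" unfolding d_def
      proof (rule sum_norm_le)
        show "norm (?\<phi> k - ?a k) \<le> \<epsilon> * (1/2)^n" if "k \<in> {..<n}" for k using earlier[of k n] that by simp
      qed
      also have "\<dots> = \<epsilon> * (real n * (1/2)^n)" by simp
      also have "\<dots> \<le> \<epsilon> * 1"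
      proof (intro mult_left_mono)
        have "real n < 2 ^ n" by (rule of_nat_less_two_power)
        then show "real n * (1/2)^n \<le> 1" by (simp add: power_divide field_simps)
      qed (use \<epsilon> in simp)
      finally show ?thesis by simp
    qed
    define s where "s = (\<Sum>k<n. ?a k) - x1 (pullback h)"
    have s: "norm s < \<epsilon>" unfolding s_def by (rule N[OF n(1)])
    have "x1 (pullback (g n)) = t + (\<Sum>k<Suc n. ?\<phi> k)"
      unfolding x1_eq[OF pg] t_def by (rule suminf_split_initial_segment[OF x1_summable[OF pg]])
    then have eq: "x1 (pullback (g n)) - x1 (pullback h) = t + d + s + ?\<phi> n"
      by (simp add: d_def s_def sum_subtractf)
    have re: "r - 4 * \<epsilon> \<le> (x1 (pullback (g n)) - x1 (pullback h)) \<bullet> 1"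
      unfolding eq inner_add_left
      using t d s diag[of n] abs_re_le_norm[of t] abs_re_le_norm[of d] abs_re_le_norm[of s] by linarith
    let ?u = "vdiff (dual F) (g n) h"
    have "a ?u = a (g n) - a h" by (rule dual_diff[OF ab F'.seminormed_space_axioms gd hd])
    also have "\<dots> = 2 * (x1 (pullback (g n)) - x1 (pullback h)) + (g n w - h w)"
      unfolding a_apply[OF gd] a_apply[OF hd] by (simp add: algebra_simps)
    finally have au: "a ?u = 2 * (x1 (pullback (g n)) - x1 (pullback h)) + (g n w - h w)" .
    have two: "(2 * q) \<bullet> 1 = 2 * (q \<bullet> 1)" for q :: 'k
      by (simp only: mult_2 inner_add_left)
    have "- \<epsilon> \<le> (g n w - h w) \<bullet> 1"
      using n(2) abs_re_le_norm[of "g n w - h w"] by linarith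
    then have "2 * (r - 4 * \<epsilon>) + - \<epsilon> \<le> a ?u \<bullet> 1"
      unfolding au inner_add_left two using re by (intro add_mono mult_left_mono) auto
    then have "2 * (r - 4 * \<epsilon>) - \<epsilon> \<le> a ?u \<bullet> 1" by simp
    also have "\<dots> \<le> norm (a ?u)" by (rule re_le_norm)
    also have "\<dots> \<le> vnorm (bidual F) a * vnorm (dual F) ?u"
      by (rule dual_norm_bound[OF ab F'.seminormed_space_axioms F'.diff_closed[OF gd hd]])
    also have "\<dots> \<le> vnorm (bidual F) a * 2"
    proof (intro mult_left_mono)
      interpret F'': seminormed_space "bidual F" using F by (intro seminormed_dual)
      show "vnorm (dual F) ?u \<le> 2"
        using F'.norm_diff_le[OF gd hd, of n] gb[of n] h by (simp add: unit_ball_def)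
      show "0 \<le> vnorm (bidual F) a" using ab by (rule F''.norm_nonneg)
    qed
    finally show ?thesis using \<epsilon> by (simp add: \<epsilon>_def)
  qed
  have "?R \<noteq> {}" unfolding residuum_op_apply[OF Ac]
    using L.nonempty F.nonempty by (auto simp: coset_def)
  then have "r - e \<le> vnorm (residuum F) ?R"
    unfolding residuum_sel using a_ge by (intro cINF_greatest)
  also have "\<dots> \<le> op_norm (residuum (L_infty M)) (residuum F) (residuum_op (L_infty M) F T)"
    by (rule residuum_op_norm_bdd[OF T LS F sep A])
  finally show "r \<le> op_norm (residuum (L_infty M)) (residuum F) (residuum_op (L_infty M) F T) + e" by simp
qed

lemma residuum_norm_nonneg:
  assumes sep: "separating F"
  shows "0 \<le> op_norm (residuum (L_infty M)) (residuum F) (residuum_op (L_infty M) F T)"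
proof -
  interpret F'': seminormed_space "bidual F" using F by (intro seminormed_dual)
  obtain A where A: "A \<in> unit_ball (residuum (L_infty M :: ('k, ('x \<Rightarrow> 'k) set) nspace))"
    using residuum_ball_nonempty[OF LS] by blast
  then have Ac: "A \<in> vcarrier (residuum (L_infty M))" by (simp add: unit_ball_def)
  have "residuum_op (L_infty M) F T A \<noteq> {}"
    unfolding residuum_op_apply[OF Ac] using Ac L.nonempty F.nonempty by (auto simp: residuum_sel coset_def)
  then have "0 \<le> vnorm (residuum F) (residuum_op (L_infty M) F T A)"
    unfolding residuum_sel using residuum_op_closed[OF T LS F Ac] by (intro cINF_greatest) auto
  also have "\<dots> \<le> op_norm (residuum (L_infty M)) (residuum F) (residuum_op (L_infty M) F T)"
    by (rule residuum_op_norm_bdd[OF T LS F sep A])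
  finally show ?thesis .
qed

text \<open>
  Scale the bounded representative of \<open>x\<close> into the unit ball.
\<close>

lemma dominated_bound:
  assumes "dominated_on (space M) r"
  obtains \<mu> where "charge M \<mu>"
    "\<And>x. x \<in> vcarrier (L_infty M) \<Longrightarrow> vnorm F (T x) \<le> charge.charge_norm M \<mu> x + r * vnorm (L_infty M) x"
proof -
  obtain \<mu> where \<mu>: "charge M \<mu>" "\<And>f. f \<in> unit_functions \<Longrightarrow>
     image_norm (\<lambda>t. indicator (space M) t *\<^sub>R f t) \<le> \<mu> (\<lambda>t. norm (f t)) + r"
    using assms unfolding dominated_on_def by blast
  interpret charge M \<mu> by (rule \<mu>(1))
  have "vnorm F (T x) \<le> charge_norm x + r * vnorm (L_infty M) x" if x: "x \<in> vcarrier (L_infty M)" for x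
  proof -
    let ?n = "vnorm (L_infty M) x" and ?f = "representative M x"
    have fb: "?f \<in> bounded_measurable M" using x by (rule representative_bounded)
    show ?thesis
    proof (cases "?n = 0")
      case True
      have "vnorm F (T x) \<le> op_norm (L_infty M) F T * ?n" by (rule op_norm_bound[OF T LS F x])
      moreover have "0 \<le> charge_norm x" unfolding charge_norm_def by (intro nonneg nonneg_bounded_norm fb)
      ultimately show ?thesis using True by simp
    next
      case False
      then have n: "?n > 0" using L.norm_nonneg[OF x] by simp
      let ?h = "\<lambda>t. of_real (inverse ?n) * ?f t"
      have nh: "norm (?h t) = inverse ?n * norm (?f t)" for t
        unfolding norm_mult norm_of_real using n by simp
      have hb: "?h \<in> bounded_measurable M" by (intro bounded_measurable_mult bounded_measurable_const fb)
      have "norm (?h t) \<le> 1" for t unfolding nh using representative_le[OF x, of t] n by (simp add: field_simps)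
      then have hu: "?h \<in> unit_functions" using hb by (simp add: unit_functions_def)
      have rb: "(\<lambda>t. indicator (space M) t *\<^sub>R ?h t) \<in> bounded_measurable M" by (intro restrict_bounded hb) simp
      have "AE t in M. indicator (space M) t *\<^sub>R ?h t = ?h t" by (intro AE_I2) simp
      then have "ae_class M (\<lambda>t. indicator (space M) t *\<^sub>R ?h t) = ae_class M ?h"
        using ae_class_eq_iff[OF bounded_measurable_ess_bounded[OF rb] bounded_measurable_ess_bounded[OF hb]] by blast
      then have "image_norm ?h = image_norm (\<lambda>t. indicator (space M) t *\<^sub>R ?h t)" by (simp add: image_norm_def)
      also have "\<dots> \<le> \<mu> (\<lambda>t. norm (?h t)) + r" by (rule \<mu>(2)[OF hu])
      also have "\<mu> (\<lambda>t. norm (?h t)) = inverse ?n * charge_norm x"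
        unfolding nh charge_norm_def using n by (intro cmult nonneg_bounded_norm fb) auto
      finally have "inverse ?n * vnorm F (T x) \<le> inverse ?n * charge_norm x + r"
        unfolding image_norm_cmult[OF fb] norm_of_real image_norm_def ae_class_representative[OF x] using n by simp
      then show ?thesis using n by (simp add: field_simps)
    qed
  qed
  then show ?thesis using that \<mu>(1) by blast
qed

end

section \<open>Equality of the four quantities\<close>

text \<open>
  Any level \<open>r\<close> above the norm of the residuum operator admits a dominating charge, and the
  decomposition of \<open>T\<close> for this charge has a weakly compact part and a remainder of norm at most
  \<open>r\<close>.
\<close>

theorem (in finite_measure) weak_essential_norm_le_residuum:
  fixes T :: "('a \<Rightarrow> 'k::{real_normed_field,euclidean_space}) set \<Rightarrow> ('a \<Rightarrow> 'k) set"
  assumes T: "T \<in> vcarrier (bounded_ops (L_infty M) (L_infty M))"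
  shows "weak_essential_norm (L_infty M) (L_infty M) T
    \<le> op_norm (residuum (L_infty M)) (residuum (L_infty M)) (residuum_op (L_infty M) (L_infty M) T)"
proof (rule dense_ge)
  let ?L = "L_infty M :: ('k, ('a \<Rightarrow> 'k) set) nspace"
  have L: "seminormed_space ?L" by (rule seminormed_L_infty)
  interpret L: seminormed_space ?L by (rule L)
  interpret L_infty_operator M ?L T using L T by unfold_locales
  fix r assume r: "op_norm (residuum ?L) (residuum ?L) (residuum_op ?L ?L T) < r"
  then have "dominated_on (space M) r" using residuum_norm_ge_if_not_dominated[OF separating_L_infty] by force
  then obtain \<mu> where \<mu>: "charge M \<mu>"
    "\<And>x. x \<in> vcarrier ?L \<Longrightarrow> vnorm ?L (T x) \<le> charge.charge_norm M \<mu> x + r * vnorm ?L x"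
    by (rule dominated_bound) (rule that; (assumption | blast))
  interpret \<mu>: charge M \<mu> by (rule \<mu>(1))
  have r0: "0 \<le> r" using residuum_norm_nonneg[OF separating_L_infty] r by linarith
  obtain W where W: "W \<in> vcarrier (bounded_ops ?L ?L)"
    "\<And>x. x \<in> vcarrier ?L \<Longrightarrow> vnorm ?L (W x) \<le> \<mu>.charge_norm x"
    "\<And>x. x \<in> vcarrier ?L \<Longrightarrow> vnorm ?L (vdiff ?L (T x) (W x)) \<le> r * vnorm ?L x"
    using L_infty_operator_decomposition[OF L T \<mu>.charge_norm_add \<mu>.charge_norm_scale \<mu>.charge_norm_le r0 \<mu>(2)]
    by blast
  obtain P where P: "P \<in> vcarrier (bounded_ops (bidual ?L) ?L)"
    "\<And>z. z \<in> vcarrier (bidual ?L) \<Longrightarrow> vnorm ?L (P z) \<le> vnorm (bidual ?L) z"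
    "\<And>y. y \<in> vcarrier ?L \<Longrightarrow> P (canonical_embedding ?L y) = y"
    using L_infty_bidual_projection by blast
  have wc: "weakly_compact_op ?L ?L W"
    by (rule \<mu>.weakly_compact_op_if_charge_dominated[OF L separating_L_infty P W(1,2)])
  have "weak_essential_norm ?L ?L T \<le> op_norm ?L ?L (vdiff (bounded_ops ?L ?L) T W)"
    by (rule weak_essential_norm_le[OF T L L wc])
  also have "\<dots> \<le> r"
  proof (rule op_norm_le'[OF L _ r0])
    fix x assume x: "x \<in> vcarrier ?L"
    have "vdiff (bounded_ops ?L ?L) T W x = vdiff ?L (T x) (W x)"
      using x by (simp add: vdiff_def bounded_ops_sel)
    then show "vnorm ?L (vdiff (bounded_ops ?L ?L) T W x) \<le> r * vnorm ?L x" using W(3)[OF x] by simp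
  qed
  finally show "weak_essential_norm ?L ?L T \<le> r" .
qed

theorem (in finite_measure) L_infty_weak_noncompactness_equalities:
  fixes T :: "('a \<Rightarrow> 'k::{real_normed_field,euclidean_space}) set \<Rightarrow> ('a \<Rightarrow> 'k) set"
  assumes T: "T \<in> vcarrier (bounded_ops (L_infty M) (L_infty M))"
  shows "weak_essential_norm (L_infty M) (L_infty M) T
      = weak_essential_norm (dual (L_infty M)) (dual (L_infty M)) (adjoint_op (L_infty M) (L_infty M) T) \<and>
    weak_essential_norm (dual (L_infty M)) (dual (L_infty M)) (adjoint_op (L_infty M) (L_infty M) T)
      = op_norm (residuum (L_infty M)) (residuum (L_infty M)) (residuum_op (L_infty M) (L_infty M) T) \<and>
    op_norm (residuum (L_infty M)) (residuum (L_infty M)) (residuum_op (L_infty M) (L_infty M) T)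
      = de_blasi_op (L_infty M) (L_infty M) T"
proof -
  let ?L = "L_infty M :: ('k, ('a \<Rightarrow> 'k) set) nspace"
  have L: "seminormed_space ?L" by (rule seminormed_L_infty)
  have sep: "separating ?L" by (rule separating_L_infty)
  obtain P where P: "P \<in> vcarrier (bounded_ops (bidual ?L) ?L)"
    "\<And>z. z \<in> vcarrier (bidual ?L) \<Longrightarrow> vnorm ?L (P z) \<le> vnorm (bidual ?L) z"
    "\<And>y. y \<in> vcarrier ?L \<Longrightarrow> P (canonical_embedding ?L y) = y"
    using L_infty_bidual_projection by blast
  show ?thesis
    using weak_essential_norm_adjoint_le[OF T L L sep] weak_essential_norm_le_adjoint[OF T L L sep P]
      residuum_op_norm_le_de_blasi[OF T L L sep] de_blasi_op_le_weak_essential_norm[OF T L L sep]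
      weak_essential_norm_le_residuum[OF T] by linarith
qed

lemma finite_measure_lebesgue_on_01: "finite_measure (lebesgue_on {0..1::real})"
  by (rule finite_measureI) (simp add: emeasure_restrict_space)

theorem theorem1p14:
  shows
    "(let E = (L_infty_01 :: (real, (real \<Rightarrow> real) set) nspace) in
       \<forall>T \<in> vcarrier (bounded_ops E E).
         weak_essential_norm E E T = weak_essential_norm (dual E) (dual E) (adjoint_op E E T) \<and>
         weak_essential_norm (dual E) (dual E) (adjoint_op E E T)
           = op_norm (residuum E) (residuum E) (residuum_op E E T) \<and>
         op_norm (residuum E) (residuum E) (residuum_op E E T) = de_blasi_op E E T)
     \<and>
     (let E = (L_infty_01 :: (complex, (real \<Rightarrow> complex) set) nspace) in
       \<forall>T \<in> vcarrier (bounded_ops E E).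
         weak_essential_norm E E T = weak_essential_norm (dual E) (dual E) (adjoint_op E E T) \<and>
         weak_essential_norm (dual E) (dual E) (adjoint_op E E T)
           = op_norm (residuum E) (residuum E) (residuum_op E E T) \<and>
         op_norm (residuum E) (residuum E) (residuum_op E E T) = de_blasi_op E E T)"
  unfolding Let_def
  by (rule conjI; rule ballI;
      rule finite_measure.L_infty_weak_noncompactness_equalities[OF finite_measure_lebesgue_on_01])

end
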